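(* Let $\epsilon\in(0,1/2)$ and let $(m_i)$, $(r_i)$ be sequences of positive integers with $\lim_{i\to\infty}m_i=\infty$ and $\limsup_{i\to\infty}\binom{m_i}{\le r_i}2^{-m_i}<1-H(\epsilon)$. There exist $c,c',c''>0$ such that, if $f$ is drawn uniformly from $RM(m_i,r_i)$ and $\tilde f$ is obtained from $f$ by flipping each coordinate independently with probability $\epsilon$, then as $i\to\infty$ the algorithm $\mathrm{RMRec2}(m_i,r_i,\epsilon,\tilde f,c,c')$ returns $f$ with probability $1-O(2^{-2^{c''\sqrt{m_i}}})$.
   Context: $H$ is the binary entropy function and $\binom{m}{\le r}=\sum_{j=0}^r\binom mj$. $RM(m,r)$ is the set of evaluation vectors $(f(x))_{x\in\mathbb{F}_2^m}$ of polynomials over $\mathbb{F}_2$ in $m$ variables of degree at most $r$. Algorithm $\mathrm{RMRec}(M,r,\epsilon,g,c')$ for $g\in\{0,1\}^{\mathbb{F}_2^M}$: (1) for each $x$ let $\hat g(x)$ be the most likely value of the codeword bit at $x$ given all of $g$, assuming a uniform codeword of $RM(M,r)$ sent through a channel flipping each bit independently with probability $\epsilon$ (uniformly random if tied); (2) let $\ell$ be the list of all elements of $RM(M,r)$ disagreeing with $\hat g$ on at most $2^{M-c'\sqrt M\log_2(M)/2}/2$ coordinates; (3) return the element of $\ell$ agreeing with $g$ on the most coordinates (ties uniformly at random). Algorithm $\mathrm{RMRec2}(m,r,\epsilon,\tilde f,c,c')$: (1) let $m'=\lceil\sqrt m/c\rceil$; (2) partition the coordinate indices $\{1,\dots,m\}$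 of $\mathbb{F}_2^m$ into sets $S_1,\dots,S_{m'}$ with sizes as close to equal as possible; (3) for each $1\le j\le m'$ and $x\in\{0,1\}^{S_j}$, let $\tilde f_{S_j,x}$ be the restriction of $\tilde f$ to the points whose coordinates indexed by $S_j$ equal $x$ (viewed as a word indexed by $\mathbb{F}_2^{m-|S_j|}$; the corresponding restriction of $f$ lies in $RM(m-|S_j|,r)$), and set $f^{(j,x)}=\mathrm{RMRec}(m-|S_j|,r,\epsilon,\tilde f_{S_j,x},c')$; (4) for each $y\in\mathbb{F}_2^m$ set $\hat f(y)$ to the most common value of $f^{(j,y_{S_j})}(y)$ over $1\le j\le m'$, where $y_{S_j}$ is the substring of $y$ indexed by $S_j$; (5) let $\ell$ be the list of all elements of $RM(m,r)$ disagreeing with $\hat f$ on at most $2^{m-\sqrt m\log_2(m)}/2$ coordinates; (6) return the element of $\ell$ agreeing with $\tilde f$ on the largest number of coordinates. *)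

theory Defs
  imports "HOL-Probability.Probability" "HOL-Library.Landau_Symbols"
begin

text \<open>Points of F_2^m are boolean lists of length m; words are maps from points to bits,
  extensional (False outside the points of the relevant length).\<close>
type_synonym point = "bool list"
type_synonym word = "bool list \<Rightarrow> bool"

definition bin_entropy :: "real \<Rightarrow> real" where
  "bin_entropy p = - p * log 2 p - (1 - p) * log 2 (1 - p)"

definition binom_le :: "nat \<Rightarrow> nat \<Rightarrow> nat" where
  "binom_le m r = (\<Sum>j\<le>r. m choose j)"

definition points :: "nat \<Rightarrow> point set" where
  "points m = {x. length x = m}"

text \<open>A polynomial over F_2 in variables x_0..x_(m-1) is a finite set A of monomials
  (exponent vectors e, supported on indices below m) -- the monomials with coefficient 1.
  Its degree is at most r iff every monomial has total degree at most r.
  The monomial e evaluates to 1 at x iff x_i = 1 whenever e i > 0.\<close>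
definition RM :: "nat \<Rightarrow> nat \<Rightarrow> word set" where
  "RM m r = {w. \<exists>A. finite A \<and>
      A \<subseteq> {e :: nat \<Rightarrow> nat. (\<forall>i\<ge>m. e i = 0) \<and> (\<Sum>i<m. e i) \<le> r} \<and>
      (\<forall>x. w x = (x \<in> points m \<and> odd (card {e\<in>A. \<forall>i<m. 0 < e i \<longrightarrow> x ! i})))}"

definition hdist :: "nat \<Rightarrow> word \<Rightarrow> word \<Rightarrow> nat" where
  "hdist M v w = card {x\<in>points M. v x \<noteq> w x}"

definition agree :: "nat \<Rightarrow> word \<Rightarrow> word \<Rightarrow> nat" where
  "agree M v w = card {x\<in>points M. v x = w x}"

definition best_agree :: "nat \<Rightarrow> word \<Rightarrow> word set \<Rightarrow> word set" where
  "best_agree M g L = {v\<in>L. \<forall>w\<in>L. agree M w g \<le> agree M v g}"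

text \<open>Likelihood of receiving g when codeword c was sent through BSC(eps);
  with a uniform prior this is proportional to the posterior of c given g.\<close>
definition lik :: "real \<Rightarrow> nat \<Rightarrow> word \<Rightarrow> word \<Rightarrow> real" where
  "lik eps M c g = eps ^ hdist M c g * (1 - eps) ^ (2 ^ M - hdist M c g)"

definition bit_MAP :: "real \<Rightarrow> nat \<Rightarrow> nat \<Rightarrow> word \<Rightarrow> point \<Rightarrow> bool pmf" where
  "bit_MAP eps M r g x =
     (let pT = (\<Sum>c\<in>{c\<in>RM M r. c x}. lik eps M c g);
          pF = (\<Sum>c\<in>{c\<in>RM M r. \<not> c x}. lik eps M c g)
      in if pF < pT then return_pmf True
         else if pT < pF then return_pmf False
         else bernoulli_pmf (1/2))"

text \<open>RMRec(M, r, eps, g, c'). If the list is empty (not specified in the paper) the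
  decoder outputs the bitwise estimate.\<close>
definition RMRec :: "nat \<Rightarrow> nat \<Rightarrow> real \<Rightarrow> word \<Rightarrow> real \<Rightarrow> word pmf" where
  "RMRec M r eps g c' =
     bind_pmf (Pi_pmf (points M) False (\<lambda>x. bit_MAP eps M r g x)) (\<lambda>gh.
       (let L = {v\<in>RM M r. real (hdist M v gh)
                  \<le> 2 powr (real M - c' * sqrt (real M) * log 2 (real M) / 2) / 2}
        in if L = {} then return_pmf gh else pmf_of_set (best_agree M g L)))"

text \<open>Sub-point indexed by S (coordinates in increasing order), the complementary
  sub-point, and the inverse: merging an assignment u on S with z on the complement.\<close>
definition key :: "nat set \<Rightarrow> point \<Rightarrow> point" where
  "key S y = map (\<lambda>k. y ! k) (sorted_list_of_set S)"

definition proj :: "nat \<Rightarrow> nat set \<Rightarrow> point \<Rightarrow> point" where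
  "proj m S y = map (\<lambda>k. y ! k) (sorted_list_of_set ({..<m} - S))"

definition merge :: "nat \<Rightarrow> nat set \<Rightarrow> point \<Rightarrow> point \<Rightarrow> point" where
  "merge m S u z = map (\<lambda>k. if k \<in> S then u ! card {k'\<in>S. k' < k}
                             else z ! card {k'\<in>{..<m} - S. k' < k}) [0..<m]"

definition restr :: "nat \<Rightarrow> nat set \<Rightarrow> word \<Rightarrow> point \<Rightarrow> word" where
  "restr m S g u = (\<lambda>z. if z \<in> points (m - card S) then g (merge m S u z) else False)"

definition balanced_partition :: "nat \<Rightarrow> nat \<Rightarrow> (nat \<Rightarrow> nat set) \<Rightarrow> bool" where
  "balanced_partition m m' P \<longleftrightarrow>
     (\<forall>j<m'. P j \<subseteq> {..<m}) \<and> (\<Union>j<m'. P j) = {..<m} \<and>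
     (\<forall>j<m'. \<forall>k<m'. j \<noteq> k \<longrightarrow> P j \<inter> P k = {}) \<and>
     (\<forall>j<m'. \<forall>k<m'. card (P j) \<le> card (P k) + 1)"

definition num_parts :: "nat \<Rightarrow> real \<Rightarrow> nat" where
  "num_parts m c = nat \<lceil>sqrt (real m) / c\<rceil>"

text \<open>RMRec2(m, r, eps, ft, c, c') with partition P (P j = S_(j+1)). Independent runs of
  RMRec for every (j, x); majority vote (uniformly random on ties); list decoding; output
  None if the list is empty (failure), otherwise a best-agreeing element (random ties).\<close>
definition RMRec2 :: "nat \<Rightarrow> nat \<Rightarrow> real \<Rightarrow> word \<Rightarrow> real \<Rightarrow> real \<Rightarrow> (nat \<Rightarrow> nat set)
                      \<Rightarrow> word option pmf" where
  "RMRec2 m r eps ft c c' P =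
     (let m' = num_parts m c;
          I = {(j, u). j < m' \<and> u \<in> points (card (P j))}
      in bind_pmf (Pi_pmf I (\<lambda>_. False)
                     (\<lambda>(j, u). RMRec (m - card (P j)) r eps (restr m (P j) ft u) c')) (\<lambda>F.
         (let votes = (\<lambda>y. card {j\<in>{..<m'}. F (j, key (P j) y) (proj m (P j) y)})
          in bind_pmf (Pi_pmf (points m) False (\<lambda>y.
                 if m' < 2 * votes y then return_pmf True
                 else if 2 * votes y < m' then return_pmf False
                 else bernoulli_pmf (1/2))) (\<lambda>fh.
             (let L = {v\<in>RM m r. real (hdist m v fh)
                        \<le> 2 powr (real m - sqrt (real m) * log 2 (real m)) / 2}
              in if L = {} then return_pmf None
                 else map_pmf Some (pmf_of_set (best_agree m ft L)))))))"

definition success_prob :: "nat \<Rightarrow> nat \<Rightarrow> real \<Rightarrow> real \<Rightarrow> real \<Rightarrow> (nat \<Rightarrow> nat set) \<Rightarrow> real" where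
  "success_prob m r eps c c' P =
     pmf (bind_pmf (pmf_of_set (RM m r)) (\<lambda>f.
          bind_pmf (Pi_pmf (points m) False (\<lambda>_. bernoulli_pmf eps)) (\<lambda>e.
            map_pmf (\<lambda>out. out = Some f) (RMRec2 m r eps (\<lambda>x. f x \<noteq> e x) c c' P)))) True"

end

theory Submission
  imports Defs "HOL-Real_Asymp.Real_Asymp"
begin

text \<open>
  Bit error of RM. Since the rate is below capacity, the chain rule for the divergence from the
  uniform distribution shows that a codeword bit correlates by a constant with its posterior mean
  given the other received bits, also for the restrictions of the code to subspaces of codimension
  \<open>O(sqrt m)\<close>. Restrict to about \<open>m\<close> such subspaces through the point, any two of which meet in a common kernel, and
  take the vote. Given the noise on the kernel the votes are independent, so it suffices that the
  conditional mean of a vote rarely moves. Its Fourier expansion is invariant under shears, and a random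
  shear moves a set of size \<open>s\<close> into the kernel with probability at most \<open>(s + 1) ^ (-k)\<close>, where \<open>k\<close> is
  the codimension of the kernel in a petal. The coefficients of sets larger than
  a small power of \<open>m\<close> are then negligible in L2, the others by hypercontractivity in a high
  moment, and the error is \<open>2 ^ (-\<Omega>(sqrt m log m))\<close>.

  Block error. A codeword of weight below \<open>2 ^ (m - l - 4)\<close> is the majority of \<open>O(m)\<close>
  derivatives of order \<open>l\<close>, each described by a codeword of \<open>RM(m - l, r - l)\<close>. For \<open>l\<close> of order
  \<open>sqrt m log m\<close> there are so few of these that the union bound over light codewords succeeds. By
  Markov's inequality RMRec fails with probability \<open>2 ^ (-\<Omega>(sqrt m log m))\<close>.

  RMRec2. For a fixed part the restrictions are disjoint, so the number of failing blocks is
  concentrated with doubly exponential probability. The keys of a point with respect to different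
  parts are independent, so the vote is wrong at a fraction of at most
  \<open>2 ^ (-sqrt m log m) / 2\<close> of the points, and list decoding finishes as before.
\<close>

subsection \<open>Reed--Muller codes\<close>

text \<open>The scale \<open>sqrt m\<close> comes from the rate: fixing one variable raises it by at
  most about \<open>1 / sqrt m\<close>, so a constant gap to capacity pays for a small multiple of
  \<open>sqrt m\<close> variables. That is the codimension available both to the petals and to the
  parts of RMRec2. The obstacle is the extra \<open>log m\<close> in the exponent. The entropy
  argument gives only a constant correlation, whereas the union bound over codewords is available
  here only for weights below \<open>2 ^ (m - l)\<close> with \<open>l\<close> of order
  \<open>sqrt m * log m\<close>, so the bit error must reach this level. Every source of error has
  to gain the logarithm: the vote by having order \<open>m\<close> instead of \<open>sqrt m\<close>
  petals, large Fourier sets because a power of \<open>m\<close> is raised to the power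
  \<open>k\<close> of order \<open>sqrt m\<close>, small sets by a moment whose order exceeds
  \<open>log m\<close>. By linearity all error bounds refer to the noise alone, and the transmitted
  codeword drops out.\<close>

definition monomials :: "nat \<Rightarrow> nat \<Rightarrow> (nat \<Rightarrow> nat) set" where
  "monomials m r = {e. (\<forall>i\<ge>m. e i = 0) \<and> (\<Sum>i<m. e i) \<le> r}"

definition monom_word :: "nat \<Rightarrow> (nat \<Rightarrow> nat) \<Rightarrow> word" where
  "monom_word m e x \<longleftrightarrow> x \<in> points m \<and> (\<forall>i<m. 0 < e i \<longrightarrow> x ! i)"

definition wxor :: "('a \<Rightarrow> bool) \<Rightarrow> ('a \<Rightarrow> bool) \<Rightarrow> 'a \<Rightarrow> bool" where
  "wxor u v = (\<lambda>x. u x \<noteq> v x)"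

lemma wxor_apply [simp]: "wxor u v x \<longleftrightarrow> u x \<noteq> v x"
  by (simp add: wxor_def)

lemma wxor_zero [simp]: "wxor u (\<lambda>_. False) = u" "wxor (\<lambda>_. False) u = u"
  by (auto simp: wxor_def)

lemma wxor_cancel: "wxor u (wxor u v) = v"
  by (auto simp: fun_eq_iff)

lemma finite_points [simp, intro]: "finite (points m)"
  using finite_lists_length_eq[of "UNIV :: bool set" m] by (simp add: points_def)

lemma card_points [simp]: "card (points m) = 2 ^ m"
  using card_lists_length_eq[of "UNIV :: bool set" m] by (simp add: points_def)

lemma RM_alt: "RM m r = {w. \<exists>A. finite A \<and> A \<subseteq> monomials m r \<and>
    w = (\<lambda>x. x \<in> points m \<and> odd (card {e \<in> A. monom_word m e x}))}"
proof -
  have "(x \<in> points m \<and> odd (card {e\<in>A. \<forall>i<m. 0 < e i \<longrightarrow> x ! i})) =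
     (x \<in> points m \<and> odd (card {e \<in> A. monom_word m e x}))" for x and A :: "(nat \<Rightarrow> nat) set"
    by (auto simp: monom_word_def)
  then show ?thesis
    unfolding RM_def monomials_def fun_eq_iff by simp
qed

lemma RM_outside: "w \<in> RM m r \<Longrightarrow> x \<notin> points m \<Longrightarrow> \<not> w x"
  by (auto simp: RM_def)

lemma RM_zero [simp]: "(\<lambda>_. False) \<in> RM m r"
  unfolding RM_alt by (rule CollectI, rule exI[of _ "{}"]) simp

lemma monom_word_insert:
  assumes "finite A" "e \<notin> A"
  shows "(\<lambda>x. x \<in> points m \<and> odd (card {d \<in> insert e A. monom_word m d x})) =
    wxor (monom_word m e) (\<lambda>x. x \<in> points m \<and> odd (card {d \<in> A. monom_word m d x}))"
  (is "?L = ?R")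
proof (rule ext)
  fix x
  have "{d \<in> insert e A. monom_word m d x} =
      (if monom_word m e x then insert e {d \<in> A. monom_word m d x} else {d \<in> A. monom_word m d x})"
    by auto
  note eq = this
  have "finite {d \<in> A. monom_word m d x}" "e \<notin> {d \<in> A. monom_word m d x}"
    using assms by auto
  moreover have "x \<in> points m" if "monom_word m e x" using that by (simp add: monom_word_def)
  ultimately show "?L x = ?R x"
    unfolding eq wxor_apply by (cases "monom_word m e x") simp_all
qed

text \<open>The code is spanned by the monomial words, so the closure properties below reduce to
  adding one monomial. A monomial that is already present cancels; \<open>RM_add_monom\<close>
  settles this once.\<close>

lemma RM_induct [consumes 1, case_names zero add]:
  assumes "w \<in> RM m r" "P (\<lambda>_. False)"
    "\<And>e w. e \<in> monomials m r \<Longrightarrow> w \<in> RM m r \<Longrightarrow> P w \<Longrightarrow> P (wxor (monom_word m e) w)"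
  shows "P w"
proof -
  obtain A where A: "finite A" "A \<subseteq> monomials m r"
    "w = (\<lambda>x. x \<in> points m \<and> odd (card {e \<in> A. monom_word m e x}))"
    using assms(1) by (auto simp: RM_alt)
  have "P (\<lambda>x. x \<in> points m \<and> odd (card {e \<in> A. monom_word m e x}))"
    using A(1,2)
  proof (induction A)
    case empty then show ?case using assms(2) by simp
  next
    case (insert e A)
    have "(\<lambda>x. x \<in> points m \<and> odd (card {e \<in> A. monom_word m e x})) \<in> RM m r"
      using insert by (auto simp: RM_alt)
    with insert show ?case unfolding monom_word_insert[OF insert(1,2)] by (intro assms(3)) auto
  qed
  with A show ?thesis by simp
qed

lemma RM_add_monom:
  assumes "e \<in> monomials m r" "w \<in> RM m r"
  shows "wxor (monom_word m e) w \<in> RM m r"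
proof -
  obtain A where A: "finite A" "A \<subseteq> monomials m r"
    "w = (\<lambda>x. x \<in> points m \<and> odd (card {e \<in> A. monom_word m e x}))"
    using assms by (auto simp: RM_alt)
  show ?thesis
  proof (cases "e \<in> A")
    case True
    then have "insert e (A - {e}) = A" by auto
    then have "w = wxor (monom_word m e) (\<lambda>x. x \<in> points m \<and> odd (card {d \<in> A - {e}. monom_word m d x}))"
      using monom_word_insert[of "A - {e}" e m] A by (simp only:) auto
    then have "wxor (monom_word m e) w = (\<lambda>x. x \<in> points m \<and> odd (card {d \<in> A - {e}. monom_word m d x}))"
      by (simp only: wxor_cancel)
    then show ?thesis using A unfolding RM_alt by (intro CollectI exI[of _ "A - {e}"]) auto
  next
    case False
    have "wxor (monom_word m e) w = (\<lambda>x. x \<in> points m \<and> odd (card {d \<in> insert e A. monom_word m d x}))"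
      using A False monom_word_insert[of A e m] by simp
    then show ?thesis using A assms(1) unfolding RM_alt
      by (intro CollectI exI[of _ "insert e A"]) auto
  qed
qed

lemma RM_xor: "u \<in> RM m r \<Longrightarrow> v \<in> RM m r \<Longrightarrow> wxor u v \<in> RM m r"
proof (induction rule: RM_induct)
  case zero then show ?case by simp
next
  case (add e w)
  have "wxor (wxor (monom_word m e) w) v = wxor (monom_word m e) (wxor w v)" by (auto simp: fun_eq_iff)
  with RM_add_monom[OF add(1) add(3)[OF add(4)]] show ?case by (simp only:)
qed

lemma RM_monom: "e \<in> monomials m r \<Longrightarrow> monom_word m e \<in> RM m r"
  using RM_add_monom[OF _ RM_zero, of e m r] by simp

lemma RM_mono: "w \<in> RM m r \<Longrightarrow> r \<le> r' \<Longrightarrow> w \<in> RM m r'"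
proof (induction rule: RM_induct)
  case (add e w)
  then have "e \<in> monomials m r'" by (auto simp: monomials_def)
  with add show ?case by (intro RM_add_monom) auto
qed simp

lemma RM_one: "(\<lambda>x. x \<in> points m) \<in> RM m r"
proof -
  have "monom_word m (\<lambda>_. 0) = (\<lambda>x. x \<in> points m)" by (auto simp: monom_word_def)
  then show ?thesis using RM_monom[of "\<lambda>_. 0" m r] by (simp add: monomials_def)
qed

lemma RM_coord:
  assumes "i < m" "1 \<le> r" shows "(\<lambda>x. x \<in> points m \<and> x ! i) \<in> RM m r"
proof -
  have "monom_word m (\<lambda>j. if j = i then 1 else 0) = (\<lambda>x. x \<in> points m \<and> x ! i)"
    using assms by (auto simp: monom_word_def)
  then show ?thesis using RM_monom[of "\<lambda>j. if j = i then 1 else 0" m r] assms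
    by (simp add: monomials_def sum.delta)
qed

text \<open>A product of monomial words is the monomial word of the sum of the exponents, because
  \<open>e i + d i\<close> is positive as soon as one summand is. Exponents are not reduced to 0 and
  1, so degrees simply add.\<close>

lemma RM_mult: "u \<in> RM m a \<Longrightarrow> v \<in> RM m b \<Longrightarrow> (\<lambda>x. u x \<and> v x) \<in> RM m (a + b)"
proof (induction rule: RM_induct)
  case zero then show ?case by simp
next
  case (add e w)
  have "v \<in> RM m b \<Longrightarrow> (\<lambda>x. monom_word m e x \<and> v x) \<in> RM m (a + b)"
  proof (induction rule: RM_induct)
    case zero then show ?case by simp
  next
    case (add d v)
    have eq: "(\<lambda>x. monom_word m e x \<and> wxor (monom_word m d) v x) =
       wxor (monom_word m (\<lambda>i. e i + d i)) (\<lambda>x. monom_word m e x \<and> v x)"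
      by (auto simp: monom_word_def fun_eq_iff)
    have "(\<lambda>i. e i + d i) \<in> monomials m (a + b)"
      using add \<open>e \<in> monomials m a\<close> by (auto simp: monomials_def sum.distrib)
    then show ?case unfolding eq using add by (intro RM_add_monom)
  qed
  then have "(\<lambda>x. monom_word m e x \<and> v x) \<in> RM m (a + b)" using add by simp
  moreover have eq: "(\<lambda>x. wxor (monom_word m e) w x \<and> v x) =
     wxor (\<lambda>x. monom_word m e x \<and> v x) (\<lambda>x. w x \<and> v x)" by (auto simp: fun_eq_iff)
  ultimately show ?case unfolding eq using add by (intro RM_xor)
qed

text \<open>A monomial of total degree \<open>d\<close> becomes a product of at most
  \<open>d\<close> functions of degree at most 1. Affinity of \<open>T\<close> is expressed by
  putting its coordinate functions into \<open>RM n 1\<close>; symmetries, petals, restrictions and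
  changes of direction all enter through this lemma.\<close>

lemma RM_comp:
  assumes w: "w \<in> RM m r"
    and T: "\<And>x. x \<in> points n \<Longrightarrow> T x \<in> points m"
    and aff: "\<And>i. i < m \<Longrightarrow> (\<lambda>x. x \<in> points n \<and> T x ! i) \<in> RM n 1"
  shows "(\<lambda>x. x \<in> points n \<and> w (T x)) \<in> RM n r"
  using w
proof (induction rule: RM_induct)
  case zero then show ?case by simp
next
  case (add e w)
  have "(\<lambda>x. x \<in> points n \<and> (\<forall>i<k. 0 < e i \<longrightarrow> T x ! i)) \<in> RM n (\<Sum>i<k. e i)" if "k \<le> m" for k
    using that
  proof (induction k)
    case 0 then show ?case by (simp add: RM_one)
  next
    case (Suc k)
    show ?case
    proof (cases "e k = 0")
      case True
      then have "(\<forall>i<Suc k. 0 < e i \<longrightarrow> T x ! i) \<longleftrightarrow> (\<forall>i<k. 0 < e i \<longrightarrow> T x ! i)" for x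
        using less_Suc_eq by auto
      then show ?thesis using Suc True by simp
    next
      case False
      \<comment> \<open>A variable contributes one factor even if its exponent exceeds 1;
        \<open>RM_mono\<close> makes up for the difference in degree.\<close>
      have "(\<lambda>x. (x \<in> points n \<and> (\<forall>i<k. 0 < e i \<longrightarrow> T x ! i)) \<and> (x \<in> points n \<and> T x ! k))
          \<in> RM n ((\<Sum>i<k. e i) + 1)"
        using Suc aff by (intro RM_mult) auto
      moreover have "(\<lambda>x. (x \<in> points n \<and> (\<forall>i<k. 0 < e i \<longrightarrow> T x ! i)) \<and> (x \<in> points n \<and> T x ! k)) =
         (\<lambda>x. x \<in> points n \<and> (\<forall>i<Suc k. 0 < e i \<longrightarrow> T x ! i))"
        using False by (auto simp: less_Suc_eq)
      ultimately show ?thesis using False RM_mono by fastforce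
    qed
  qed
  from this[of m] have "(\<lambda>x. x \<in> points n \<and> monom_word m e (T x)) \<in> RM n r"
    using add T RM_mono by (auto simp: monom_word_def monomials_def cong: conj_cong)
  moreover have eq: "(\<lambda>x. x \<in> points n \<and> wxor (monom_word m e) w (T x)) =
      wxor (\<lambda>x. x \<in> points n \<and> monom_word m e (T x)) (\<lambda>x. x \<in> points n \<and> w (T x))" by (auto simp: fun_eq_iff)
  ultimately show ?case unfolding eq using add by (intro RM_xor)
qed

lemma card_bounded_subsets: "card {I. I \<subseteq> {..<m} \<and> card I \<le> r} = binom_le m r"
proof -
  have "{I. I \<subseteq> {..<m} \<and> card I \<le> r} = (\<Union>j\<le>r. {I. I \<subseteq> {..<m} \<and> card I = j})" by auto
  also have "card \<dots> = (\<Sum>j\<le>r. card {I. I \<subseteq> {..<m} \<and> card I = j})"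
    by (rule card_UN_disjoint) auto
  also have "\<dots> = binom_le m r" using n_subsets[of "{..<m}"] by (simp add: binom_le_def)
  finally show ?thesis .
qed

text \<open>Exponent vectors with the same support give the same word, so every codeword is a parity
  of monomials indexed by sets of at most \<open>r\<close> variables.\<close>

lemma RM_card: "finite (RM m r)" "card (RM m r) \<le> 2 ^ binom_le m r"
proof -
  let ?J = "{I. I \<subseteq> {..<m} \<and> card I \<le> r}"
  let ?F = "\<lambda>B x. x \<in> points m \<and> odd (card {I \<in> B. \<forall>i\<in>I. x ! i})"
  have fin: "finite ?J" by simp
  have ex: "\<exists>B. B \<subseteq> ?J \<and> w = ?F B" if "w \<in> RM m r" for w
    using that
  proof (induction rule: RM_induct)
    case zero then show ?case by (intro exI[of _ "{}"]) auto
  next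
    case (add e w)
    then obtain B where B: "B \<subseteq> ?J" "w = ?F B" by blast
    have finB: "finite B" using B fin finite_subset by blast
    define I where "I = {i. i < m \<and> 0 < e i}"
    have "card I = (\<Sum>i\<in>I. 1)" by simp
    also have "\<dots> \<le> (\<Sum>i\<in>I. e i)" unfolding I_def by (rule sum_mono) auto
    also have "\<dots> \<le> (\<Sum>i<m. e i)" unfolding I_def by (rule sum_mono2) auto
    also have "\<dots> \<le> r" using add by (simp add: monomials_def)
    finally have IJ: "I \<in> ?J" by (auto simp: I_def)
    have ins: "?F (insert I D) = wxor (monom_word m e) (?F D)" if "finite D" "I \<notin> D" for D
    proof (rule ext)
      fix x
      have "{L \<in> insert I D. \<forall>i\<in>L. x ! i} =
        (if \<forall>i\<in>I. x ! i then insert I {L \<in> D. \<forall>i\<in>L. x ! i} else {L \<in> D. \<forall>i\<in>L. x ! i})" by auto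
      then show "?F (insert I D) x = wxor (monom_word m e) (?F D) x"
        using that by (auto simp: monom_word_def I_def)
    qed
    show ?case
    proof (cases "I \<in> B")
      case True
      then have "insert I (B - {I}) = B" by auto
      then have "w = wxor (monom_word m e) (?F (B - {I}))"
        using ins[of "B - {I}"] finB B(2) by (simp only:) auto
      then have "wxor (monom_word m e) w = ?F (B - {I})" by (simp only: wxor_cancel)
      then show ?thesis using B(1) by (intro exI[of _ "B - {I}"] conjI) auto
    next
      case False
      have "wxor (monom_word m e) w = ?F (insert I B)" unfolding B(2) using ins[OF finB False] by (rule sym)
      then show ?thesis using B(1) IJ by (intro exI[of _ "insert I B"] conjI) auto
    qed
  qed
  have sub: "RM m r \<subseteq> ?F ` Pow ?J"
  proof
    fix w assume "w \<in> RM m r"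
    from ex[OF this] obtain B where "B \<subseteq> ?J" "w = ?F B" by (elim exE conjE)
    then show "w \<in> ?F ` Pow ?J" by (intro image_eqI[of w ?F B] PowI)
  qed
  then show "finite (RM m r)" by (rule finite_surj[OF iffD2[OF finite_Pow_iff fin]])
  have "card (RM m r) \<le> card (Pow ?J)" using sub fin by (meson finite_Pow_iff surj_card_le)
  then show "card (RM m r) \<le> 2 ^ binom_le m r" using fin by (simp add: card_Pow card_bounded_subsets)
qed

text \<open>The derivative in the last variable removes it from each monomial that contains it.
  Degree 0 is separated because \<open>r - 1\<close> is truncated, whereas the derivative of a
  constant vanishes.\<close>

lemma RM_sum_last:
  assumes "f \<in> RM (Suc n) r"
  shows "(r > 0 \<longrightarrow> (\<lambda>z. z \<in> points n \<and> f (z @ [False]) \<noteq> f (z @ [True])) \<in> RM n (r - 1)) \<and>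
    (r = 0 \<longrightarrow> (\<forall>z\<in>points n. f (z @ [False]) = f (z @ [True])))"
  using assms
proof (induction rule: RM_induct)
  case zero then show ?case by simp
next
  case (add e w)
  let ?D = "\<lambda>f z. z \<in> points n \<and> f (z @ [False]) \<noteq> f (z @ [True])"
  have lastc: "monom_word (Suc n) e (z @ [b]) \<longleftrightarrow> z \<in> points n \<and> (0 < e n \<longrightarrow> b) \<and> (\<forall>i<n. 0 < e i \<longrightarrow> z ! i)" for z b
    by (auto simp: monom_word_def points_def nth_append less_Suc_eq)
  have eq: "?D (wxor (monom_word (Suc n) e) w) = wxor (?D (monom_word (Suc n) e)) (?D w)"
    by (auto simp: fun_eq_iff)
  show ?case
  proof (cases "e n = 0")
    case True
    then have D0: "?D (monom_word (Suc n) e) = (\<lambda>_. False)" by (auto simp: lastc)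
    have "r = 0 \<longrightarrow> (\<forall>z\<in>points n. wxor (monom_word (Suc n) e) w (z @ [False]) = wxor (monom_word (Suc n) e) w (z @ [True]))"
      using True add by (simp add: lastc)
    then show ?thesis unfolding eq D0 wxor_zero using add by blast
  next
    case False
    then have "r > 0" using add by (auto simp: monomials_def)
    have "?D (monom_word (Suc n) e) = (\<lambda>z. z \<in> points n \<and> (\<forall>i<n. 0 < e i \<longrightarrow> z ! i))"
    proof (rule ext)
      fix z
      show "(z \<in> points n \<and> monom_word (Suc n) e (z @ [False]) \<noteq> monom_word (Suc n) e (z @ [True])) =
          (z \<in> points n \<and> (\<forall>i<n. 0 < e i \<longrightarrow> z ! i))"
        unfolding lastc using False by (cases "\<forall>i<n. 0 < e i \<longrightarrow> z ! i") simp_all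
    qed
    moreover have "\<dots> = monom_word n (e(n := 0))"
      by (auto simp: monom_word_def fun_eq_iff)
    ultimately have D1: "?D (monom_word (Suc n) e) = monom_word n (e(n := 0))" by (rule trans)
    have "\<forall>i\<ge>n. (e(n := 0)) i = 0"
      using add(1) by (simp add: monomials_def)
    moreover have "(\<Sum>i<n. (e(n := 0)) i) = (\<Sum>i<n. e i)" by (rule sum.cong) auto
    moreover have "(\<Sum>i<n. e i) \<le> r - 1" using add(1) False unfolding monomials_def mem_Collect_eq sum.lessThan_Suc by linarith
    ultimately have "e(n := 0) \<in> monomials n (r - 1)"
      by (simp add: monomials_def)
    then have "wxor (monom_word n (e(n := 0))) (?D w) \<in> RM n (r - 1)"
      using add \<open>r > 0\<close> by (intro RM_add_monom) auto
    then show ?thesis unfolding eq D1 using \<open>r > 0\<close> by blast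
  qed
qed

lemma points_Suc_snoc: "points (Suc l) = (\<lambda>t. t @ [False]) ` points l \<union> (\<lambda>t. t @ [True]) ` points l"
proof -
  have "\<exists>t\<in>points l. s = t @ [False] \<or> s = t @ [True]" if "s \<in> points (Suc l)" for s
  proof -
    have "s \<noteq> []" "length (butlast s) = l" using that by (auto simp: points_def)
    moreover from this have "s = butlast s @ [last s]" by simp
    ultimately have "s = butlast s @ [last s]" "length (butlast s) = l" by auto
    then obtain t b where "s = t @ [b]" "length t = l" by blast
    then show ?thesis by (cases b) (auto simp: points_def)
  qed
  then show ?thesis by (auto simp: points_def)
qed

lemma card_points_Suc_snoc:
  "card {t \<in> points (Suc l). P t} = card {t \<in> points l. P (t @ [False])} + card {t \<in> points l. P (t @ [True])}"
proof -
  have eq: "{t \<in> points (Suc l). P t} = (\<lambda>t. t @ [False]) ` {t \<in> points l. P (t @ [False])}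
     \<union> (\<lambda>t. t @ [True]) ` {t \<in> points l. P (t @ [True])}"
    by (auto simp: points_Suc_snoc)
  show ?thesis unfolding eq
    by (subst card_Un_disjoint) (auto simp: card_image inj_on_def)
qed

lemma odd_card_xor: "finite A \<Longrightarrow> odd (card {x \<in> A. u x \<noteq> v x}) \<longleftrightarrow> odd (card {x \<in> A. u x}) \<noteq> odd (card {x \<in> A. v x})"
proof (induction A rule: finite_induct)
  case (insert a A)
  have ins: "odd (card {x \<in> insert a A. P x}) = (P a \<noteq> odd (card {x \<in> A. P x}))" for P
  proof -
    have "{x \<in> insert a A. P x} = (if P a then insert a {x \<in> A. P x} else {x \<in> A. P x})" by auto
    then show ?thesis using insert(1,2) by (cases "P a") auto
  qed
  show ?case unfolding ins insert.IH by blast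
qed simp

text \<open>Summation over an \<open>l\<close>-dimensional face is an \<open>l\<close>-fold
  derivative: it lowers the degree by \<open>l\<close> and kills everything of degree below
  \<open>l\<close>.\<close>

lemma RM_sum_last_many:
  assumes "f \<in> RM (n + l) r"
  shows "(l \<le> r \<longrightarrow> (\<lambda>z. z \<in> points n \<and> odd (card {t \<in> points l. f (z @ t)})) \<in> RM n (r - l)) \<and>
    (r < l \<longrightarrow> (\<forall>z\<in>points n. even (card {t \<in> points l. f (z @ t)})))"
  using assms
proof (induction l arbitrary: f r)
  case 0
  have p0: "points 0 = {[]}" by (auto simp: points_def)
  have "odd (card {t \<in> points 0. f (z @ t)}) = f z" for z
  proof -
    have "{t \<in> points 0. f (z @ t)} = (if f z then {[]} else {})" unfolding p0 by (cases "f z") auto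
    then show ?thesis by (cases "f z") (simp_all only: if_True if_False card.empty card_1_singleton_iff, simp_all)
  qed
  moreover have "f = (\<lambda>z. z \<in> points n \<and> f z)"
  proof (rule ext)
    fix z show "f z = (z \<in> points n \<and> f z)" using 0 RM_outside[of f n r z] by auto
  qed
  ultimately show ?case using 0 by simp
next
  case (Suc l)
  let ?g = "\<lambda>z. z \<in> points (n + l) \<and> f (z @ [False]) \<noteq> f (z @ [True])"
  have par: "odd (card {t \<in> points (Suc l). f (z @ t)}) = odd (card {t \<in> points l. ?g (z @ t)})"
    if "z \<in> points n" for z
  proof -
    have "{t \<in> points l. ?g (z @ t)} = {t \<in> points l. f (z @ t @ [False]) \<noteq> f (z @ t @ [True])}"
      using that by (auto simp: points_def)
    then show ?thesis using odd_card_xor[OF finite_points[of l]]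
      by (simp add: card_points_Suc_snoc)
  qed
  show ?case
  proof (cases "r = 0")
    case True
    then have "\<forall>z\<in>points (n + l). f (z @ [False]) = f (z @ [True])"
      using RM_sum_last[of f "n + l" r] Suc by simp
    then have "{t \<in> points l. ?g (z @ t)} = {}" if "z \<in> points n" for z by auto
    then show ?thesis using True par
      by (metis (no_types, lifting) card.empty even_zero le_zero_eq nat.distinct(1))
  next
    case False
    then have "?g \<in> RM (n + l) (r - 1)" using RM_sum_last[of f "n + l" r] Suc by simp
    from Suc.IH[OF this] show ?thesis using par False
      by (auto simp: cong: conj_cong) 
  qed
qed


subsection \<open>Noise, Fourier analysis and hypercontractivity\<close>

locale bsc =
  fixes eps :: real
  assumes eps_pos: "0 < eps" and eps_half: "eps < 1/2"
begin

text \<open>A noise pattern is the set \<open>Z\<close> of flipped coordinates, and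
  \<open>wt A Z\<close> its probability. Expectations remain finite sums over \<open>Pow A\<close>
  until \<open>expectation_noise\<close> identifies them with the channel.\<close>

definition wt :: "'a set \<Rightarrow> 'a set \<Rightarrow> real" where
  "wt A Z = eps ^ card Z * (1 - eps) ^ card (A - Z)"

definition E :: "'a set \<Rightarrow> ('a set \<Rightarrow> real) \<Rightarrow> real" where
  "E A f = (\<Sum>Z\<in>Pow A. wt A Z * f Z)"

lemma wt_pos: "wt A Z > 0"
  using eps_pos eps_half by (simp add: wt_def)

lemma wt_nonneg: "wt A Z \<ge> 0"
  using wt_pos less_imp_le by blast

lemma E_cong: "(\<And>Z. Z \<subseteq> A \<Longrightarrow> f Z = g Z) \<Longrightarrow> E A f = E A g"
  unfolding E_def by (rule sum.cong) auto

lemma E_mono: "(\<And>Z. Z \<subseteq> A \<Longrightarrow> f Z \<le> g Z) \<Longrightarrow> E A f \<le> E A g"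
  unfolding E_def by (rule sum_mono) (auto intro: mult_left_mono wt_nonneg)

lemma E_nonneg: "(\<And>Z. Z \<subseteq> A \<Longrightarrow> 0 \<le> f Z) \<Longrightarrow> 0 \<le> E A f"
  unfolding E_def by (rule sum_nonneg) (auto intro: mult_nonneg_nonneg wt_nonneg)

lemma E_add: "E A (\<lambda>Z. f Z + g Z) = E A f + E A g"
  by (simp add: E_def sum.distrib algebra_simps)

lemma E_diff: "E A (\<lambda>Z. f Z - g Z) = E A f - E A g"
  by (simp add: E_def sum_subtractf algebra_simps)

lemma E_cmult: "E A (\<lambda>Z. c * f Z) = c * E A f"
  unfolding E_def sum_distrib_left by (simp add: mult.left_commute)

lemma E_cmult_right: "E A (\<lambda>Z. f Z * c) = E A f * c"
  unfolding E_def sum_distrib_right by (simp add: mult.assoc)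

lemma E_sum: "E A (\<lambda>Z. \<Sum>i\<in>I. f i Z) = (\<Sum>i\<in>I. E A (f i))"
  by (simp add: E_def sum_distrib_left sum.swap[of _ I])

text \<open>Independence of the coordinates is the expansion of a product of two-term sums over all
  subsets.\<close>

lemma E_prod:
  assumes "finite A"
  shows "E A (\<lambda>Z. \<Prod>v\<in>A. h v (v \<in> Z)) = (\<Prod>v\<in>A. eps * h v True + (1 - eps) * h v False)"
proof -
  have "(\<Prod>v\<in>A. eps * h v True + (1 - eps) * h v False) =
     (\<Sum>B\<in>Pow A. (\<Prod>v\<in>B. eps * h v True) * (\<Prod>v\<in>A - B. (1 - eps) * h v False))"
    by (rule prod_add[OF assms, of "\<lambda>v. eps * h v True" "\<lambda>v. (1 - eps) * h v False"])
  also have "\<dots> = (\<Sum>B\<in>Pow A. wt A B * (\<Prod>v\<in>A. h v (v \<in> B)))"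
  proof (rule sum.cong[OF refl])
    fix B assume B: "B \<in> Pow A"
    have "(\<Prod>v\<in>A. h v (v \<in> B)) = (\<Prod>v\<in>B \<union> (A - B). h v (v \<in> B))"
      using B by (simp add: Un_absorb1)
    also have "\<dots> = (\<Prod>v\<in>B. h v (v \<in> B)) * (\<Prod>v\<in>A - B. h v (v \<in> B))"
      using B assms by (intro prod.union_disjoint) (auto intro: finite_subset)
    also have "\<dots> = (\<Prod>v\<in>B. h v True) * (\<Prod>v\<in>A - B. h v False)"
      by (intro arg_cong2[of _ _ _ _ "(*)"] prod.cong) auto
    finally show "(\<Prod>v\<in>B. eps * h v True) * (\<Prod>v\<in>A - B. (1 - eps) * h v False) =
        wt A B * (\<Prod>v\<in>A. h v (v \<in> B))"
      by (simp add: wt_def prod.distrib)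
  qed
  finally show ?thesis by (simp add: E_def)
qed

lemma E_const [simp]: "finite A \<Longrightarrow> E A (\<lambda>_. c) = c"
proof -
  assume "finite A"
  from E_prod[OF this, of "\<lambda>_ _. 1"] have "E A (\<lambda>_. 1) = 1" by simp
  then show ?thesis using E_cmult[of A c "\<lambda>_. 1"] by simp
qed

lemma E_empty [simp]: "E {} f = f {}"
  by (simp add: E_def wt_def)

lemma E_split:
  assumes "finite A" "finite B" "A \<inter> B = {}"
  shows "E (A \<union> B) f = E A (\<lambda>Z. E B (\<lambda>Y. f (Z \<union> Y)))"
proof -
  have "E (A \<union> B) f = (\<Sum>(Z, Y)\<in>Pow A \<times> Pow B. wt (A \<union> B) (Z \<union> Y) * f (Z \<union> Y))"
    unfolding E_def
    by (rule sum.reindex_bij_witness[of _ "\<lambda>(Z, Y). Z \<union> Y" "\<lambda>Z. (Z \<inter> A, Z \<inter> B)"])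
       (use assms in \<open>auto simp: Int_Un_distrib2 Int_absorb2 intro!: arg_cong2[of _ _ _ _ "(*)"] arg_cong2[of _ _ _ _ wt] arg_cong[of _ _ f]\<close>)
  also have "\<dots> = (\<Sum>(Z, Y)\<in>Pow A \<times> Pow B. wt A Z * (wt B Y * f (Z \<union> Y)))"
  proof (rule sum.cong[OF refl])
    fix x assume "x \<in> Pow A \<times> Pow B"
    then obtain Z Y where x: "x = (Z, Y)" and ZY: "Z \<subseteq> A" "Y \<subseteq> B" by auto
    then have fin: "finite Z" "finite Y" using assms by (auto intro: finite_subset)
    have "card (Z \<union> Y) = card Z + card Y"
      using ZY assms fin by (intro card_Un_disjoint) auto
    moreover have "A \<union> B - (Z \<union> Y) = (A - Z) \<union> (B - Y)" using ZY assms by auto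
    moreover have "card ((A - Z) \<union> (B - Y)) = card (A - Z) + card (B - Y)"
      using assms by (intro card_Un_disjoint) auto
    ultimately show "(case x of (Z, Y) \<Rightarrow> wt (A \<union> B) (Z \<union> Y) * f (Z \<union> Y)) =
        (case x of (Z, Y) \<Rightarrow> wt A Z * (wt B Y * f (Z \<union> Y)))"
      by (simp add: x wt_def power_add)
  qed
  also have "\<dots> = E A (\<lambda>Z. E B (\<lambda>Y. f (Z \<union> Y)))"
    by (simp add: E_def sum_distrib_left sum.cartesian_product)
  finally show ?thesis .
qed

lemma E_insert:
  assumes "finite A" "v \<notin> A"
  shows "E (insert v A) f = E A (\<lambda>Z. eps * f (insert v Z) + (1 - eps) * f Z)"
proof -
  have "Pow {v} = {{}, {v}}" by auto
  then have "E {v} g = eps * g {v} + (1 - eps) * g {}" for g :: "'a set \<Rightarrow> real"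
    by (simp add: E_def wt_def)
  then show ?thesis using E_split[of A "{v}" f] assms by simp
qed

lemma E_image:
  assumes "inj_on g A"
  shows "E (g ` A) f = E A (\<lambda>Z. f (g ` Z))"
  unfolding E_def
proof (rule sum.reindex_bij_witness[of _ "image g" "\<lambda>Z. {x \<in> A. g x \<in> Z}"])
  fix Z assume Z: "Z \<in> Pow (g ` A)"
  then show gZ: "g ` {x \<in> A. g x \<in> Z} = Z" by auto
  show "{x \<in> A. g x \<in> Z} \<in> Pow A" by auto
  have "card {x \<in> A. g x \<in> Z} = card Z"
    by (subst (2) gZ[symmetric], rule card_image[symmetric]) (use assms in \<open>auto simp: inj_on_def\<close>)
  moreover have "g ` (A - {x \<in> A. g x \<in> Z}) = g ` A - Z" by auto
  then have "card (A - {x \<in> A. g x \<in> Z}) = card (g ` A - Z)"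
    by (metis (no_types, lifting) Diff_subset assms card_image inj_on_subset)
  ultimately show "wt A {x \<in> A. g x \<in> Z} * f (g ` {x \<in> A. g x \<in> Z}) = wt (g ` A) Z * f Z"
    using gZ by (simp add: wt_def)
next
  fix Z assume "Z \<in> Pow A"
  then show "{x \<in> A. g x \<in> g ` Z} = Z" "g ` Z \<in> Pow (g ` A)" using assms by (auto simp: inj_on_def)
qed

lemma E_local:
  assumes "finite A" "B \<subseteq> A"
  shows "E A (\<lambda>Z. f (Z \<inter> B)) = E B f"
proof -
  have "E (B \<union> (A - B)) (\<lambda>Z. f (Z \<inter> B)) = E B (\<lambda>Z. E (A - B) (\<lambda>Y. f ((Z \<union> Y) \<inter> B)))"
    using assms finite_subset by (intro E_split) auto
  also have "\<dots> = E B (\<lambda>Z. E (A - B) (\<lambda>Y. f Z))"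
  proof (intro E_cong)
    fix Z Y assume "Z \<subseteq> B" "Y \<subseteq> A - B"
    then have "(Z \<union> Y) \<inter> B = Z" by auto
    then show "f ((Z \<union> Y) \<inter> B) = f Z" by simp
  qed
  also have "\<dots> = E B f" using assms by simp
  finally show ?thesis using assms by (simp add: Un_absorb1)
qed

text \<open>The sets \<open>P i\<close> will be the private noise coordinates of a petal, or of one
  block of RMRec2.\<close>

lemma E_indep:
  assumes "finite I" "finite A" "\<And>i. i \<in> I \<Longrightarrow> P i \<subseteq> A"
    "\<And>i j. i \<in> I \<Longrightarrow> j \<in> I \<Longrightarrow> i \<noteq> j \<Longrightarrow> P i \<inter> P j = {}"
  shows "E A (\<lambda>Z. \<Prod>i\<in>I. h i (Z \<inter> P i)) = (\<Prod>i\<in>I. E (P i) (h i))"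
  using assms
proof (induction I arbitrary: A rule: finite_induct)
  case empty then show ?case by simp
next
  case (insert i I)
  let ?B = "A - P i"
  have PI: "P i \<subseteq> A" "finite (P i)"
    using insert.prems finite_subset[of "P i" A] by auto
  have d: "P j \<subseteq> ?B" "P j \<inter> P i = {}" if "j \<in> I" for j
  proof -
    have "j \<noteq> i" using that insert(2) by auto
    then have "P j \<subseteq> A" "P j \<inter> P i = {}"
      using that insert.prems(2)[of j] insert.prems(3)[of j i] by auto
    then show "P j \<subseteq> ?B" "P j \<inter> P i = {}" by auto
  qed
  have "E (P i \<union> ?B) (\<lambda>Z. \<Prod>i\<in>insert i I. h i (Z \<inter> P i)) =
      E (P i) (\<lambda>Z. E ?B (\<lambda>Y. \<Prod>j\<in>insert i I. h j ((Z \<union> Y) \<inter> P j)))"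
    using PI insert by (intro E_split) auto
  also have "\<dots> = E (P i) (\<lambda>Z. E ?B (\<lambda>Y. h i Z * (\<Prod>j\<in>I. h j (Y \<inter> P j))))"
  proof (intro E_cong)
    fix Z Y assume ZY: "Z \<subseteq> P i" "Y \<subseteq> ?B"
    have "(Z \<union> Y) \<inter> P i = Z" using ZY by auto
    moreover have "(\<Prod>j\<in>I. h j ((Z \<union> Y) \<inter> P j)) = (\<Prod>j\<in>I. h j (Y \<inter> P j))"
    proof (rule prod.cong[OF refl])
      fix j assume "j \<in> I"
      then have "(Z \<union> Y) \<inter> P j = Y \<inter> P j" using d ZY by blast
      then show "h j ((Z \<union> Y) \<inter> P j) = h j (Y \<inter> P j)" by simp
    qed
    ultimately show "(\<Prod>j\<in>insert i I. h j ((Z \<union> Y) \<inter> P j)) = h i Z * (\<Prod>j\<in>I. h j (Y \<inter> P j))"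
      using insert by simp
  qed
  also have "\<dots> = E (P i) (h i) * E ?B (\<lambda>Y. \<Prod>j\<in>I. h j (Y \<inter> P j))"
    by (simp add: E_cmult E_cmult_right)
  also have "E ?B (\<lambda>Y. \<Prod>j\<in>I. h j (Y \<inter> P j)) = (\<Prod>j\<in>I. E (P j) (h j))"
    using insert d by (intro insert.IH) auto
  finally show ?case using insert PI by (simp add: Un_absorb1)
qed

lemma E_Cauchy_Schwarz: "(E A (\<lambda>Z. f Z * g Z))\<^sup>2 \<le> E A (\<lambda>Z. (f Z)\<^sup>2) * E A (\<lambda>Z. (g Z)\<^sup>2)"
proof -
  have "E A (\<lambda>Z. f Z * g Z) = (\<Sum>Z\<in>Pow A. (sqrt (wt A Z) * f Z) * (sqrt (wt A Z) * g Z))"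
    unfolding E_def
  proof (rule sum.cong[OF refl])
    fix Z
    have "sqrt (wt A Z) * sqrt (wt A Z) = wt A Z" using wt_nonneg[of A Z] by simp
    then show "wt A Z * (f Z * g Z) = (sqrt (wt A Z) * f Z) * (sqrt (wt A Z) * g Z)"
      by (metis (no_types, lifting) mult.assoc mult.left_commute)
  qed
  moreover have "E A (\<lambda>Z. (f Z)\<^sup>2) = (\<Sum>Z\<in>Pow A. (sqrt (wt A Z) * f Z)\<^sup>2)" for f :: "'a set \<Rightarrow> real"
    unfolding E_def power_mult_distrib real_sqrt_pow2[OF wt_nonneg] ..
  ultimately show ?thesis using Cauchy_Schwarz_ineq_sum[of "\<lambda>Z. sqrt (wt A Z) * f Z" "\<lambda>Z. sqrt (wt A Z) * g Z" "Pow A"]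
    by simp
qed

lemma E_Markov:
  assumes "\<And>Z. Z \<subseteq> A \<Longrightarrow> 0 \<le> f Z" "0 < c"
  shows "E A (\<lambda>Z. of_bool (c \<le> f Z)) \<le> E A f / c"
proof -
  have "E A (\<lambda>Z. of_bool (c \<le> f Z)) \<le> E A (\<lambda>Z. (1 / c) * f Z)"
    using assms by (intro E_mono) (auto simp: of_bool_def)
  then show ?thesis unfolding E_cmult by simp
qed

text \<open>Up to sign the only function of a Bernoulli(\<open>eps\<close>) bit with mean 0 and
  variance 1. Its products \<open>chi S\<close> are the orthonormal Fourier basis of the biased
  cube.\<close>

definition phi :: "bool \<Rightarrow> real" where
  "phi b = (if b then sqrt ((1 - eps) / eps) else - sqrt (eps / (1 - eps)))"

definition chi :: "'a set \<Rightarrow> 'a set \<Rightarrow> real" where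
  "chi S Z = (\<Prod>v\<in>S. phi (v \<in> Z))"

lemma phi_sq: "(phi True)\<^sup>2 = (1 - eps) / eps" "(phi False)\<^sup>2 = eps / (1 - eps)"
  using eps_pos eps_half by (auto simp: phi_def)

lemma phi_mult: "phi True * phi False = -1" "phi False * phi True = -1"
proof -
  have "sqrt ((1 - eps) / eps) * sqrt (eps / (1 - eps)) = 1"
    using eps_pos eps_half by (simp flip: real_sqrt_mult)
  then show "phi True * phi False = -1" "phi False * phi True = -1"
    by (auto simp: phi_def mult.commute)
qed

lemma phi_mean: "eps * phi True + (1 - eps) * phi False = 0"
proof -
  have "(eps * phi True + (1 - eps) * phi False) * phi True = eps * (phi True)\<^sup>2 + (1 - eps) * (phi False * phi True)"
    by (simp add: algebra_simps power2_eq_square)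
  also have "\<dots> = 0" using eps_pos by (simp add: phi_sq phi_mult)
  finally show ?thesis using eps_pos eps_half by (simp add: phi_def)
qed

lemma phi_var: "eps * (phi True)\<^sup>2 + (1 - eps) * (phi False)\<^sup>2 = 1"
  using eps_pos eps_half by (simp add: phi_sq)

lemma E_chi_prod:
  assumes "finite A" "S \<subseteq> A" "T \<subseteq> A"
  shows "E A (\<lambda>Z. chi S Z * chi T Z) = of_bool (S = T)"
proof -
  let ?h = "\<lambda>v b. (if v \<in> S then phi b else 1) * (if v \<in> T then phi b else 1)"
  have "chi S Z = (\<Prod>v\<in>A. if v \<in> S then phi (v \<in> Z) else 1)" if "S \<subseteq> A" for S Z
    unfolding chi_def using assms(1) that by (simp add: prod.If_cases Int_absorb1)
  then have "E A (\<lambda>Z. chi S Z * chi T Z) = E A (\<lambda>Z. \<Prod>v\<in>A. ?h v (v \<in> Z))"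
    using assms by (intro E_cong) (simp add: prod.distrib)
  also have "\<dots> = (\<Prod>v\<in>A. eps * ?h v True + (1 - eps) * ?h v False)"
    using E_prod[OF assms(1), of ?h] by simp
  also have "\<dots> = of_bool (S = T)"
  proof (cases "S = T")
    case True
    then show ?thesis using phi_var by (auto simp: power2_eq_square intro!: prod.neutral)
  next
    case False
    then obtain v where v: "v \<in> A" "(v \<in> S) \<noteq> (v \<in> T)" using assms by auto
    then have "eps * ?h v True + (1 - eps) * ?h v False = 0" using phi_mean by auto
    then have "(\<Prod>v\<in>A. eps * ?h v True + (1 - eps) * ?h v False) = 0"
      using v(1) by (intro prod_zero[OF assms(1)] bexI[of _ v])
    then show ?thesis using False by simp
  qed
  finally show ?thesis .
qed

section \<open>Fourier inversion and Plancherel\<close>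

definition coef :: "'a set \<Rightarrow> ('a set \<Rightarrow> real) \<Rightarrow> 'a set \<Rightarrow> real" where
  "coef A f S = E A (\<lambda>Z. f Z * chi S Z)"

text \<open>Completeness of the basis. The sum factors over coordinates, and
  \<open>phi a * phi b + 1\<close> is the reciprocal of the probability of the bit \<open>a\<close>
  if \<open>a = b\<close>, and 0 otherwise.\<close>

lemma chi_kernel:
  assumes "finite A" "Z \<subseteq> A" "Y \<subseteq> A"
  shows "(\<Sum>S\<in>Pow A. chi S Z * chi S Y) = (if Z = Y then 1 / wt A Z else 0)"
proof -
  have "(\<Sum>S\<in>Pow A. chi S Z * chi S Y) = (\<Prod>v\<in>A. phi (v \<in> Z) * phi (v \<in> Y) + 1)"
    using prod_add[OF assms(1), of "\<lambda>v. phi (v \<in> Z) * phi (v \<in> Y)" "\<lambda>_. 1"]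
    by (simp add: chi_def prod.distrib)
  also have "\<dots> = (if Z = Y then 1 / wt A Z else 0)"
  proof (cases "Z = Y")
    case True
    have "phi True * phi True + 1 = 1 / eps" "phi False * phi False + 1 = 1 / (1 - eps)"
      using phi_sq eps_pos eps_half by (simp_all add: power2_eq_square field_simps)
    then have "(\<Prod>v\<in>A. phi (v \<in> Z) * phi (v \<in> Z) + 1) = (\<Prod>v\<in>Z \<union> (A - Z). if v \<in> Z then 1 / eps else 1 / (1 - eps))"
      using assms by (intro prod.cong) auto
    also have "\<dots> = (\<Prod>v\<in>Z. 1 / eps) * (\<Prod>v\<in>A - Z. 1 / (1 - eps))"
      using assms by (subst prod.union_disjoint) (auto intro: finite_subset)
    also have "\<dots> = 1 / wt A Z" by (simp add: wt_def power_divide)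
    finally show ?thesis using True by simp
  next
    case False
    then obtain v where v: "v \<in> A" "(v \<in> Z) \<noteq> (v \<in> Y)" using assms by auto
    then have "phi (v \<in> Z) * phi (v \<in> Y) + 1 = 0" using phi_mult by (cases "v \<in> Z") auto
    then have "(\<Prod>v\<in>A. phi (v \<in> Z) * phi (v \<in> Y) + 1) = 0"
      using v(1) by (intro prod_zero[OF assms(1)] bexI[of _ v])
    then show ?thesis using False by simp
  qed
  finally show ?thesis .
qed

lemma chi_expansion:
  assumes "finite A" "Y \<subseteq> A"
  shows "f Y = (\<Sum>S\<in>Pow A. coef A f S * chi S Y)"
proof -
  have "(\<Sum>S\<in>Pow A. coef A f S * chi S Y) = (\<Sum>S\<in>Pow A. \<Sum>Z\<in>Pow A. wt A Z * f Z * (chi S Z * chi S Y))"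
    by (simp add: coef_def E_def sum_distrib_right mult.assoc)
  also have "\<dots> = (\<Sum>Z\<in>Pow A. wt A Z * f Z * (\<Sum>S\<in>Pow A. chi S Z * chi S Y))"
    by (subst sum.swap) (simp add: sum_distrib_left)
  also have "\<dots> = (\<Sum>Z\<in>Pow A. if Z = Y then wt A Z * f Z / wt A Z else 0)"
    using assms(2) by (intro sum.cong) (simp_all add: chi_kernel[OF assms(1)])
  also have "\<dots> = f Y" using assms wt_pos[of A Y] by (simp add: sum.delta cong: if_cong)
  finally show ?thesis by simp
qed

lemma coef_of_sum:
  assumes "finite A" "S \<subseteq> A"
  shows "coef A (\<lambda>Z. \<Sum>T\<in>Pow A. a T * chi T Z) S = a S"
proof -
  have "coef A (\<lambda>Z. \<Sum>T\<in>Pow A. a T * chi T Z) S = (\<Sum>T\<in>Pow A. a T * E A (\<lambda>Z. chi T Z * chi S Z))"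
    by (simp add: coef_def sum_distrib_right E_sum mult.assoc E_cmult)
  also have "\<dots> = (\<Sum>T\<in>Pow A. if T = S then a T else 0)"
    using assms by (intro sum.cong) (auto simp: E_chi_prod)
  also have "\<dots> = a S" using assms by (simp add: sum.delta)
  finally show ?thesis .
qed

lemma Plancherel:
  assumes "finite A" shows "E A (\<lambda>Z. (f Z)\<^sup>2) = (\<Sum>S\<in>Pow A. (coef A f S)\<^sup>2)"
proof -
  have "E A (\<lambda>Z. (f Z)\<^sup>2) = E A (\<lambda>Z. \<Sum>S\<in>Pow A. coef A f S * (f Z * chi S Z))"
  proof (rule E_cong)
    fix Z assume "Z \<subseteq> A"
    have "(f Z)\<^sup>2 = f Z * (\<Sum>S\<in>Pow A. coef A f S * chi S Z)"
      using chi_expansion[OF assms \<open>Z \<subseteq> A\<close>, of f] by (simp add: power2_eq_square)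
    then show "(f Z)\<^sup>2 = (\<Sum>S\<in>Pow A. coef A f S * (f Z * chi S Z))"
      by (simp add: sum_distrib_left mult.left_commute)
  qed
  also have "\<dots> = (\<Sum>S\<in>Pow A. (coef A f S)\<^sup>2)"
    by (simp add: E_sum E_cmult power2_eq_square flip: coef_def)
  finally show ?thesis .
qed

text \<open>The second argument of the maximum is the cost of \<open>h ^ 4\<close> in
  \<open>phi_fourth_moment\<close>. The 16 is the least positive \<open>K\<close> with
  \<open>sqrt K <= K / 4\<close>, which the cross term in \<open>hypercontractive\<close>
  requires.\<close>

definition hyp_const :: real where
  "hyp_const = max 16 (eps * phi True ^ 4 + (1 - eps) * phi False ^ 4
      + 2 * (eps * phi True ^ 3 + (1 - eps) * phi False ^ 3)\<^sup>2)"

lemma hyp_const_ge: "16 \<le> hyp_const" by (simp add: hyp_const_def)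

text \<open>The linear term vanishes by mean 0, and variance 1 gives the quadratic one the
  coefficient 6. The cubic term, absent for fair bits, is split by
  \<open>2 a b <= a^2 + b^2\<close>; this raises 6 to 8 and brings in the square of the third
  moment.\<close>

lemma phi_fourth_moment:
  "eps * (g + phi True * h) ^ 4 + (1 - eps) * (g + phi False * h) ^ 4
    \<le> g ^ 4 + 8 * (g ^ 2 * h ^ 2) + hyp_const * h ^ 4"
proof -
  define p q where "p = phi True" "q = phi False"
  define m3 m4 where "m3 = eps * p ^ 3 + (1 - eps) * q ^ 3" "m4 = eps * p ^ 4 + (1 - eps) * q ^ 4"
  have 1: "eps * p + (1 - eps) * q = 0" and 2: "eps * p\<^sup>2 + (1 - eps) * q\<^sup>2 = 1"
    using phi_mean phi_var by (auto simp: p_q_def)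
  have "eps * (g + p * h) ^ 4 + (1 - eps) * (g + q * h) ^ 4 =
    g ^ 4 + 4 * g ^ 3 * h * (eps * p + (1 - eps) * q) + 6 * g\<^sup>2 * h\<^sup>2 * (eps * p\<^sup>2 + (1 - eps) * q\<^sup>2)
     + 4 * g * h ^ 3 * m3 + m4 * h ^ 4"
    unfolding m3_m4_def by (simp add: power4_eq_xxxx power3_eq_cube power2_eq_square algebra_simps)
  also have "\<dots> = g ^ 4 + 6 * (g\<^sup>2 * h\<^sup>2) + 2 * (2 * (g * h) * (m3 * h\<^sup>2)) + m4 * h ^ 4"
    unfolding 1 2 by (simp add: power4_eq_xxxx power3_eq_cube power2_eq_square algebra_simps)
  also have "\<dots> \<le> g ^ 4 + 6 * (g\<^sup>2 * h\<^sup>2) + 2 * ((g * h)\<^sup>2 + (m3 * h\<^sup>2)\<^sup>2) + m4 * h ^ 4"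
    using sum_squares_bound[of "g * h" "m3 * h\<^sup>2"] by simp
  also have "\<dots> = g ^ 4 + 8 * (g\<^sup>2 * h\<^sup>2) + (m4 + 2 * m3\<^sup>2) * h ^ 4"
    by (simp add: power4_eq_xxxx power2_eq_square algebra_simps)
  also have "\<dots> \<le> g ^ 4 + 8 * (g\<^sup>2 * h\<^sup>2) + hyp_const * h ^ 4"
    unfolding hyp_const_def m3_m4_def p_q_def by (intro add_left_mono mult_right_mono) auto
  finally show ?thesis by (simp add: p_q_def)
qed

text \<open>Bonami's lemma for the biased basis. In the decomposition \<open>f = g + phi h\<close>
  with respect to one coordinate, \<open>h\<close> has degree one less and so a factor of the
  constant to spare; Cauchy-Schwarz bounds the cross term by the geometric mean of the two inductive
  bounds.\<close>

lemma hypercontractive: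
  assumes "finite A" "\<And>S. S \<subseteq> A \<Longrightarrow> card S > D \<Longrightarrow> a S = 0"
  shows "E A (\<lambda>Z. (\<Sum>S\<in>Pow A. a S * chi S Z) ^ 4) \<le> hyp_const ^ D * (\<Sum>S\<in>Pow A. (a S)\<^sup>2)\<^sup>2"
  using assms
proof (induction A arbitrary: a D rule: finite_induct)
  case empty
  have "1 \<le> hyp_const ^ D" using one_le_power[of hyp_const D] hyp_const_ge by simp
  then have "1 * (a {}) ^ 4 \<le> hyp_const ^ D * (a {}) ^ 4" by (intro mult_right_mono) auto
  then show ?case by (simp add: chi_def)
next
  case (insert v A)
  let ?K = hyp_const
  let ?g = "\<lambda>Z. \<Sum>S\<in>Pow A. a S * chi S Z"
  let ?h = "\<lambda>Z. \<Sum>S\<in>Pow A. a (insert v S) * chi S Z"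
  define X where "X = (\<Sum>S\<in>Pow A. (a S)\<^sup>2)"
  define Y where "Y = (\<Sum>S\<in>Pow A. (a (insert v S))\<^sup>2)"
  have XY: "X \<ge> 0" "Y \<ge> 0" unfolding X_def Y_def by (auto intro: sum_nonneg)
  have ins: "(\<Sum>S\<in>Pow (insert v A). F S) = (\<Sum>S\<in>Pow A. F S) + (\<Sum>S\<in>Pow A. F (insert v S))"
    for F :: "'a set \<Rightarrow> real"
  proof -
    have "inj_on (insert v) (Pow A)" using insert(2) by (auto simp: inj_on_def)
    then show ?thesis unfolding Pow_insert using insert(1,2)
      by (subst sum.union_disjoint) (auto simp: sum.reindex)
  qed
  have chi_ins: "chi S (insert v Z) = chi S Z" "chi (insert v S) Z' = phi (v \<in> Z') * chi S Z'"
    if "S \<subseteq> A" for S Z Z'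
  proof -
    have "v \<notin> S" "finite S" using that insert finite_subset by auto
    then show "chi S (insert v Z) = chi S Z" "chi (insert v S) Z' = phi (v \<in> Z') * chi S Z'"
      unfolding chi_def by (auto intro!: prod.cong arg_cong[of _ _ phi])
  qed
  have f1: "(\<Sum>S\<in>Pow (insert v A). a S * chi S (insert v Z)) = ?g Z + phi True * ?h Z" for Z
    unfolding ins by (simp add: chi_ins sum_distrib_left algebra_simps)
  have f0: "(\<Sum>S\<in>Pow (insert v A). a S * chi S Z) = ?g Z + phi False * ?h Z" if "Z \<subseteq> A" for Z
  proof -
    have "v \<notin> Z" using that insert by auto
    then show ?thesis unfolding ins by (simp add: chi_ins sum_distrib_left algebra_simps)
  qed
  have "E (insert v A) (\<lambda>Z. (\<Sum>S\<in>Pow (insert v A). a S * chi S Z) ^ 4) =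
    E A (\<lambda>Z. eps * (?g Z + phi True * ?h Z) ^ 4 + (1 - eps) * (?g Z + phi False * ?h Z) ^ 4)"
    unfolding E_insert[OF insert(1,2)] by (rule E_cong) (simp only: f0 f1)
  also have "\<dots> \<le> E A (\<lambda>Z. ?g Z ^ 4 + 8 * ((?g Z)\<^sup>2 * (?h Z)\<^sup>2) + ?K * ?h Z ^ 4)"
    by (rule E_mono) (rule phi_fourth_moment)
  also have "\<dots> = E A (\<lambda>Z. ?g Z ^ 4) + 8 * E A (\<lambda>Z. (?g Z)\<^sup>2 * (?h Z)\<^sup>2) + ?K * E A (\<lambda>Z. ?h Z ^ 4)"
    by (simp add: E_add E_cmult)
  also have "\<dots> \<le> ?K ^ D * (X + Y)\<^sup>2"
  proof -
    have G: "E A (\<lambda>Z. ?g Z ^ 4) \<le> ?K ^ D * X\<^sup>2"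
      unfolding X_def by (intro insert.IH insert.prems) auto
    show ?thesis
    proof (cases D)
      \<comment> \<open>There is no degree to spare, but then \<open>h\<close> vanishes.\<close>
      case 0
      have z: "a (insert v S) = 0" if "S \<subseteq> A" for S
      proof -
        have "finite S" using that insert(1) finite_subset[of S A] by auto
        then show ?thesis using that insert.prems[of "insert v S"] 0 by (auto simp: card_gt_0_iff)
      qed
      have h0: "?h Z = 0" for Z using z by (auto intro!: sum.neutral)
      moreover have "Y = 0" unfolding Y_def using z by (auto intro!: sum.neutral)
      ultimately show ?thesis using G insert(1) by (simp add: h0)
    next
      case (Suc d)
      have H: "E A (\<lambda>Z. ?h Z ^ 4) \<le> ?K ^ d * Y\<^sup>2"
        unfolding Y_def
      proof (rule insert.IH)
        fix S assume S: "S \<subseteq> A" "d < card S"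
        then have "v \<notin> S" "finite S" using insert(1,2) finite_subset[of S A] by auto
        then show "a (insert v S) = 0" using S Suc insert.prems[of "insert v S"] by auto
      qed
      have "(E A (\<lambda>Z. (?g Z)\<^sup>2 * (?h Z)\<^sup>2))\<^sup>2 \<le> E A (\<lambda>Z. ((?g Z)\<^sup>2)\<^sup>2) * E A (\<lambda>Z. ((?h Z)\<^sup>2)\<^sup>2)"
        by (rule E_Cauchy_Schwarz)
      also have "\<dots> = E A (\<lambda>Z. ?g Z ^ 4) * E A (\<lambda>Z. ?h Z ^ 4)" by (simp flip: power_mult)
      also have "\<dots> \<le> (?K ^ D * X\<^sup>2) * (?K ^ d * Y\<^sup>2)"
        using G H hyp_const_ge by (intro mult_mono) (auto intro!: E_nonneg mult_nonneg_nonneg)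
      also have "\<dots> = (?K ^ d * X * Y)\<^sup>2 * ?K"
        using Suc by (simp add: power2_eq_square algebra_simps)
      \<comment> \<open>\<open>K <= (K / 4)^2\<close> because \<open>K >= 16\<close>. The resulting
        1/4 turns the coefficient 8 into the 2 of the binomial square.\<close>
      also have "\<dots> \<le> (?K ^ d * X * Y)\<^sup>2 * (?K / 4)\<^sup>2"
        using hyp_const_ge by (intro mult_left_mono) (auto simp: power2_eq_square)
      also have "\<dots> = (?K ^ D * X * Y / 4)\<^sup>2"
        using Suc by (simp add: power2_eq_square algebra_simps)
      finally have sq: "(E A (\<lambda>Z. (?g Z)\<^sup>2 * (?h Z)\<^sup>2))\<^sup>2 \<le> (?K ^ D * X * Y / 4)\<^sup>2" .
      have "0 \<le> ?K ^ D * X * Y / 4" using XY hyp_const_ge by simp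
      with sq have "E A (\<lambda>Z. (?g Z)\<^sup>2 * (?h Z)\<^sup>2) \<le> ?K ^ D * X * Y / 4"
        by (rule power2_le_imp_le)
      moreover have "?K * E A (\<lambda>Z. ?h Z ^ 4) \<le> ?K * (?K ^ d * Y\<^sup>2)"
        using H hyp_const_ge by (intro mult_left_mono) auto
      moreover have "?K * (?K ^ d * Y\<^sup>2) = ?K ^ D * Y\<^sup>2" by (simp add: Suc)
      ultimately have "E A (\<lambda>Z. ?g Z ^ 4) + 8 * E A (\<lambda>Z. (?g Z)\<^sup>2 * (?h Z)\<^sup>2) + ?K * E A (\<lambda>Z. ?h Z ^ 4)
        \<le> ?K ^ D * X\<^sup>2 + 8 * (?K ^ D * X * Y / 4) + ?K ^ D * Y\<^sup>2"
        using G by linarith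
      also have "\<dots> = ?K ^ D * (X + Y)\<^sup>2" by (simp add: power2_eq_square algebra_simps)
      finally show ?thesis .
    qed
  qed
  also have "X + Y = (\<Sum>S\<in>Pow (insert v A). (a S)\<^sup>2)" by (simp add: ins X_def Y_def)
  finally show ?case .
qed

section \<open>Moments of functions of bounded degree\<close>

definition low_degree :: "'a set \<Rightarrow> nat \<Rightarrow> ('a set \<Rightarrow> real) \<Rightarrow> bool" where
  "low_degree A D f \<longleftrightarrow> (\<forall>S\<subseteq>A. D < card S \<longrightarrow> coef A f S = 0)"

lemma low_degree_fourth_moment:
  assumes "finite A" "low_degree A D f"
  shows "E A (\<lambda>Z. f Z ^ 4) \<le> hyp_const ^ D * (E A (\<lambda>Z. (f Z)\<^sup>2))\<^sup>2"
proof -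
  have "E A (\<lambda>Z. f Z ^ 4) = E A (\<lambda>Z. (\<Sum>S\<in>Pow A. coef A f S * chi S Z) ^ 4)"
    using chi_expansion[OF assms(1), of _ f] by (intro E_cong) simp
  also have "\<dots> \<le> hyp_const ^ D * (\<Sum>S\<in>Pow A. (coef A f S)\<^sup>2)\<^sup>2"
    using assms by (intro hypercontractive) (auto simp: low_degree_def)
  finally show ?thesis using Plancherel[OF assms(1), of f] by simp
qed

text \<open>Under the biased measure \<open>chi S * chi T\<close> is not a character, but its
  spectrum lies in the subsets of \<open>S \<union> T\<close>: a coordinate of \<open>U\<close>
  outside contributes a factor of mean 0. This makes degrees subadditive in
  \<open>low_degree_mult\<close>.\<close>

lemma E_chi_triple:
  assumes "finite A" "S \<subseteq> A" "T \<subseteq> A" "U \<subseteq> A" "\<not> U \<subseteq> S \<union> T"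
  shows "E A (\<lambda>Z. chi S Z * chi T Z * chi U Z) = 0"
proof -
  let ?h = "\<lambda>v b. (if v \<in> S then phi b else 1) * (if v \<in> T then phi b else 1) * (if v \<in> U then phi b else 1)"
  have "chi S Z = (\<Prod>v\<in>A. if v \<in> S then phi (v \<in> Z) else 1)" if "S \<subseteq> A" for S Z
    unfolding chi_def using assms(1) that by (simp add: prod.If_cases Int_absorb1)
  then have "E A (\<lambda>Z. chi S Z * chi T Z * chi U Z) = E A (\<lambda>Z. \<Prod>v\<in>A. ?h v (v \<in> Z))"
    using assms by (intro E_cong) (simp add: prod.distrib)
  also have "\<dots> = (\<Prod>v\<in>A. eps * ?h v True + (1 - eps) * ?h v False)"
    using E_prod[OF assms(1), of ?h] by simp
  also have "\<dots> = 0"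
  proof -
    obtain v where v: "v \<in> U" "v \<notin> S" "v \<notin> T" using assms by auto
    then have "eps * ?h v True + (1 - eps) * ?h v False = 0" using phi_mean by auto
    then show ?thesis using v assms(4) by (intro prod_zero[OF assms(1)] bexI[of _ v]) auto
  qed
  finally show ?thesis .
qed

lemma low_degree_mult:
  assumes fin: "finite A" and f: "low_degree A D f" and g: "low_degree A D' g"
  shows "low_degree A (D + D') (\<lambda>Z. f Z * g Z)"
  unfolding low_degree_def
proof (intro allI impI)
  fix U assume U: "U \<subseteq> A" "D + D' < card U"
  have "coef A (\<lambda>Z. f Z * g Z) U = E A (\<lambda>Z. \<Sum>S\<in>Pow A. \<Sum>T\<in>Pow A. coef A f S * coef A g T * (chi S Z * chi T Z * chi U Z))"
    unfolding coef_def[of A "\<lambda>Z. f Z * g Z"]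
  proof (rule E_cong)
    fix Z assume "Z \<subseteq> A"
    then show "f Z * g Z * chi U Z = (\<Sum>S\<in>Pow A. \<Sum>T\<in>Pow A. coef A f S * coef A g T * (chi S Z * chi T Z * chi U Z))"
      unfolding chi_expansion[OF fin \<open>Z \<subseteq> A\<close>, of f] chi_expansion[OF fin \<open>Z \<subseteq> A\<close>, of g] sum_product
      unfolding sum_distrib_right by (intro sum.cong refl) (simp only: mult_ac)
  qed
  also have "\<dots> = (\<Sum>S\<in>Pow A. \<Sum>T\<in>Pow A. coef A f S * coef A g T * E A (\<lambda>Z. chi S Z * chi T Z * chi U Z))"
    by (simp add: E_sum E_cmult)
  also have "\<dots> = 0"
  proof (intro sum.neutral ballI)
    fix S T assume ST: "S \<in> Pow A" "T \<in> Pow A"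
    then have finST: "finite S" "finite T" using fin finite_subset by auto
    show "coef A f S * coef A g T * E A (\<lambda>Z. chi S Z * chi T Z * chi U Z) = 0"
    proof (cases "card S > D \<or> card T > D'")
      case True then show ?thesis using f g ST by (auto simp: low_degree_def)
    next
      case False
      have "\<not> U \<subseteq> S \<union> T"
      proof
        assume "U \<subseteq> S \<union> T"
        then have "card U \<le> card (S \<union> T)" using finST by (intro card_mono) auto
        then show False using card_Un_le[of S T] False U by linarith
      qed
      then show ?thesis using ST U E_chi_triple[OF fin] by simp
    qed
  qed
  finally show "coef A (\<lambda>Z. f Z * g Z) U = 0" .
qed

lemma low_degree_power:
  assumes "finite A" "low_degree A D f"
  shows "low_degree A (n * D) (\<lambda>Z. f Z ^ n)"
proof (induction n)
  case 0
  have "coef A (\<lambda>_. 1) S = of_bool ({} = S)" if "S \<subseteq> A" for S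
    using E_chi_prod[OF assms(1), of "{}" S] that by (simp add: coef_def chi_def)
  then show ?case by (auto simp: low_degree_def)
next
  case (Suc n)
  then show ?case using low_degree_mult[OF assms(1,2) Suc] by (simp add: add.commute)
qed

text \<open>The fourth-moment bound is applied to \<open>f ^ 2 ^ (s - 1)\<close>, so each step
  doubles the order of the moment. The degree doubles along with it, which costs only a factor
  linear in \<open>s\<close> in the exponent of the constant.\<close>

lemma low_degree_moment:
  assumes fin: "finite A" and f: "low_degree A D f" and "1 \<le> s"
  shows "E A (\<lambda>Z. f Z ^ (2 ^ s)) \<le> (hyp_const ^ (D * s)) ^ (2 ^ s) * (E A (\<lambda>Z. (f Z)\<^sup>2)) ^ (2 ^ (s - 1))"
  using \<open>1 \<le> s\<close>
proof (induction s rule: dec_induct)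
  case base
  have "0 \<le> E A (\<lambda>Z. (f Z)\<^sup>2)" by (rule E_nonneg) simp
  moreover have "1 \<le> (hyp_const ^ (D * 1)) ^ (2 ^ 1)" using hyp_const_ge by (intro one_le_power) auto
  ultimately show ?case using mult_right_mono by fastforce
next
  case (step s)
  let ?v = "E A (\<lambda>Z. (f Z)\<^sup>2)"
  have s: "2 ^ s = 2 * (2 ^ (s - 1) :: nat)" using step by (metis One_nat_def Suc_pred less_eq_Suc_le power_Suc)
  have ld: "low_degree A (2 ^ (s - 1) * D) (\<lambda>Z. f Z ^ 2 ^ (s - 1))"
    by (rule low_degree_power[OF fin f])
  have "E A (\<lambda>Z. f Z ^ (2 ^ Suc s)) = E A (\<lambda>Z. (f Z ^ 2 ^ (s - 1)) ^ 4)"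
    by (simp add: s flip: power_mult) (simp add: mult.commute)
  also have "\<dots> \<le> hyp_const ^ (2 ^ (s - 1) * D) * (E A (\<lambda>Z. (f Z ^ 2 ^ (s - 1))\<^sup>2))\<^sup>2"
    by (rule low_degree_fourth_moment[OF fin ld])
  also have "E A (\<lambda>Z. (f Z ^ 2 ^ (s - 1))\<^sup>2) = E A (\<lambda>Z. f Z ^ 2 ^ s)"
    by (simp add: s flip: power_mult) (simp add: mult.commute)
  also have "hyp_const ^ (2 ^ (s - 1) * D) * (E A (\<lambda>Z. f Z ^ 2 ^ s))\<^sup>2 \<le>
    hyp_const ^ (2 ^ (s - 1) * D) * ((hyp_const ^ (D * s)) ^ (2 ^ s) * ?v ^ (2 ^ (s - 1)))\<^sup>2"
  proof (intro mult_left_mono power_mono step.IH)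
    show "0 \<le> E A (\<lambda>Z. f Z ^ 2 ^ s)" by (rule E_nonneg) (simp add: s)
  qed (use hyp_const_ge in auto)
  also have "\<dots> = hyp_const ^ (2 ^ (s - 1) * D + 2 * (D * s * 2 ^ s)) * ?v ^ (2 * 2 ^ (s - 1))"
    by (simp only: power_mult_distrib power_add power_mult[symmetric]) (simp add: mult_ac)
  also have "\<dots> \<le> hyp_const ^ (D * Suc s * 2 ^ Suc s) * ?v ^ (2 * 2 ^ (s - 1))"
  proof (intro mult_right_mono power_increasing)
    show "2 ^ (s - 1) * D + 2 * (D * s * 2 ^ s) \<le> D * Suc s * 2 ^ Suc s"
      by (simp add: s algebra_simps)
  qed (use hyp_const_ge in \<open>auto intro!: zero_le_power E_nonneg\<close>)
  also have "\<dots> = (hyp_const ^ (D * Suc s)) ^ (2 ^ Suc s) * ?v ^ (2 ^ (Suc s - 1))"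
    using s by (simp flip: power_mult)
  finally show ?case .
qed

end


subsection \<open>Weak decoding from the entropy bound\<close>

definition sd :: "'a set \<Rightarrow> 'a set \<Rightarrow> 'a set" where
  "sd A B = (A - B) \<union> (B - A)"

lemma in_sd [simp]: "x \<in> sd A B \<longleftrightarrow> (x \<in> A) \<noteq> (x \<in> B)"
  by (auto simp: sd_def)

lemma sd_cancel [simp]: "sd A (sd A B) = B"
  by (auto simp: set_eq_iff)

lemma sd_subset: "A \<subseteq> X \<Longrightarrow> B \<subseteq> X \<Longrightarrow> sd A B \<subseteq> X"
  by (auto simp: sd_def)

lemma sum_sd_shift:
  assumes "c \<in> C" "\<And>a b. a \<in> C \<Longrightarrow> b \<in> C \<Longrightarrow> sd a b \<in> C"
  shows "(\<Sum>d\<in>C. f (sd c d)) = (\<Sum>d\<in>C. f d)"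
  by (rule sum.reindex_bij_witness[of _ "sd c" "sd c"]) (use assms in auto)

lemma sum_Pow_sd_shift:
  fixes A :: "'a set"
  shows "(\<Sum>Y\<in>Pow A. f (sd c Y \<inter> A)) = (\<Sum>Y\<in>Pow A. f Y)"
proof -
  have inv: "sd c (sd c Y \<inter> A) \<inter> A = Y" if "Y \<in> Pow A" for Y using that by (auto simp: set_eq_iff)
  have bij: "bij_betw (\<lambda>Y. sd c Y \<inter> A) (Pow A) (Pow A)"
    by (rule bij_betw_byWitness[of _ "\<lambda>Y. sd c Y \<inter> A"]) (use inv in blast)+
  show ?thesis by (rule sum.reindex_bij_betw[OF bij])
qed

text \<open>A code is a family of supports with symmetric difference as addition. Codewords, noise
  patterns and received words then have the same type.\<close>

locale lin_code = bsc +
  fixes Om :: "'a set" and C :: "'a set set"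
  assumes fin_Om [simp]: "finite Om" and C_sub: "C \<subseteq> Pow Om" and C_empty: "{} \<in> C"
    and C_sd: "a \<in> C \<Longrightarrow> b \<in> C \<Longrightarrow> sd a b \<in> C"
begin

lemma fin_C [simp]: "finite C"
  using finite_subset[OF C_sub] by simp

lemma card_C_pos: "card C > 0"
  using C_empty card_gt_0_iff fin_C by blast

lemma C_ne [simp]: "C \<noteq> {}"
  using C_empty by auto

definition sg :: "'a \<Rightarrow> 'a set \<Rightarrow> real" where
  "sg x c = (if x \<in> c then -1 else 1)"

text \<open>\<open>wt A (sd c Y \<inter> A)\<close> is the probability that \<open>c\<close> is
  received as \<open>Y\<close> on \<open>A\<close>, so \<open>pr A\<close> is the law of the
  received word on \<open>A\<close> for a uniform codeword.\<close>

definition pr :: "'a set \<Rightarrow> 'a set \<Rightarrow> real" where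
  "pr A Y = (\<Sum>c\<in>C. wt A (sd c Y \<inter> A)) / card C"

definition bias :: "'a set \<Rightarrow> 'a \<Rightarrow> 'a set \<Rightarrow> real" where
  "bias A x Y = (\<Sum>c\<in>C. sg x c * wt A (sd c Y \<inter> A)) / card C"

text \<open>\<open>post A x Y\<close> is the posterior mean of the sign of the codeword bit at \<open>x\<close>, given that
  \<open>Y\<close> was received on the coordinates \<open>A\<close>.\<close>
definition post :: "'a set \<Rightarrow> 'a \<Rightarrow> 'a set \<Rightarrow> real" where
  "post A x Y = bias A x Y / pr A Y"

text \<open>The second moment of \<open>post A x\<close> under \<open>pr A\<close>: how much the
  coordinates in \<open>A\<close> reveal about the codeword bit at \<open>x\<close>. In this
  quotient form monotonicity becomes a convexity statement.\<close>

definition gain :: "'a set \<Rightarrow> 'a \<Rightarrow> real" where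
  "gain A x = (\<Sum>Y\<in>Pow A. (bias A x Y)\<^sup>2 / pr A Y)"

lemma sg_sq [simp]: "sg x c * sg x c = 1" "sg x c * (sg x c * y) = y" "\<bar>sg x c\<bar> = 1"
  by (auto simp: sg_def)

lemma sg_sd: "sg x (sd c d) = sg x c * sg x d"
  by (auto simp: sg_def)

lemma pr_pos: "pr A Y > 0"
  unfolding pr_def using card_C_pos C_empty wt_pos by (intro divide_pos_pos sum_pos) auto

lemma bias_le: "\<bar>bias A x Y\<bar> \<le> pr A Y"
proof -
  have "\<bar>\<Sum>c\<in>C. sg x c * wt A (sd c Y \<inter> A)\<bar> \<le> (\<Sum>c\<in>C. \<bar>sg x c * wt A (sd c Y \<inter> A)\<bar>)"
    by (rule sum_abs)
  also have "\<dots> = (\<Sum>c\<in>C. wt A (sd c Y \<inter> A))"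
    by (simp add: abs_mult wt_nonneg)
  finally show ?thesis unfolding bias_def pr_def using card_C_pos by (simp add: divide_right_mono)
qed

lemma post_le: "\<bar>post A x Y\<bar> \<le> 1"
  unfolding post_def using bias_le[of A x Y] pr_pos[of A Y] by (simp add: divide_le_eq)

lemma wt_insert:
  assumes "finite A" "x \<notin> A" "Z \<subseteq> A"
  shows "wt (insert x A) Z = (1 - eps) * wt A Z" "wt (insert x A) (insert x Z) = eps * wt A Z"
proof -
  have fin: "finite Z" "x \<notin> Z" using assms finite_subset by auto
  have "insert x A - Z = insert x (A - Z)" using fin by auto
  moreover have "insert x A - insert x Z = A - Z" using assms by auto
  ultimately show "wt (insert x A) Z = (1 - eps) * wt A Z" "wt (insert x A) (insert x Z) = eps * wt A Z"
    using assms fin by (simp_all add: wt_def)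
qed

lemma wt_insert_sd:
  assumes "finite A" "x \<notin> A" "Y \<subseteq> A"
  shows "wt (insert x A) (sd c Y \<inter> insert x A) = (1 + (1 - 2 * eps) * sg x c) / 2 * wt A (sd c Y \<inter> A)"
    and "wt (insert x A) (sd c (insert x Y) \<inter> insert x A) = (1 - (1 - 2 * eps) * sg x c) / 2 * wt A (sd c Y \<inter> A)"
proof -
  have xY: "x \<notin> Y" using assms by auto
  have e: "sd c (insert x Y) \<inter> insert x A = (if x \<in> c then sd c Y \<inter> A else insert x (sd c Y \<inter> A))"
     "sd c Y \<inter> insert x A = (if x \<in> c then insert x (sd c Y \<inter> A) else sd c Y \<inter> A)"
    using xY assms(2) by (auto simp: set_eq_iff)
  show "wt (insert x A) (sd c Y \<inter> insert x A) = (1 + (1 - 2 * eps) * sg x c) / 2 * wt A (sd c Y \<inter> A)"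
    "wt (insert x A) (sd c (insert x Y) \<inter> insert x A) = (1 - (1 - 2 * eps) * sg x c) / 2 * wt A (sd c Y \<inter> A)"
    unfolding e by (simp_all add: wt_insert[OF assms(1,2)] sg_def field_simps)
qed

lemma sum_affine:
  fixes k :: real
  shows "(\<Sum>c\<in>D. (1 + k * s c) / 2 * w c) = ((\<Sum>c\<in>D. w c) + k * (\<Sum>c\<in>D. s c * w c)) / 2"
proof -
  have "(1 + k * s c) / 2 * w c = w c / 2 + k / 2 * (s c * w c)" for c by (simp add: field_simps)
  then show ?thesis by (simp add: sum.distrib add_divide_distrib flip: sum_distrib_left sum_divide_distrib)
qed

text \<open>Given \<open>Y\<close> on \<open>A\<close>, the sign of the next received bit has mean
  \<open>(1 - 2 * eps) * post A x Y\<close>: the channel shrinks the posterior mean by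
  \<open>1 - 2 * eps\<close>.\<close>

lemma pr_insert:
  assumes "finite A" "x \<notin> A" "Y \<subseteq> A"
  shows "pr (insert x A) Y = (pr A Y + (1 - 2 * eps) * bias A x Y) / 2"
    and "pr (insert x A) (insert x Y) = (pr A Y - (1 - 2 * eps) * bias A x Y) / 2"
proof -
  have neg: "1 - (1 - 2 * eps) * s = 1 + (- (1 - 2 * eps)) * s" for s by (simp add: algebra_simps)
  show "pr (insert x A) Y = (pr A Y + (1 - 2 * eps) * bias A x Y) / 2"
    "pr (insert x A) (insert x Y) = (pr A Y - (1 - 2 * eps) * bias A x Y) / 2"
    unfolding pr_def bias_def wt_insert_sd[OF assms] neg sum_affine
    using card_C_pos by (simp_all add: field_simps)
qed

lemma marginal:
  assumes "finite A" "x \<notin> A" "Y \<subseteq> A"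
  shows "pr A Y = pr (insert x A) Y + pr (insert x A) (insert x Y)"
    and "bias A z Y = bias (insert x A) z Y + bias (insert x A) z (insert x Y)"
proof -
  have "wt A (sd c Y \<inter> A) = wt (insert x A) (sd c Y \<inter> insert x A) + wt (insert x A) (sd c (insert x Y) \<inter> insert x A)" for c
    unfolding wt_insert_sd[OF assms] by (simp add: field_simps)
  then show "pr A Y = pr (insert x A) Y + pr (insert x A) (insert x Y)"
    "bias A z Y = bias (insert x A) z Y + bias (insert x A) z (insert x Y)"
    by (simp_all add: pr_def bias_def distrib_left sum.distrib add_divide_distrib)
qed

lemma sum_Pow_insert:
  assumes "finite A" "x \<notin> A"
  shows "(\<Sum>Y\<in>Pow (insert x A). f Y) = (\<Sum>Y\<in>Pow A. f Y + f (insert x Y) :: real)"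
proof -
  have "inj_on (insert x) (Pow A)" using assms by (auto simp: inj_on_def)
  then show ?thesis unfolding Pow_insert using assms
    by (subst sum.union_disjoint) (auto simp: sum.reindex sum.distrib)
qed

lemma sum_sq_divide:
  fixes a b p q :: real assumes "0 < p" "0 < q"
  shows "(a + b)\<^sup>2 / (p + q) \<le> a\<^sup>2 / p + b\<^sup>2 / q"
proof -
  have "a\<^sup>2 / p + b\<^sup>2 / q - (a + b)\<^sup>2 / (p + q) = (a * q - b * p)\<^sup>2 / (p * q * (p + q))"
    using assms by (simp add: divide_simps) (simp add: power2_eq_square algebra_simps)
  also have "\<dots> \<ge> 0" using assms by simp
  finally show ?thesis by simp
qed

text \<open>More observations cannot lower the second moment of a posterior mean: the quantities on
  \<open>A\<close> are sums over the two values of the new bit, and \<open>a^2 / p\<close> is convex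
  and homogeneous.\<close>

lemma gain_insert:
  assumes "finite A" "z \<notin> A" shows "gain A x \<le> gain (insert z A) x"
  unfolding gain_def sum_Pow_insert[OF assms]
proof (rule sum_mono)
  fix Y assume "Y \<in> Pow A"
  then show "(bias A x Y)\<^sup>2 / pr A Y \<le> (bias (insert z A) x Y)\<^sup>2 / pr (insert z A) Y
     + (bias (insert z A) x (insert z Y))\<^sup>2 / pr (insert z A) (insert z Y)"
    using marginal[OF assms, of Y] sum_sq_divide pr_pos by auto
qed

lemma gain_mono:
  assumes "finite B" "A \<subseteq> B" shows "gain A x \<le> gain B x"
proof -
  have "finite (B - A)" using assms by simp
  moreover have "finite D \<Longrightarrow> D \<inter> A = {} \<Longrightarrow> finite A \<Longrightarrow> gain A x \<le> gain (A \<union> D) x" for D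
  proof (induction D rule: finite_induct)
    case (insert z D)
    then have "gain (A \<union> D) x \<le> gain (insert z (A \<union> D)) x" by (intro gain_insert) auto
    then show ?case using insert by auto
  qed simp
  ultimately have "gain A x \<le> gain (A \<union> (B - A)) x" using assms finite_subset by (metis Diff_disjoint inf_commute)
  then show ?thesis using assms by (simp add: Un_absorb1)
qed

section \<open>Divergence of the received word from the uniform distribution, in nats\<close>

definition kl :: "'a set \<Rightarrow> real" where
  "kl A = (\<Sum>Y\<in>Pow A. pr A Y * ln (2 ^ card A * pr A Y))"

text \<open>Chain rule: the increment is the mean divergence of a bit of bias
  \<open>t = (1 - 2 * eps) * post A x Y\<close> from a fair bit. By \<open>ln (1 + t) <= t\<close>
  this divergence is at most \<open>t^2\<close>, which is at most the squared posterior
  mean.\<close>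

lemma kl_insert:
  assumes "finite A" "x \<notin> A" shows "kl (insert x A) \<le> kl A + gain A x"
  unfolding kl_def gain_def sum_Pow_insert[OF assms] sum.distrib[symmetric]
proof (rule sum_mono)
  fix Y assume "Y \<in> Pow A"
  then have Y: "Y \<subseteq> A" by simp
  define p t where "p = pr A Y" "t = (1 - 2 * eps) * (bias A x Y / p)"
  have p: "p > 0" using pr_pos by (simp add: p_t_def)
  have bt: "(1 - 2 * eps) * bias A x Y = t * p" using p by (simp add: p_t_def)
  have "\<bar>t\<bar> = (1 - 2 * eps) * \<bar>post A x Y\<bar>" using eps_half by (simp add: p_t_def post_def abs_mult)
  also have "\<dots> \<le> (1 - 2 * eps) * 1" using post_le eps_half by (intro mult_left_mono) auto
  finally have t: "\<bar>t\<bar> < 1" using eps_pos by simp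
  have c: "card (insert x A) = Suc (card A)" using assms by simp
  have P1: "pr (insert x A) Y = p * (1 + t) / 2" and P2: "pr (insert x A) (insert x Y) = p * (1 - t) / 2"
    unfolding pr_insert[OF assms Y] bt by (simp_all add: p_t_def algebra_simps)
  have l1: "ln (2 ^ card (insert x A) * pr (insert x A) Y) = ln (2 ^ card A * p) + ln (1 + t)"
  proof -
    have "2 ^ card (insert x A) * pr (insert x A) Y = (2 ^ card A * p) * (1 + t)"
      unfolding P1 c by simp
    moreover have "2 ^ card A * p > 0" using p by simp
    ultimately show ?thesis using t by (simp add: ln_mult_pos)
  qed
  have l2: "ln (2 ^ card (insert x A) * pr (insert x A) (insert x Y)) = ln (2 ^ card A * p) + ln (1 - t)"
  proof -
    have "2 ^ card (insert x A) * pr (insert x A) (insert x Y) = (2 ^ card A * p) * (1 - t)"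
      unfolding P2 c by simp
    moreover have "2 ^ card A * p > 0" using p by simp
    ultimately show ?thesis using t by (simp add: ln_mult_pos)
  qed
  have "pr (insert x A) Y * ln (2 ^ card (insert x A) * pr (insert x A) Y)
      + pr (insert x A) (insert x Y) * ln (2 ^ card (insert x A) * pr (insert x A) (insert x Y))
      = p * ln (2 ^ card A * p) + p * ((1 + t) * ln (1 + t) + (1 - t) * ln (1 - t)) / 2"
    unfolding l1 l2 unfolding P1 P2 by (simp add: field_simps)
  also have "\<dots> \<le> p * ln (2 ^ card A * p) + p * ((1 + t) * t + (1 - t) * (- t)) / 2"
    using p t ln_add_one_self_le_self2[of t] ln_add_one_self_le_self2[of "-t"]
    by (intro add_mono divide_right_mono mult_left_mono) auto
  also have "\<dots> = p * ln (2 ^ card A * p) + p * t\<^sup>2" by (simp add: power2_eq_square algebra_simps)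
  also have "p * t\<^sup>2 = (1 - 2 * eps)\<^sup>2 * ((bias A x Y)\<^sup>2 / p)"
    using p by (simp add: p_t_def power2_eq_square)
  also have "\<dots> \<le> 1 * ((bias A x Y)\<^sup>2 / p)"
    using p eps_pos eps_half by (intro mult_right_mono power_le_one) auto
  finally show "pr (insert x A) Y * ln (2 ^ card (insert x A) * pr (insert x A) Y)
      + pr (insert x A) (insert x Y) * ln (2 ^ card (insert x A) * pr (insert x A) (insert x Y))
      \<le> pr A Y * ln (2 ^ card A * pr A Y) + (bias A x Y)\<^sup>2 / pr A Y"
    by (simp add: p_t_def)
qed

text \<open>The coordinates are exposed one at a time; what the earlier ones reveal about
  \<open>x\<close> is at most what all the others reveal.\<close>

lemma kl_upper:
  fixes mu :: real
  assumes mu: "\<And>x. x \<in> Om \<Longrightarrow> gain (Om - {x}) x \<le> mu"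
  shows "kl Om \<le> card Om * mu"
proof -
  have "finite A \<Longrightarrow> A \<subseteq> Om \<Longrightarrow> kl A \<le> card A * mu" for A
  proof (induction A rule: finite_induct[consumes 1])
    case empty
    have "pr {} {} = 1" using card_C_pos by (simp add: pr_def wt_def)
    then show ?case by (simp add: kl_def)
  next
    case (insert x A)
    have "gain A x \<le> gain (Om - {x}) x" using insert by (intro gain_mono) auto
    then show ?case using kl_insert[of A x] insert mu[of x] by (simp add: algebra_simps)
  qed
  then show ?thesis by simp
qed

lemma E_indicator_fun:
  assumes "finite A" "v \<in> A" shows "E A (\<lambda>Z. h (v \<in> Z)) = eps * h True + (1 - eps) * h False"
proof -
  have "E A (\<lambda>Z. h (v \<in> Z)) = E A (\<lambda>Z. \<Prod>u\<in>A. (if u = v then h (u \<in> Z) else 1))"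
    using assms by (intro E_cong) (simp add: prod.delta)
  also have "\<dots> = (\<Prod>u\<in>A. eps * (if u = v then h True else 1) + (1 - eps) * (if u = v then h False else 1))"
    using E_prod[OF assms(1), of "\<lambda>u b. if u = v then h b else 1"] by simp
  also have "\<dots> = (\<Prod>u\<in>A. if u = v then eps * h True + (1 - eps) * h False else 1)"
    by (intro prod.cong) auto
  finally show ?thesis using assms by (simp add: prod.delta)
qed

text \<open>Codeword and noise determine the received word, so its entropy is at most
  \<open>ln (card C)\<close> plus the entropy of the noise. Pointwise, \<open>pr Om Y\<close> is at
  least the contribution of any single codeword.\<close>

lemma kl_lower: "kl Om \<ge> card Om * (ln 2 + eps * ln eps + (1 - eps) * ln (1 - eps)) - ln (card C)"
proof -
  let ?N = "card Om" let ?K = "real (card C)"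
  have e: "sd c Y \<inter> Om = sd c Y" if "c \<in> C" "Y \<subseteq> Om" for c Y
    using that by (auto dest!: subsetD[OF C_sub])
  have ent: "E Om (\<lambda>Z. ln (wt Om Z)) = ?N * (eps * ln eps + (1 - eps) * ln (1 - eps))"
  proof -
    have "E Om (\<lambda>Z. ln (wt Om Z)) = E Om (\<lambda>Z. \<Sum>v\<in>Om. (\<lambda>b. if b then ln eps else ln (1 - eps)) (v \<in> Z))"
    proof (rule E_cong)
      fix Z assume Z: "Z \<subseteq> Om"
      have "(\<Sum>v\<in>Om. (\<lambda>b. if b then ln eps else ln (1 - eps)) (v \<in> Z)) = card Z * ln eps + card (Om - Z) * ln (1 - eps)"
        using Z by (simp add: sum.If_cases Int_absorb1 Diff_eq)
      moreover have "ln (wt Om Z) = card Z * ln eps + card (Om - Z) * ln (1 - eps)"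
        using eps_pos eps_half by (simp add: wt_def ln_mult ln_realpow)
      ultimately show "ln (wt Om Z) = (\<Sum>v\<in>Om. (\<lambda>b. if b then ln eps else ln (1 - eps)) (v \<in> Z))" by simp
    qed
    also have "\<dots> = (\<Sum>v\<in>Om. eps * ln eps + (1 - eps) * ln (1 - eps))"
      unfolding E_sum by (intro sum.cong refl, subst E_indicator_fun) auto
    finally show ?thesis by simp
  qed
  have total: "(\<Sum>Y\<in>Pow Om. pr Om Y) = 1"
  proof -
    have "(\<Sum>Y\<in>Pow Om. pr Om Y) = (\<Sum>c\<in>C. \<Sum>Y\<in>Pow Om. wt Om (sd c Y \<inter> Om)) / ?K"
      by (simp add: pr_def sum.swap[of _ C] flip: sum_divide_distrib)
    also have "\<dots> = (\<Sum>c\<in>C. E Om (\<lambda>_. 1)) / ?K"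
      by (simp add: E_def sum_Pow_sd_shift[of "wt Om"])
    finally show ?thesis using card_C_pos by simp
  qed
  have "E Om (\<lambda>Z. ln (wt Om Z)) - ln ?K = (\<Sum>c\<in>C. E Om (\<lambda>Z. ln (wt Om Z / ?K))) / ?K"
  proof -
    have "E Om (\<lambda>Z. ln (wt Om Z / ?K)) = E Om (\<lambda>Z. ln (wt Om Z) - ln ?K)"
      using card_C_pos by (intro E_cong) (simp add: ln_divide_pos wt_pos)
    then show ?thesis using card_C_pos by (simp add: E_diff)
  qed
  also have "\<dots> = (\<Sum>c\<in>C. \<Sum>Y\<in>Pow Om. wt Om (sd c Y \<inter> Om) * ln (wt Om (sd c Y \<inter> Om) / ?K)) / ?K"
    by (simp add: E_def sum_Pow_sd_shift[of "\<lambda>Z. wt Om Z * ln (wt Om Z / ?K)"])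
  also have "\<dots> \<le> (\<Sum>c\<in>C. \<Sum>Y\<in>Pow Om. wt Om (sd c Y \<inter> Om) * ln (pr Om Y)) / ?K"
  proof (intro divide_right_mono sum_mono mult_left_mono)
    fix c Y assume "c \<in> C" "Y \<in> Pow Om"
    then have "wt Om (sd c Y \<inter> Om) \<le> (\<Sum>c\<in>C. wt Om (sd c Y \<inter> Om))"
      by (intro member_le_sum) (auto simp: wt_nonneg)
    then have "wt Om (sd c Y \<inter> Om) / ?K \<le> pr Om Y" unfolding pr_def by (intro divide_right_mono) auto
    then show "ln (wt Om (sd c Y \<inter> Om) / ?K) \<le> ln (pr Om Y)"
      using wt_pos[of Om "sd c Y \<inter> Om"] card_C_pos by (subst ln_le_cancel_iff) (auto simp: pr_pos)
  qed (auto simp: wt_nonneg)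
  also have "\<dots> = (\<Sum>Y\<in>Pow Om. pr Om Y * ln (pr Om Y))"
    by (simp add: pr_def sum.swap[of _ C] sum_divide_distrib sum_distrib_right)
  also have "\<dots> = kl Om - ?N * ln 2"
  proof -
    have "kl Om = (\<Sum>Y\<in>Pow Om. pr Om Y * (?N * ln 2) + pr Om Y * ln (pr Om Y))"
      unfolding kl_def using pr_pos by (intro sum.cong) (auto simp: ln_mult ln_realpow algebra_simps)
    then show ?thesis using total by (simp add: sum.distrib flip: sum_distrib_right)
  qed
  finally show ?thesis by (simp add: ent algebra_simps)
qed

section \<open>Automorphisms of the code and the symmetry between codewords\<close>

lemma transport:
  assumes g: "inj_on g Om" "(image g) ` C = C" and A: "A \<subseteq> Om" "Y \<subseteq> A" "x \<in> Om"
  shows "pr (g ` A) (g ` Y) = pr A Y" "bias (g ` A) (g x) (g ` Y) = bias A x Y"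
proof -
  have inj: "inj_on (image g) C" using g(1) C_sub by (meson inj_on_image_Pow inj_on_subset)
  have w: "wt (g ` A) (sd (g ` c) (g ` Y) \<inter> g ` A) = wt A (sd c Y \<inter> A)" if "c \<in> C" for c
  proof -
    have c: "c \<subseteq> Om" using that C_sub by auto
    have sub: "c - Y \<subseteq> Om" "Y - c \<subseteq> Om" "Y \<subseteq> Om" "sd c Y \<subseteq> Om" using c A by (auto simp: sd_def)
    have "g ` (sd c Y \<inter> A) = g ` (sd c Y) \<inter> g ` A"
      by (rule inj_on_image_Int[OF g(1) sub(4) A(1)])
    also have "g ` (sd c Y) = sd (g ` c) (g ` Y)"
      unfolding sd_def image_Un inj_on_image_set_diff[OF g(1) sub(1) sub(3)] inj_on_image_set_diff[OF g(1) sub(2) c] ..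
    finally have "sd (g ` c) (g ` Y) \<inter> g ` A = g ` (sd c Y \<inter> A)" ..
    moreover have "inj_on g A" using A g(1) inj_on_subset by blast
    ultimately show ?thesis
      by (simp add: wt_def card_image inj_on_subset flip: inj_on_image_set_diff[of g A A])
  qed
  have s: "sg (g x) (g ` c) = sg x c" if "c \<in> C" for c
    using inj_on_image_mem_iff[OF g(1) A(3)] that C_sub by (auto simp: sg_def)
  have "(\<Sum>c\<in>C. f c) = (\<Sum>c\<in>C. f (g ` c))" for f :: "'a set \<Rightarrow> real"
    by (subst (1) g(2)[symmetric]) (simp add: sum.reindex[OF inj])
  note r = this
  show "pr (g ` A) (g ` Y) = pr A Y"
    unfolding pr_def by (subst r) (simp add: w)
  show "bias (g ` A) (g x) (g ` Y) = bias A x Y"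
    unfolding bias_def by (subst r) (simp add: w s)
qed

lemma transport_post:
  assumes "inj_on g Om" "(image g) ` C = C" "A \<subseteq> Om" "Y \<subseteq> A" "x \<in> Om"
  shows "post (g ` A) (g x) (g ` Y) = post A x Y"
  using transport[OF assms] by (simp add: post_def)

lemma transport_gain:
  assumes "inj_on g Om" "(image g) ` C = C" "A \<subseteq> Om" "x \<in> Om"
  shows "gain (g ` A) (g x) = gain A x"
proof -
  have "inj_on (image g) (Pow A)" using assms by (meson inj_on_image_Pow inj_on_subset)
  moreover have "Pow (g ` A) = (image g) ` Pow A" by (auto simp: subset_image_iff)
  ultimately show ?thesis unfolding gain_def using transport[OF assms(1,2,3) _ assms(4)]
    by (simp add: sum.reindex)
qed

lemma post_shift:
  assumes "c \<in> C" "Y \<subseteq> A"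
  shows "post A x (sd c Y \<inter> A) = sg x c * post A x Y"
proof -
  have e: "sd d (sd c Y \<inter> A) \<inter> A = sd (sd c d) Y \<inter> A" for d by auto
  have "pr A (sd c Y \<inter> A) = pr A Y"
  proof -
    have "(\<Sum>d\<in>C. wt A (sd (sd c d) Y \<inter> A)) = (\<Sum>d\<in>C. wt A (sd d Y \<inter> A))"
      by (rule sum_sd_shift[OF assms(1), where f = "\<lambda>d. wt A (sd d Y \<inter> A)"]) (rule C_sd)
    then show ?thesis unfolding pr_def e by simp
  qed
  moreover have "bias A x (sd c Y \<inter> A) = sg x c * bias A x Y"
  proof -
    have "(\<Sum>d\<in>C. sg x d * wt A (sd (sd c d) Y \<inter> A)) = (\<Sum>d\<in>C. sg x c * (sg x (sd c d) * wt A (sd (sd c d) Y \<inter> A)))"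
      by (simp add: sg_sd mult.assoc)
    also have "\<dots> = (\<Sum>d\<in>C. sg x c * (sg x d * wt A (sd d Y \<inter> A)))"
      by (rule sum_sd_shift[OF assms(1), where f = "\<lambda>d. sg x c * (sg x d * wt A (sd d Y \<inter> A))"]) (rule C_sd)
    finally show ?thesis by (simp add: bias_def e sum_distrib_left)
  qed
  ultimately show ?thesis by (simp add: post_def)
qed

text \<open>\<open>E\<close> averages over the noise alone, that is, for the zero codeword. Adding
  \<open>c\<close> multiplies the posterior mean by \<open>sg x c\<close>, so this is the mean over
  all codewords of sign times posterior mean, which is the second moment of the posterior
  mean.\<close>

lemma E_post: "E A (post A x) = gain A x"
proof -
  have "gain A x = (\<Sum>Y\<in>Pow A. bias A x Y * post A x Y)"
    by (simp add: gain_def post_def power2_eq_square)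
  also have "\<dots> = (\<Sum>c\<in>C. \<Sum>Y\<in>Pow A. sg x c * wt A (sd c Y \<inter> A) * post A x Y) / card C"
    by (simp add: bias_def sum_distrib_right sum.swap[of _ C] sum_divide_distrib)
  also have "\<dots> = (\<Sum>c\<in>C. \<Sum>Y\<in>Pow A. wt A (sd c Y \<inter> A) * post A x (sd c Y \<inter> A)) / card C"
    by (simp add: post_shift mult_ac)
  also have "\<dots> = (\<Sum>c\<in>C. E A (post A x)) / card C"
    by (simp add: E_def sum_Pow_sd_shift[of "\<lambda>Y. wt A Y * post A x Y"])
  finally show ?thesis using card_C_pos C_empty by auto
qed

text \<open>Transitivity makes the gain from all other coordinates the same at every coordinate; the
  chain rule for the divergence from uniform then bounds it from below.\<close>
lemma weak_decoding:
  assumes "x0 \<in> Om"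
    and trans: "\<And>x. x \<in> Om \<Longrightarrow> \<exists>g. inj_on g Om \<and> g ` Om = Om \<and> (image g) ` C = C \<and> g x0 = x"
  shows "card Om * (ln 2 + eps * ln eps + (1 - eps) * ln (1 - eps)) - ln (card C)
    \<le> card Om * E (Om - {x0}) (post (Om - {x0}) x0)"
proof -
  have "gain (Om - {x}) x \<le> gain (Om - {x0}) x0" if x: "x \<in> Om" for x
  proof -
    obtain g where g: "inj_on g Om" "g ` Om = Om" "(image g) ` C = C" "g x0 = x"
      using trans[OF x] by auto
    have "Om - {x} = g ` (Om - {x0})" using g assms(1) by (simp add: inj_on_image_set_diff[of g Om])
    then show ?thesis using transport_gain[OF g(1,3), of "Om - {x0}" x0] g(4) assms(1) by simp
  qed
  then have "kl Om \<le> card Om * gain (Om - {x0}) x0" by (rule kl_upper)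
  with kl_lower show ?thesis unfolding E_post by simp
qed

end


subsection \<open>Sunflower voting\<close>

context bsc begin

text \<open>The conditional mean of \<open>f\<close> given that the noise on \<open>K\<close> is
  \<open>Z\<close>. On the Fourier side it keeps exactly the coefficients of subsets of
  \<open>K\<close>.\<close>

definition kmean :: "'a set \<Rightarrow> 'a set \<Rightarrow> ('a set \<Rightarrow> real) \<Rightarrow> 'a set \<Rightarrow> real" where
  "kmean A K f Z = E (A - K) (\<lambda>Y. f (Z \<union> Y))"

lemma E_kmean:
  assumes "finite A" "K \<subseteq> A" shows "E K (\<lambda>Z. kmean A K f Z * h Z) = E A (\<lambda>Z. f Z * h (Z \<inter> K))"
proof -
  have "E A (\<lambda>Z. f Z * h (Z \<inter> K)) = E (K \<union> (A - K)) (\<lambda>Z. f Z * h (Z \<inter> K))"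
    using assms by (simp add: Un_absorb1)
  also have "\<dots> = E K (\<lambda>Z. E (A - K) (\<lambda>Y. f (Z \<union> Y) * h ((Z \<union> Y) \<inter> K)))"
    using assms finite_subset[of K A] by (intro E_split) auto
  also have "\<dots> = E K (\<lambda>Z. E (A - K) (\<lambda>Y. f (Z \<union> Y) * h Z))"
  proof (intro E_cong)
    fix Z Y assume "Z \<subseteq> K" "Y \<subseteq> A - K"
    then have "(Z \<union> Y) \<inter> K = Z" by auto
    then show "f (Z \<union> Y) * h ((Z \<union> Y) \<inter> K) = f (Z \<union> Y) * h Z" by simp
  qed
  finally show ?thesis by (simp add: kmean_def E_cmult_right)
qed

lemma coef_kmean:
  assumes "finite A" "K \<subseteq> A" "S \<subseteq> K" shows "coef K (kmean A K f) S = coef A f S"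
proof -
  have "chi S (Z \<inter> K) = chi S Z" for Z
    unfolding chi_def using assms by (intro prod.cong arg_cong[of _ _ phi]) auto
  then show ?thesis using E_kmean[OF assms(1,2), of f "chi S"] by (simp add: coef_def)
qed

lemma coef_empty: "coef A f {} = E A f"
  by (simp add: coef_def chi_def)

text \<open>A deviation by \<open>mu / 2\<close> forces the part of degree 1 to \<open>D\<close> or
  the part of higher degree to reach \<open>mu / 4\<close>. The latter has small enough variance, by
  \<open>con\<close> at \<open>D + 1\<close>. The former has variance at most
  \<open>2 ^ (-k)\<close>, by \<open>con\<close> at 1; this is too weak for Chebyshev, but low
  degree permits a moment of order \<open>2 ^ s\<close>.\<close>

lemma kernel_tail:
  fixes A K :: "'a set"
  assumes fin: "finite A" and K: "K \<subseteq> A" and mu: "E A f = mu" "mu > 0" and s: "1 \<le> s"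
    and con: "\<And>d. (\<Sum>S\<in>{S \<in> Pow K. d \<le> card S}. (coef A f S)\<^sup>2) \<le> 1 / (real d + 1) ^ k"
  shows "E K (\<lambda>Z. of_bool (kmean A K f Z < mu / 2)) \<le>
    (4 / mu) ^ (2 ^ s) * ((hyp_const ^ (D * s)) ^ (2 ^ s) * (1 / 2 ^ k) ^ (2 ^ (s - 1)))
     + 16 / mu\<^sup>2 / (real D + 2) ^ k"
proof -
  have finK: "finite K" using fin K finite_subset by auto
  define a where "a = (\<lambda>S. if 1 \<le> card S \<and> card S \<le> D then coef A f S else 0)"
  define b where "b = (\<lambda>S. if Suc D \<le> card S then coef A f S else 0)"
  define low where "low = (\<lambda>Z. \<Sum>S\<in>Pow K. a S * chi S Z)"
  define high where "high = (\<lambda>Z. \<Sum>S\<in>Pow K. b S * chi S Z)"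
  have split: "kmean A K f Z = mu + low Z + high Z" if Z: "Z \<subseteq> K" for Z
  proof -
    have "kmean A K f Z = (\<Sum>S\<in>Pow K. coef A f S * chi S Z)"
      unfolding chi_expansion[OF finK Z, of "kmean A K f"]
      by (intro sum.cong refl) (simp add: coef_kmean[OF fin K])
    also have "\<dots> = (\<Sum>S\<in>Pow K. (if S = {} then mu else 0) + (a S * chi S Z + b S * chi S Z))"
    proof (rule sum.cong[OF refl])
      fix S assume "S \<in> Pow K"
      then have "finite S" using finK finite_subset by auto
      then have "S = {} \<longleftrightarrow> card S = 0" by simp
      moreover have "coef A f {} * chi {} Z = mu" using mu by (simp add: coef_empty chi_def)
      ultimately show "coef A f S * chi S Z = (if S = {} then mu else 0) + (a S * chi S Z + b S * chi S Z)"
        by (cases "S = {}") (auto simp: a_def b_def)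
    qed
    also have "\<dots> = mu + low Z + high Z"
      using finK by (simp add: sum.distrib low_def high_def)
    finally show ?thesis .
  qed
  have sq: "E K (\<lambda>Z. (\<Sum>S\<in>Pow K. c S * chi S Z)\<^sup>2) = (\<Sum>S\<in>Pow K. (c S)\<^sup>2)" for c
    unfolding Plancherel[OF finK] by (intro sum.cong refl) (simp add: coef_of_sum[OF finK])
  have "E K (\<lambda>Z. (high Z)\<^sup>2) = (\<Sum>S\<in>{S \<in> Pow K. Suc D \<le> card S}. (coef A f S)\<^sup>2)"
    unfolding high_def sq using finK by (intro sum.mono_neutral_cong_right) (auto simp: b_def)
  also have "\<dots> \<le> 1 / (real D + 2) ^ k" using con[of "Suc D"] by (simp add: add.commute)
  finally have high: "E K (\<lambda>Z. (high Z)\<^sup>2) \<le> 1 / (real D + 2) ^ k" .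
  have "E K (\<lambda>Z. (low Z)\<^sup>2) = (\<Sum>S\<in>Pow K. (a S)\<^sup>2)" unfolding low_def by (rule sq)
  also have "\<dots> \<le> (\<Sum>S\<in>{S \<in> Pow K. 1 \<le> card S}. (coef A f S)\<^sup>2)"
    unfolding a_def using finK by (subst sum.inter_filter) (auto intro!: sum_mono)
  also have "\<dots> \<le> 1 / 2 ^ k" using con[of 1] by simp
  finally have low: "E K (\<lambda>Z. (low Z)\<^sup>2) \<le> 1 / 2 ^ k" .
  have ld: "low_degree K D low"
    unfolding low_degree_def low_def by (auto simp: coef_of_sum[OF finK] a_def)
  have "E K (\<lambda>Z. low Z ^ 2 ^ s) \<le> (hyp_const ^ (D * s)) ^ (2 ^ s) * (E K (\<lambda>Z. (low Z)\<^sup>2)) ^ (2 ^ (s - 1))"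
    by (rule low_degree_moment[OF finK ld s])
  also have "\<dots> \<le> (hyp_const ^ (D * s)) ^ (2 ^ s) * (1 / 2 ^ k) ^ (2 ^ (s - 1))"
    using hyp_const_ge low by (intro mult_left_mono power_mono) (auto intro!: E_nonneg)
  finally have lowm: "E K (\<lambda>Z. low Z ^ 2 ^ s) \<le> (hyp_const ^ (D * s)) ^ (2 ^ s) * (1 / 2 ^ k) ^ (2 ^ (s - 1))" .
  have ev: "even ((2::nat) ^ s)" using s by simp
  have "E K (\<lambda>Z. of_bool (kmean A K f Z < mu / 2)) \<le>
    E K (\<lambda>Z. of_bool ((mu / 4) ^ 2 ^ s \<le> low Z ^ 2 ^ s) + of_bool ((mu / 4)\<^sup>2 \<le> (high Z)\<^sup>2))"
  proof (rule E_mono)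
    fix Z assume Z: "Z \<subseteq> K"
    show "(of_bool (kmean A K f Z < mu / 2) :: real) \<le>
      of_bool ((mu / 4) ^ 2 ^ s \<le> low Z ^ 2 ^ s) + of_bool ((mu / 4)\<^sup>2 \<le> (high Z)\<^sup>2)"
    proof (cases "kmean A K f Z < mu / 2")
      case True
      then consider "mu / 4 \<le> \<bar>low Z\<bar>" | "mu / 4 \<le> \<bar>high Z\<bar>" using split[OF Z] by linarith
      then show ?thesis
      proof cases
        case 1
        then have "(mu / 4) ^ 2 ^ s \<le> \<bar>low Z\<bar> ^ 2 ^ s" using mu by (intro power_mono) auto
        then show ?thesis using ev by (simp add: power_even_abs)
      next
        case 2
        then have "(mu / 4)\<^sup>2 \<le> \<bar>high Z\<bar>\<^sup>2" using mu by (intro power_mono) auto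
        then show ?thesis by simp
      qed
    qed simp
  qed
  also have "\<dots> \<le> E K (\<lambda>Z. low Z ^ 2 ^ s) / (mu / 4) ^ 2 ^ s + E K (\<lambda>Z. (high Z)\<^sup>2) / (mu / 4)\<^sup>2"
    unfolding E_add using mu ev by (intro add_mono E_Markov) (auto simp: zero_le_even_power)
  also have "\<dots> \<le> (hyp_const ^ (D * s)) ^ (2 ^ s) * (1 / 2 ^ k) ^ (2 ^ (s - 1)) / (mu / 4) ^ 2 ^ s
      + 1 / (real D + 2) ^ k / (mu / 4)\<^sup>2"
    using mu lowm high by (intro add_mono divide_right_mono) auto
  also have "\<dots> = (4 / mu) ^ (2 ^ s) * ((hyp_const ^ (D * s)) ^ (2 ^ s) * (1 / 2 ^ k) ^ (2 ^ (s - 1)))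
     + 16 / mu\<^sup>2 / (real D + 2) ^ k"
    by (simp add: power_divide mult.commute)
  finally show ?thesis .
qed

lemma exp_le_quadratic: "\<bar>x :: real\<bar> \<le> 1 \<Longrightarrow> exp x \<le> 1 + x + x\<^sup>2"
proof (cases "0 \<le> x")
  case True then show "\<bar>x\<bar> \<le> 1 \<Longrightarrow> ?thesis" using exp_bound[of x] by auto
next
  case False
  define y where "y = - x"
  have y: "y > 0" using False by (simp add: y_def)
  have "exp x = 1 / exp y" by (simp add: y_def exp_minus field_simps)
  also have "\<dots> \<le> 1 / (1 + y)" using y by (intro divide_left_mono) auto
  also have "\<dots> \<le> 1 - y + y\<^sup>2"
  proof -
    have "1 \<le> 1 + y ^ 3" using y by simp
    also have "\<dots> = (1 - y + y\<^sup>2) * (1 + y)" by (simp add: power2_eq_square power3_eq_cube algebra_simps)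
    finally show ?thesis using y by (simp add: divide_le_eq)
  qed
  finally show ?thesis by (simp add: y_def)
qed

text \<open>At the tilt \<open>mu / 4\<close> a mean of at least \<open>mu / 2\<close> gives a
  linear gain \<open>mu^2 / 8\<close>, twice the quadratic loss \<open>mu^2 / 16\<close>.\<close>

lemma petal_moment:
  assumes fin: "finite B" and f: "\<And>Y. Y \<subseteq> B \<Longrightarrow> \<bar>f Y\<bar> \<le> 1" and mu: "0 < mu" "mu \<le> 1" "mu / 2 \<le> E B f"
  shows "E B (\<lambda>Y. exp (- (mu / 4) * f Y)) \<le> exp (- mu\<^sup>2 / 16)"
proof -
  have "E B (\<lambda>Y. exp (- (mu / 4) * f Y)) \<le> E B (\<lambda>Y. 1 - (mu / 4) * f Y + (mu / 4)\<^sup>2)"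
  proof (rule E_mono)
    fix Y assume Y: "Y \<subseteq> B"
    have "\<bar>- (mu / 4) * f Y\<bar> \<le> 1 * 1"
      unfolding abs_mult using f[OF Y] mu by (intro mult_mono) auto
    then have "exp (- (mu / 4) * f Y) \<le> 1 + (- (mu / 4) * f Y) + (- (mu / 4) * f Y)\<^sup>2"
      by (intro exp_le_quadratic) simp
    also have "(- (mu / 4) * f Y)\<^sup>2 = (mu / 4)\<^sup>2 * (f Y)\<^sup>2"
      unfolding power_mult_distrib by simp
    also have "\<dots> \<le> (mu / 4)\<^sup>2 * 1"
      using f[OF Y] by (intro mult_left_mono) (auto simp: abs_square_le_1)
    finally show "exp (- (mu / 4) * f Y) \<le> 1 - (mu / 4) * f Y + (mu / 4)\<^sup>2" by simp
  qed
  also have "\<dots> = 1 - (mu / 4) * E B f + (mu / 4)\<^sup>2"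
    using fin by (simp add: E_add E_diff E_cmult del: times_divide_eq_left)
  also have "\<dots> \<le> 1 - (mu / 4) * (mu / 2) + (mu / 4)\<^sup>2"
    using mu by (intro add_right_mono diff_left_mono mult_left_mono) auto
  also have "\<dots> = 1 + (- mu\<^sup>2 / 16)" by (simp add: power2_eq_square)
  also have "\<dots> \<le> exp (- mu\<^sup>2 / 16)" by (rule exp_ge_add_one_self)
  finally show ?thesis .
qed

text \<open>The petals \<open>i ` A\<close> share the kernel \<open>i ` K\<close>, and given the noise on it their votes are independent.\<close>
lemma sunflower_vote:
  fixes A K :: "'a set" and B :: "'b set" and i :: "'c \<Rightarrow> 'a \<Rightarrow> 'b"
  assumes fin: "finite A" "finite B" "finite I" and K: "K \<subseteq> A"
    and inj: "\<And>t. t \<in> I \<Longrightarrow> inj_on (i t) A" and into: "\<And>t. t \<in> I \<Longrightarrow> i t ` A \<subseteq> B"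
    and ker: "\<And>t v. t \<in> I \<Longrightarrow> v \<in> K \<Longrightarrow> i t v = j v"
    and disj: "\<And>t u v v'. t \<in> I \<Longrightarrow> u \<in> I \<Longrightarrow> t \<noteq> u \<Longrightarrow> v \<in> A - K \<Longrightarrow> v' \<in> A - K \<Longrightarrow> i t v \<noteq> i u v'"
    and f: "\<And>Y. Y \<subseteq> A \<Longrightarrow> \<bar>f Y\<bar> \<le> 1" and mu: "0 < mu" "mu \<le> 1" and ne: "I \<noteq> {}"
  shows "E B (\<lambda>Z. of_bool ((\<Sum>t\<in>I. f {v \<in> A. i t v \<in> Z}) \<le> 0)) \<le>
    E K (\<lambda>Z. of_bool (kmean A K f Z < mu / 2)) + exp (- mu\<^sup>2 / 16) ^ card I"
proof -
  define P where "P = (\<lambda>t. i t ` (A - K))"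
  define U where "U = (\<Union>t\<in>I. P t)"
  obtain t0 where t0: "t0 \<in> I" using ne by auto
  have jK: "j ` K \<subseteq> B" using into[OF t0] ker[OF t0] K by force
  have jinj: "inj_on j K"
  proof -
    have "inj_on (i t0) K" by (rule inj_on_subset[OF inj[OF t0] K])
    then show ?thesis using ker[OF t0] by (simp add: inj_on_def)
  qed
  have finK: "finite K" using K fin finite_subset by auto
  have finU: "finite U" using fin by (simp add: U_def P_def)
  have PB: "P t \<subseteq> B" if "t \<in> I" for t using into[OF that] by (auto simp: P_def)
  have UB: "U \<subseteq> B" using PB by (auto simp: U_def)
  have jP: "j ` K \<inter> P t = {}" if "t \<in> I" for t
  proof -
    have "i t v \<noteq> i t u" if "v \<in> K" "u \<in> A - K" for u v
      using inj[OF \<open>t \<in> I\<close>] that K by (auto simp: inj_on_def)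
    then show ?thesis using ker[OF that] by (force simp: P_def)
  qed
  then have jU: "j ` K \<inter> U = {}" by (auto simp: U_def)
  \<comment> \<open>The noise seen by petal \<open>t\<close> splits into the common pattern
    \<open>Y\<close> and the noise on its private set \<open>P t\<close>.\<close>
  have part: "{v \<in> A. i t v \<in> j ` Y \<union> Q} = Y \<union> {v \<in> A - K. i t v \<in> Q \<inter> P t}"
    if t: "t \<in> I" and Y: "Y \<subseteq> K" and Q: "Q \<subseteq> U" for t Y Q
  proof (rule set_eqI)
    fix v
    show "v \<in> {v \<in> A. i t v \<in> j ` Y \<union> Q} \<longleftrightarrow> v \<in> Y \<union> {v \<in> A - K. i t v \<in> Q \<inter> P t}"
    proof (cases "v \<in> K")
      case True
      then have "i t v = j v" using ker t by auto
      moreover have "j v \<notin> Q" using jU Q True by auto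
      moreover have "j v \<in> j ` Y \<longleftrightarrow> v \<in> Y" using jinj True Y by (auto simp: inj_on_def)
      ultimately show ?thesis using True K by auto
    next
      case False
      then have "v \<in> A \<Longrightarrow> i t v \<in> P t" by (auto simp: P_def)
      moreover from this have "v \<in> A \<Longrightarrow> i t v \<notin> j ` Y" using jP[OF t] Y by auto
      ultimately show ?thesis using False Y by auto
    qed
  qed
  have "E B (\<lambda>Z. of_bool ((\<Sum>t\<in>I. f {v \<in> A. i t v \<in> Z}) \<le> 0)) =
    E B (\<lambda>Z. (\<lambda>Z. of_bool ((\<Sum>t\<in>I. f {v \<in> A. i t v \<in> Z}) \<le> 0)) (Z \<inter> (j ` K \<union> U)))"
  proof (rule E_cong)
    fix Z assume "Z \<subseteq> B"
    have "{v \<in> A. i t v \<in> Z \<inter> (j ` K \<union> U)} = {v \<in> A. i t v \<in> Z}" if "t \<in> I" for t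
    proof -
      have "i t v \<in> j ` K \<union> U" if "v \<in> A" for v
        using that \<open>t \<in> I\<close> ker by (cases "v \<in> K") (auto simp: U_def P_def)
      then show ?thesis by auto
    qed
    then show "of_bool ((\<Sum>t\<in>I. f {v \<in> A. i t v \<in> Z}) \<le> 0) =
      (\<lambda>Z. of_bool ((\<Sum>t\<in>I. f {v \<in> A. i t v \<in> Z}) \<le> 0)) (Z \<inter> (j ` K \<union> U))"
      by (simp cong: sum.cong)
  qed
  also have "\<dots> = E (j ` K \<union> U) (\<lambda>Z. of_bool ((\<Sum>t\<in>I. f {v \<in> A. i t v \<in> Z}) \<le> 0))"
    using fin jK UB by (intro E_local) auto
  also have "\<dots> = E (j ` K) (\<lambda>Y. E U (\<lambda>Q. of_bool ((\<Sum>t\<in>I. f {v \<in> A. i t v \<in> Y \<union> Q}) \<le> 0)))"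
    using finK finU jU by (intro E_split) auto
  also have "\<dots> = E K (\<lambda>Y. E U (\<lambda>Q. of_bool ((\<Sum>t\<in>I. f {v \<in> A. i t v \<in> j ` Y \<union> Q}) \<le> 0)))"
    by (rule E_image[OF jinj])
  also have "\<dots> \<le> E K (\<lambda>Y. of_bool (kmean A K f Y < mu / 2) + exp (- mu\<^sup>2 / 16) ^ card I)"
  proof (rule E_mono)
    fix Y assume Y: "Y \<subseteq> K"
    show "E U (\<lambda>Q. of_bool ((\<Sum>t\<in>I. f {v \<in> A. i t v \<in> j ` Y \<union> Q}) \<le> 0)) \<le>
      of_bool (kmean A K f Y < mu / 2) + exp (- mu\<^sup>2 / 16) ^ card I"
    proof (cases "kmean A K f Y < mu / 2")
      \<comment> \<open>Kernel patterns with a low conditional mean are given up; the first term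
        counts them.\<close>
      case True
      have "E U (\<lambda>Q. of_bool ((\<Sum>t\<in>I. f {v \<in> A. i t v \<in> j ` Y \<union> Q}) \<le> 0)) \<le> E U (\<lambda>_. 1)"
        by (intro E_mono) simp
      then show ?thesis using True finU by (simp add: add_increasing2)
    next
      case False
      \<comment> \<open>For all other patterns the exponential bounds the failure indicator by a
        product of functions of disjoint sets of noise bits.\<close>
      let ?h = "\<lambda>t Q. exp (- (mu / 4) * f (Y \<union> {v \<in> A - K. i t v \<in> Q}))"
      have "E U (\<lambda>Q. of_bool ((\<Sum>t\<in>I. f {v \<in> A. i t v \<in> j ` Y \<union> Q}) \<le> 0)) \<le>
        E U (\<lambda>Q. \<Prod>t\<in>I. ?h t (Q \<inter> P t))"
      proof (rule E_mono)
        fix Q assume Q: "Q \<subseteq> U"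
        have "(\<Prod>t\<in>I. ?h t (Q \<inter> P t)) = exp (\<Sum>t\<in>I. - (mu / 4) * f {v \<in> A. i t v \<in> j ` Y \<union> Q})"
          using part[OF _ Y Q] by (simp add: exp_sum[OF fin(3)])
        also have "\<dots> = exp (- (mu / 4) * (\<Sum>t\<in>I. f {v \<in> A. i t v \<in> j ` Y \<union> Q}))"
          by (simp add: sum_distrib_left)
        finally have eq: "(\<Prod>t\<in>I. ?h t (Q \<inter> P t)) = exp (- (mu / 4) * (\<Sum>t\<in>I. f {v \<in> A. i t v \<in> j ` Y \<union> Q}))" .
        show "of_bool ((\<Sum>t\<in>I. f {v \<in> A. i t v \<in> j ` Y \<union> Q}) \<le> 0) \<le> (\<Prod>t\<in>I. ?h t (Q \<inter> P t))"
          unfolding eq using mu by (cases "(\<Sum>t\<in>I. f {v \<in> A. i t v \<in> j ` Y \<union> Q}) \<le> 0")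
            (auto simp: mult_nonneg_nonpos)
      qed
      also have "\<dots> = (\<Prod>t\<in>I. E (P t) (?h t))"
      proof (rule E_indep[OF fin(3) finU])
        fix t u assume "t \<in> I" "u \<in> I" "t \<noteq> u"
        then show "P t \<inter> P u = {}" using disj[of t u] unfolding P_def by blast
      qed (auto simp: U_def)
      also have "\<dots> \<le> (\<Prod>t\<in>I. exp (- mu\<^sup>2 / 16))"
      proof (rule prod_mono, intro conjI)
        fix t assume t: "t \<in> I"
        show "0 \<le> E (P t) (?h t)" by (rule E_nonneg) simp
        have inj': "inj_on (i t) (A - K)" by (rule inj_on_subset[OF inj[OF t]]) auto
        have "E (P t) (?h t) = E (A - K) (\<lambda>Q. ?h t (i t ` Q))"
          unfolding P_def by (rule E_image[OF inj'])
        also have "\<dots> = E (A - K) (\<lambda>Q. exp (- (mu / 4) * f (Y \<union> Q)))"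
        proof (rule E_cong)
          fix Q assume "Q \<subseteq> A - K"
          then have "{v \<in> A - K. i t v \<in> i t ` Q} = Q" using inj' by (auto simp: inj_on_def)
          then show "?h t (i t ` Q) = exp (- (mu / 4) * f (Y \<union> Q))" by simp
        qed
        also have "\<dots> \<le> exp (- mu\<^sup>2 / 16)"
        proof (rule petal_moment)
          fix Q assume "Q \<subseteq> A - K"
          then show "\<bar>f (Y \<union> Q)\<bar> \<le> 1" using Y K by (intro f) auto
        qed (use fin mu False in \<open>auto simp: kmean_def\<close>)
        finally show "E (P t) (?h t) \<le> exp (- mu\<^sup>2 / 16)" .
      qed
      finally show ?thesis using False by simp
    qed
  qed
  also have "\<dots> = E K (\<lambda>Z. of_bool (kmean A K f Z < mu / 2)) + exp (- mu\<^sup>2 / 16) ^ card I"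
    using finK by (simp add: E_add)
  finally show ?thesis .
qed

lemma coef_image:
  assumes "inj_on g A" "g ` A = A" "\<And>Z. Z \<subseteq> A \<Longrightarrow> f (g ` Z) = f Z" "S \<subseteq> A"
  shows "coef A f (g ` S) = coef A f S"
proof -
  have "chi (g ` S) (g ` Z) = chi S Z" if "Z \<subseteq> A" for Z
  proof -
    have "inj_on g S" by (rule inj_on_subset[OF assms(1,4)])
    then have "chi (g ` S) (g ` Z) = (\<Prod>v\<in>S. phi (g v \<in> g ` Z))" by (simp add: chi_def prod.reindex)
    also have "\<dots> = chi S Z" unfolding chi_def
    proof (intro prod.cong refl arg_cong[of _ _ phi])
      fix v assume "v \<in> S"
      then show "(g v \<in> g ` Z) = (v \<in> Z)"
        using inj_on_image_mem_iff[OF assms(1), of v Z] assms(4) that by blast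
    qed
    finally show ?thesis .
  qed
  then have "E A (\<lambda>Z. f (g ` Z) * chi (g ` S) (g ` Z)) = E A (\<lambda>Z. f Z * chi S Z)"
    using assms(3) by (intro E_cong) auto
  moreover have "E A (\<lambda>Z. f Z * chi (g ` S) Z) = E A (\<lambda>Z. f (g ` Z) * chi (g ` S) (g ` Z))"
    using E_image[OF assms(1), of "\<lambda>Z. f Z * chi (g ` S) Z"] assms(2) by simp
  ultimately show ?thesis by (simp add: coef_def)
qed

text \<open>Averaging over a family of symmetries \<open>g\<close>: few of them can move a large set into the kernel.\<close>
lemma symmetric_contraction:
  assumes fin: "finite A" "finite G" "G \<noteq> {}" and K: "K \<subseteq> A"
    and inv: "\<And>l v. l \<in> G \<Longrightarrow> v \<in> A \<Longrightarrow> g l v \<in> A \<and> g l (g l v) = v"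
    and sym: "\<And>l Z. l \<in> G \<Longrightarrow> Z \<subseteq> A \<Longrightarrow> f (g l ` Z) = f Z"
    and f: "\<And>Y. Y \<subseteq> A \<Longrightarrow> \<bar>f Y\<bar> \<le> 1"
    and count: "\<And>T. T \<subseteq> A \<Longrightarrow> card {l \<in> G. g l ` T \<subseteq> K} * (card T + 1) ^ k \<le> card G"
  shows "(\<Sum>S\<in>{S \<in> Pow K. d \<le> card S}. (coef A f S)\<^sup>2) \<le> 1 / (real d + 1) ^ k"
proof -
  let ?c = "\<lambda>S. (coef A f S)\<^sup>2"
  have inj: "inj_on (g l) A" "g l ` A = A" if "l \<in> G" for l
  proof -
    show "inj_on (g l) A" using inv[OF that] by (metis inj_onI)
    show "g l ` A = A" using inv[OF that] by (auto simp: image_iff) metis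
  qed
  have gg: "g l ` g l ` S = S" if "l \<in> G" "S \<subseteq> A" for l S
    using inv[OF that(1)] that(2) by (force simp: image_iff)
  \<comment> \<open>Each \<open>g l\<close> preserves the coefficients, so for every single
    \<open>l\<close> the weight inside the kernel equals the weight of the sets that
    \<open>g l\<close> carries into it.\<close>
  have 1: "(\<Sum>S\<in>{S \<in> Pow K. d \<le> card S}. ?c S) = (\<Sum>T\<in>{T \<in> Pow A. d \<le> card T}. ?c T * of_bool (g l ` T \<subseteq> K))"
    if l: "l \<in> G" for l
  proof -
    have "(\<Sum>S\<in>{S \<in> Pow K. d \<le> card S}. ?c S) = (\<Sum>T\<in>{T \<in> Pow A. d \<le> card T \<and> g l ` T \<subseteq> K}. ?c T)"
    proof (rule sum.reindex_bij_witness[of _ "image (g l)" "image (g l)"])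
      fix S assume S: "S \<in> {S \<in> Pow K. d \<le> card S}"
      then have SA: "S \<subseteq> A" using K by auto
      show "g l ` g l ` S = S" using gg l SA by simp
      have "g l ` S \<subseteq> A" using inv[OF l] SA by auto
      moreover have "card (g l ` S) = card S" using inj(1)[OF l] SA by (meson card_image inj_on_subset)
      ultimately show "g l ` S \<in> {T \<in> Pow A. d \<le> card T \<and> g l ` T \<subseteq> K}" using S gg[OF l SA] by auto
      show "?c (g l ` S) = ?c S" using coef_image[of "g l" A f S, OF inj[OF l] sym[OF l] SA] by simp
    next
      fix T assume T: "T \<in> {T \<in> Pow A. d \<le> card T \<and> g l ` T \<subseteq> K}"
      then have TA: "T \<subseteq> A" by auto
      show "g l ` g l ` T = T" using gg l TA by simp
      have "card (g l ` T) = card T" using inj(1)[OF l] TA by (meson card_image inj_on_subset)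
      then show "g l ` T \<in> {S \<in> Pow K. d \<le> card S}" using T by auto
    qed
    also have "\<dots> = (\<Sum>T\<in>{T \<in> Pow A. d \<le> card T}. ?c T * of_bool (g l ` T \<subseteq> K))"
      using fin by (intro sum.mono_neutral_cong_left) auto
    finally show ?thesis .
  qed
  \<comment> \<open>Averaging over \<open>l\<close> replaces membership in the kernel by the
    proportion of symmetries moving \<open>T\<close> there; the total weight is at most 1 by
    Plancherel.\<close>
  have "card G * (\<Sum>S\<in>{S \<in> Pow K. d \<le> card S}. ?c S) = (\<Sum>l\<in>G. \<Sum>T\<in>{T \<in> Pow A. d \<le> card T}. ?c T * of_bool (g l ` T \<subseteq> K))"
    using 1 by (simp flip: sum_constant)
  also have "\<dots> = (\<Sum>T\<in>{T \<in> Pow A. d \<le> card T}. ?c T * card {l \<in> G. g l ` T \<subseteq> K})"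
    using fin by (subst sum.swap) (simp add: sum_distrib_left[symmetric] sum_of_bool_eq Int_def)
  also have "\<dots> \<le> (\<Sum>T\<in>{T \<in> Pow A. d \<le> card T}. ?c T * (card G / (real d + 1) ^ k))"
  proof (intro sum_mono mult_left_mono)
    fix T assume T: "T \<in> {T \<in> Pow A. d \<le> card T}"
    have "real (card {l \<in> G. g l ` T \<subseteq> K}) * (real d + 1) ^ k \<le> card {l \<in> G. g l ` T \<subseteq> K} * (real (card T) + 1) ^ k"
      using T by (intro mult_left_mono power_mono) auto
    also have "\<dots> = real (card {l \<in> G. g l ` T \<subseteq> K} * (card T + 1) ^ k)" by (simp add: add.commute)
    also have "\<dots> \<le> card G" using count[of T] T by (simp only: of_nat_le_iff) auto
    finally show "real (card {l \<in> G. g l ` T \<subseteq> K}) \<le> card G / (real d + 1) ^ k"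
      by (simp add: pos_le_divide_eq)
  qed auto
  also have "\<dots> \<le> (\<Sum>T\<in>Pow A. ?c T * (card G / (real d + 1) ^ k))"
    using fin by (intro sum_mono2) auto
  also have "\<dots> = E A (\<lambda>Z. (f Z)\<^sup>2) * (card G / (real d + 1) ^ k)"
    by (simp only: Plancherel[OF fin(1)] sum_distrib_right)
  also have "\<dots> \<le> E A (\<lambda>_. 1) * (card G / (real d + 1) ^ k)"
    using f by (intro mult_right_mono E_mono) (auto simp: abs_square_le_1)
  finally have "card G * (\<Sum>S\<in>{S \<in> Pow K. d \<le> card S}. ?c S) \<le> card G * (1 / (real d + 1) ^ k)"
    using fin by simp
  moreover have "real (card G) > 0" using fin by (simp add: card_gt_0_iff)
  ultimately show ?thesis by (simp only: mult_le_cancel_left_pos)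
qed

end


subsection \<open>Shears and petals in the Boolean cube\<close>

text \<open>Inner product over \<open>F_2\<close> of the first \<open>w\<close> bits only, so that a
  row of length \<open>w\<close> can act on a longer point.\<close>

primrec ip :: "nat \<Rightarrow> point \<Rightarrow> point \<Rightarrow> bool" where
  "ip 0 a x = False"
| "ip (Suc w) a x = (ip w a x \<noteq> (a ! w \<and> x ! w))"

lemma ip_cong: "(\<And>j. j < w \<Longrightarrow> a ! j = a' ! j) \<Longrightarrow> (\<And>j. j < w \<Longrightarrow> x ! j = x' ! j) \<Longrightarrow> ip w a x = ip w a' x'"
  by (induction w) auto

definition zero :: "nat \<Rightarrow> point" where "zero n = replicate n False"

lemma zero_nth [simp]: "j < n \<Longrightarrow> zero n ! j = False"
  by (simp add: zero_def)

lemma zero_points [simp]: "zero n \<in> points n"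
  by (simp add: zero_def points_def)

lemma points_eqI: "x \<in> points n \<Longrightarrow> y \<in> points n \<Longrightarrow> (\<And>j. j < n \<Longrightarrow> x ! j = y ! j) \<Longrightarrow> x = y"
  by (auto simp: points_def intro: nth_equalityI)

lemma ip_zero: "w \<le> n \<Longrightarrow> ip w a (zero n) = False"
  by (induction w) auto

definition sgnb :: "bool \<Rightarrow> real" where "sgnb b = (if b then -1 else 1)"

lemma sgnb_xor: "sgnb (a \<noteq> b) = sgnb a * sgnb b" "(sgnb a)\<^sup>2 = 1"
  by (auto simp: sgnb_def)

lemma sum_points_Suc: "(\<Sum>x\<in>points (Suc w). F x) = (\<Sum>x\<in>points w. F (x @ [False]) + F (x @ [True]) :: real)"
proof -
  have "(\<Sum>x\<in>points (Suc w). F x) = (\<Sum>x\<in>(\<lambda>t. t @ [False]) ` points w. F x) + (\<Sum>x\<in>(\<lambda>t. t @ [True]) ` points w. F x)"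
    unfolding points_Suc_snoc by (rule sum.union_disjoint) auto
  then show ?thesis by (simp add: sum.reindex inj_on_def sum.distrib)
qed

lemma ip_orth:
  "a \<in> points w \<Longrightarrow> b \<in> points w \<Longrightarrow> (\<Sum>x\<in>points w. sgnb (ip w a x) * sgnb (ip w b x)) = (if a = b then 2 ^ w else 0)"
proof (induction w arbitrary: a b)
  case 0
  then show ?case by (simp add: points_def sgnb_def)
next
  case (Suc w)
  obtain a' c where a: "a = a' @ [c]" "a' \<in> points w" using Suc.prems(1) points_Suc_snoc[of w] by blast
  obtain b' d where b: "b = b' @ [d]" "b' \<in> points w" using Suc.prems(2) points_Suc_snoc[of w] by blast
  have ipx: "ip (Suc w) (e' @ [e]) (x @ [y]) = (ip w e' x \<noteq> (e \<and> y))" if "e' \<in> points w" "x \<in> points w" for e' e x y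
  proof -
    have "ip w (e' @ [e]) (x @ [y]) = ip w e' x"
      using that by (intro ip_cong) (auto simp: points_def nth_append)
    then show ?thesis using that by (simp add: points_def nth_append)
  qed
  have "(\<Sum>x\<in>points (Suc w). sgnb (ip (Suc w) a x) * sgnb (ip (Suc w) b x)) =
    (\<Sum>x\<in>points w. (sgnb (ip w a' x) * sgnb (ip w b' x)) * (1 + sgnb c * sgnb d))"
    unfolding sum_points_Suc a(1) b(1)
  proof (rule sum.cong[OF refl])
    fix x assume x: "x \<in> points w"
    show "sgnb (ip (Suc w) (a' @ [c]) (x @ [False])) * sgnb (ip (Suc w) (b' @ [d]) (x @ [False])) +
      sgnb (ip (Suc w) (a' @ [c]) (x @ [True])) * sgnb (ip (Suc w) (b' @ [d]) (x @ [True])) =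
      (sgnb (ip w a' x) * sgnb (ip w b' x)) * (1 + sgnb c * sgnb d)"
      unfolding ipx[OF a(2) x] ipx[OF b(2) x] sgnb_xor by (simp add: sgnb_def)
  qed
  also have "\<dots> = (if a' = b' then 2 ^ w else 0) * (1 + sgnb c * sgnb d)"
    by (simp only: Suc.IH[OF a(2) b(2)] flip: sum_distrib_right)
  also have "\<dots> = (if a = b then 2 ^ Suc w else 0)"
    unfolding a(1) b(1) by (auto simp: sgnb_def)
  finally show ?case .
qed

text \<open>Vectors with prescribed products on all of \<open>T\<close> lie in a coset of the
  annihilator of \<open>T\<close>. Parseval replaces the dimension count: the characters indexed by
  \<open>R\<close> agree on \<open>T\<close>, so each point of \<open>T\<close> takes
  \<open>(card R)^2\<close> out of a total of \<open>card R * 2 ^ w\<close>.\<close>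

lemma ip_solutions:
  assumes "T \<subseteq> points w" "R \<subseteq> points w" "\<And>a x. a \<in> R \<Longrightarrow> x \<in> T \<Longrightarrow> ip w a x = h x"
  shows "card R * card T \<le> 2 ^ w"
proof (cases "R = {}")
  case False
  have fin: "finite R" "finite T" using assms(1,2) by (auto intro: finite_subset)
  have "(\<Sum>x\<in>T. (\<Sum>a\<in>R. sgnb (ip w a x))\<^sup>2) = (\<Sum>x\<in>T. (real (card R))\<^sup>2)"
  proof (rule sum.cong[OF refl])
    fix x assume "x \<in> T"
    then have "(\<Sum>a\<in>R. sgnb (ip w a x)) = card R * sgnb (h x)" using assms(3) by simp
    then show "(\<Sum>a\<in>R. sgnb (ip w a x))\<^sup>2 = (real (card R))\<^sup>2" by (simp add: power_mult_distrib sgnb_xor)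
  qed
  moreover have "(\<Sum>x\<in>T. (\<Sum>a\<in>R. sgnb (ip w a x))\<^sup>2) \<le> (\<Sum>x\<in>points w. (\<Sum>a\<in>R. sgnb (ip w a x))\<^sup>2)"
    using assms(1) by (intro sum_mono2) auto
  moreover have "(\<Sum>x\<in>points w. (\<Sum>a\<in>R. sgnb (ip w a x))\<^sup>2) = (\<Sum>a\<in>R. \<Sum>b\<in>R. \<Sum>x\<in>points w. sgnb (ip w a x) * sgnb (ip w b x))"
  proof -
    have "(\<Sum>x\<in>points w. (\<Sum>a\<in>R. sgnb (ip w a x))\<^sup>2) = (\<Sum>x\<in>points w. \<Sum>a\<in>R. \<Sum>b\<in>R. sgnb (ip w a x) * sgnb (ip w b x))"
      by (simp add: power2_eq_square sum_product)
    also have "\<dots> = (\<Sum>a\<in>R. \<Sum>x\<in>points w. \<Sum>b\<in>R. sgnb (ip w a x) * sgnb (ip w b x))"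
      by (rule sum.swap)
    also have "\<dots> = (\<Sum>a\<in>R. \<Sum>b\<in>R. \<Sum>x\<in>points w. sgnb (ip w a x) * sgnb (ip w b x))"
      by (intro sum.cong refl sum.swap)
    finally show ?thesis .
  qed
  moreover have "\<dots> = (\<Sum>a\<in>R. \<Sum>b\<in>R. if a = b then 2 ^ w else 0)"
    using assms(2) by (intro sum.cong refl ip_orth) auto
  moreover have "\<dots> = card R * 2 ^ w" using fin by simp
  ultimately have "real (card T) * (real (card R))\<^sup>2 \<le> card R * 2 ^ w" by simp
  then have "real (card R) * (real (card R) * real (card T)) \<le> real (card R) * 2 ^ w"
    by (simp add: power2_eq_square mult_ac)
  moreover have "real (card R) > 0" using False fin by (simp add: card_gt_0_iff)
  ultimately have "real (card R) * real (card T) \<le> 2 ^ w" by (simp only: mult_le_cancel_left_pos)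
  then have "real (card R * card T) \<le> real (2 ^ w)" by simp
  then show ?thesis by (simp only: of_nat_le_iff)
qed simp

text \<open>The linear involution \<open>(y, z) -> (y, z + L y)\<close> of
  \<open>F_2 ^ (w + k)\<close>, with \<open>l\<close> listing the rows of \<open>L\<close>. It
  reaches the subspace \<open>z = 0\<close> exactly from the points with
  \<open>z = L y\<close>.\<close>

definition shear :: "nat \<Rightarrow> nat \<Rightarrow> (nat \<Rightarrow> point) \<Rightarrow> point \<Rightarrow> point" where
  "shear w k l x = map (\<lambda>j. if j < w then x ! j else x ! j \<noteq> ip w (l (j - w)) x) [0..<w + k]"

definition shear_maps :: "nat \<Rightarrow> nat \<Rightarrow> (nat \<Rightarrow> point) set" where
  "shear_maps w k = PiE {..<k} (\<lambda>_. points w)"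

text \<open>The origin is left out because it is the position to be decoded; \<open>rm_post\<close>
  does not look at the bit received there.\<close>

definition kernel :: "nat \<Rightarrow> nat \<Rightarrow> point set" where
  "kernel w k = {v \<in> points (w + k) - {zero (w + k)}. \<forall>j. w \<le> j \<longrightarrow> j < w + k \<longrightarrow> \<not> v ! j}"

lemma shear_nth: "j < w + k \<Longrightarrow> shear w k l x ! j = (if j < w then x ! j else x ! j \<noteq> ip w (l (j - w)) x)"
  by (simp add: shear_def)

lemma shear_points [simp]: "shear w k l x \<in> points (w + k)"
  by (simp add: shear_def points_def)

lemma shear_shear: "x \<in> points (w + k) \<Longrightarrow> shear w k l (shear w k l x) = x"
proof (rule points_eqI[of _ "w + k"])
  fix j assume j: "j < w + k"
  have "ip w a (shear w k l x) = ip w a x" for a by (rule ip_cong) (auto simp: shear_nth)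
  then show "shear w k l (shear w k l x) ! j = x ! j" using j by (auto simp: shear_nth)
qed auto

lemma shear_zero: "shear w k l (zero (w + k)) = zero (w + k)"
  by (rule points_eqI[of _ "w + k"]) (auto simp: shear_nth ip_zero)

lemma finite_shear_maps: "finite (shear_maps w k)" and card_shear_maps: "card (shear_maps w k) = (2 ^ w) ^ k"
  by (auto simp: shear_maps_def card_PiE intro!: finite_PiE)

text \<open>The rows of a shear are independent, and row \<open>i\<close> must solve one linear
  equation for each point of \<open>T\<close>. If a solution exists, the points of \<open>T\<close>
  and the origin already differ in their first \<open>w\<close> bits, so \<open>ip_solutions\<close>
  leaves at most a fraction \<open>1 / (card T + 1)\<close> of the choices for each of the
  \<open>k\<close> rows.\<close>

lemma shear_count:
  assumes T: "T \<subseteq> points (w + k) - {zero (w + k)}"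
  shows "card {l \<in> shear_maps w k. shear w k l ` T \<subseteq> kernel w k} * (card T + 1) ^ k \<le> card (shear_maps w k)"
proof -
  let ?L = "{l \<in> shear_maps w k. shear w k l ` T \<subseteq> kernel w k}"
  define R where "R = (\<lambda>i. {a \<in> points w. \<forall>x\<in>T. x ! (w + i) = ip w a x})"
  have key: "x ! (w + i) = ip w (l i) x" if "l \<in> ?L" "x \<in> T" "i < k" for l x i
  proof -
    have "shear w k l x \<in> kernel w k" using that by auto
    then have "\<not> shear w k l x ! (w + i)" using that(3) by (auto simp: kernel_def)
    then show ?thesis using that(3) by (simp add: shear_nth)
  qed
  have sub: "?L \<subseteq> PiE {..<k} R"
  proof
    fix l assume l: "l \<in> ?L"
    then have "l \<in> PiE {..<k} (\<lambda>_. points w)" by (simp add: shear_maps_def)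
    then show "l \<in> PiE {..<k} R" using key[OF l] by (auto simp: PiE_iff R_def)
  qed
  have finR: "finite (R i)" for i by (simp add: R_def)
  have "card ?L \<le> card (PiE {..<k} R)" using finR by (intro card_mono[OF _ sub] finite_PiE) auto
  then have cL: "card ?L \<le> (\<Prod>i<k. card (R i))" by (simp add: card_PiE)
  show ?thesis
  proof (cases "?L = {}")
    case True then show ?thesis by (simp only: card.empty)
  next
    case False
    then obtain l where l: "l \<in> ?L" by auto
    have finT: "finite T" by (rule finite_subset[OF T]) simp
    \<comment> \<open>The origin satisfies every equation and supplies the
      \<open>+ 1\<close>.\<close>
    let ?T0 = "insert (zero (w + k)) T"
    have T0: "x \<in> points (w + k)" if "x \<in> ?T0" for x using that T by auto
    have key0: "x ! (w + i) = ip w (l i) x" if "x \<in> ?T0" "i < k" for x i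
      using key[OF l _ that(2)] that by (auto simp: ip_zero)
    have inj: "inj_on (take w) ?T0"
    proof (rule inj_onI)
      fix x y assume xy: "x \<in> ?T0" "y \<in> ?T0" "take w x = take w y"
      have low: "x ! j = y ! j" if "j < w" for j using xy(3) that by (metis nth_take)
      show "x = y"
      proof (rule points_eqI[OF T0[OF xy(1)] T0[OF xy(2)]])
        fix j assume j: "j < w + k"
        show "x ! j = y ! j"
        proof (cases "j < w")
          case False
          then have i: "j = w + (j - w)" "j - w < k" using j by auto
          have "ip w (l (j - w)) x = ip w (l (j - w)) y" using low by (intro ip_cong) auto
          then show ?thesis using key0[OF xy(1) i(2)] key0[OF xy(2) i(2)] i(1) by simp
        qed (use low in auto)
      qed
    qed
    have "zero (w + k) \<notin> T" using T by auto
    then have cT: "card (take w ` ?T0) = card T + 1" unfolding card_image[OF inj] using finT by simp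
    have each: "card (R i) * (card T + 1) \<le> 2 ^ w" if "i < k" for i
      unfolding cT[symmetric]
    proof (rule ip_solutions)
      show "take w ` ?T0 \<subseteq> points w" using T0 by (auto simp: points_def)
      show "R i \<subseteq> points w" by (auto simp: R_def)
      fix a x assume a: "a \<in> R i" and "x \<in> take w ` ?T0"
      then obtain y where y: "x = take w y" "y \<in> ?T0" by blast
      have tk: "ip w b x = ip w b y" for b unfolding y(1) by (rule ip_cong) auto
      have "y ! (w + i) = ip w a y"
        using y(2) a that by (auto simp: R_def ip_zero)
      then show "ip w a x = ip w (l i) x" using key0[OF y(2) that] unfolding tk by simp
    qed
    have "card ?L * (card T + 1) ^ k \<le> (\<Prod>i<k. card (R i)) * (card T + 1) ^ k"
      using cL by (rule mult_right_mono) simp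
    also have "\<dots> = (\<Prod>i<k. card (R i) * (card T + 1))" by (simp only: prod.distrib) simp
    also have "\<dots> \<le> (\<Prod>i<k. 2 ^ w)" using each by (intro prod_mono) auto
    finally show ?thesis by (simp add: card_shear_maps)
  qed
qed

section \<open>The code as a family of supports, and its affine symmetries\<close>

definition RMs :: "nat \<Rightarrow> nat \<Rightarrow> point set set" where
  "RMs n r = Collect ` RM n r"

lemma in_RMs: "S \<in> RMs n r \<longleftrightarrow> (\<lambda>x. x \<in> S) \<in> RM n r"
proof
  assume "S \<in> RMs n r"
  then obtain u where "u \<in> RM n r" "S = Collect u" by (auto simp: RMs_def)
  then show "(\<lambda>x. x \<in> S) \<in> RM n r" by simp
next
  assume "(\<lambda>x. x \<in> S) \<in> RM n r"
  then have "Collect (\<lambda>x. x \<in> S) \<in> RMs n r" unfolding RMs_def by (rule imageI)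
  then show "S \<in> RMs n r" by simp
qed

lemma RMs_sub: "RMs n r \<subseteq> Pow (points n)"
  using RM_outside by (auto simp: RMs_def)

lemma card_RMs: "card (RMs n r) = card (RM n r)"
  unfolding RMs_def by (rule card_image) (auto simp: inj_on_def)

lemma RM_affine_coord:
  assumes "i < n" shows "(\<lambda>x. x \<in> points n \<and> (c \<noteq> (d \<and> x ! i))) \<in> RM n 1"
proof -
  have "(\<lambda>x. x \<in> points n \<and> (c \<noteq> (d \<and> x ! i))) =
    wxor (if c then (\<lambda>x. x \<in> points n) else (\<lambda>_. False)) (if d then (\<lambda>x. x \<in> points n \<and> x ! i) else (\<lambda>_. False))"
    by (auto simp: fun_eq_iff)
  then show ?thesis using RM_coord[OF assms] RM_one RM_zero by (auto intro!: RM_xor)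
qed

lemma RM_const: "(\<lambda>x. x \<in> points n \<and> c) \<in> RM n r"
  using RM_one[of n r] by (cases c) auto

lemma RM_ip:
  assumes "\<And>j. j < w \<Longrightarrow> (\<lambda>x. x \<in> points n \<and> T x ! j) \<in> RM n 1"
  shows "(\<lambda>x. x \<in> points n \<and> ip w a (T x)) \<in> RM n 1"
  using assms
proof (induction w)
  case (Suc w)
  have "(\<lambda>x. x \<in> points n \<and> ip (Suc w) a (T x)) =
    wxor (\<lambda>x. x \<in> points n \<and> ip w a (T x)) (if a ! w then (\<lambda>x. x \<in> points n \<and> T x ! w) else (\<lambda>_. False))"
    by (auto simp: fun_eq_iff)
  moreover have "(\<lambda>x. x \<in> points n \<and> ip w a (T x)) \<in> RM n 1" using Suc by simp
  ultimately show ?case using Suc.prems[of w] RM_zero by (auto intro!: RM_xor)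
qed simp

lemma RMs_pullback:
  assumes "c \<in> RMs m r" "\<And>x. x \<in> points n \<Longrightarrow> T x \<in> points m"
    "\<And>i. i < m \<Longrightarrow> (\<lambda>x. x \<in> points n \<and> T x ! i) \<in> RM n 1"
  shows "{x \<in> points n. T x \<in> c} \<in> RMs n r"
  using RM_comp[of "\<lambda>x. x \<in> c" m r n T] assms by (simp add: in_RMs)

lemma RMs_involution:
  assumes T: "\<And>x. x \<in> points n \<Longrightarrow> T x \<in> points n \<and> T (T x) = x"
    and aff: "\<And>i. i < n \<Longrightarrow> (\<lambda>x. x \<in> points n \<and> T x ! i) \<in> RM n 1"
  shows "inj_on T (points n)" "T ` points n = points n" "(image T) ` RMs n r = RMs n r"
proof -
  show "inj_on T (points n)" using T by (metis inj_onI)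
  show "T ` points n = points n" using T by (auto simp: image_iff) metis
  have im: "T ` c = {x \<in> points n. T x \<in> c}" if "c \<in> RMs n r" for c
  proof -
    have "c \<subseteq> points n" using that RMs_sub by auto
    then show ?thesis using T by (auto simp: image_iff) (metis subset_iff)
  qed
  have into: "T ` c \<in> RMs n r" if "c \<in> RMs n r" for c
    unfolding im[OF that] using T aff by (intro RMs_pullback[OF that]) auto
  have "c \<in> (image T) ` RMs n r" if "c \<in> RMs n r" for c
  proof (rule image_eqI[of _ _ "T ` c"])
    have "c \<subseteq> points n" using that RMs_sub by auto
    then show "c = T ` T ` c" using T by (force simp: image_iff)
  qed (rule into[OF that])
  then show "(image T) ` RMs n r = RMs n r" using into by auto
qed

lemma shear_affine:
  assumes "i < w + k" shows "(\<lambda>x. x \<in> points (w + k) \<and> shear w k l x ! i) \<in> RM (w + k) 1"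
proof (cases "i < w")
  case True
  then show ?thesis using RM_coord[of i "w + k" 1] assms by (simp add: shear_nth)
next
  case False
  have "(\<lambda>x. x \<in> points (w + k) \<and> shear w k l x ! i) =
     wxor (\<lambda>x. x \<in> points (w + k) \<and> x ! i) (\<lambda>x. x \<in> points (w + k) \<and> ip w (l (i - w)) x)"
    using False assms by (auto simp: shear_nth fun_eq_iff)
  moreover have "(\<lambda>x. x \<in> points (w + k) \<and> ip w (l (i - w)) x) \<in> RM (w + k) 1"
    by (rule RM_ip) (auto intro: RM_coord)
  ultimately show ?thesis using RM_coord[of i "w + k" 1] assms by (auto intro!: RM_xor)
qed

definition xlate :: "nat \<Rightarrow> point \<Rightarrow> point \<Rightarrow> point" where
  "xlate n a x = map (\<lambda>j. a ! j \<noteq> x ! j) [0..<n]"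

lemma xlate_nth [simp]: "j < n \<Longrightarrow> xlate n a x ! j = (a ! j \<noteq> x ! j)"
  by (simp add: xlate_def)

lemma xlate_points [simp]: "xlate n a x \<in> points n"
  by (simp add: xlate_def points_def)

lemma xlate_xlate: "x \<in> points n \<Longrightarrow> xlate n a (xlate n a x) = x"
  by (rule points_eqI[of _ n]) auto

lemma xlate_zero: "x \<in> points n \<Longrightarrow> xlate n x (zero n) = x"
  by (rule points_eqI[of _ n]) auto

lemma xlate_affine: "i < n \<Longrightarrow> (\<lambda>x. x \<in> points n \<and> xlate n a x ! i) \<in> RM n 1"
  using RM_affine_coord[of i n "a ! i" True] by simp

text \<open>The petal maps: besides the point itself they record two shifted copies of its last \<open>k\<close> bits.
  A nonzero word determines the amounts \<open>a\<close>, \<open>b\<close> of the shifts, so different petals only meet in the kernel.\<close>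
definition petal :: "nat \<Rightarrow> nat \<Rightarrow> nat \<Rightarrow> point \<Rightarrow> nat \<times> nat \<Rightarrow> point \<Rightarrow> point" where
  "petal w k N x0 ab v = map (\<lambda>j. x0 ! j \<noteq>
     (if j < w + k then v ! j
      else if j < w + k + (k + N) then fst ab \<le> j - (w + k) \<and> j - (w + k) < fst ab + k \<and> v ! (w + (j - (w + k) - fst ab))
      else snd ab \<le> j - (w + k + (k + N)) \<and> j - (w + k + (k + N)) < snd ab + k \<and> v ! (w + (j - (w + k + (k + N)) - snd ab))))
     [0..<w + k + 2 * (k + N)]"

text \<open>If \<open>a < b\<close>, equality of the shifted copies sends a set position
  \<open>i\<close> of \<open>p\<close> to the smaller set position \<open>a + i - b\<close>, and
  infinite descent excludes this. A window of length \<open>k + N\<close> holds every shift below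
  \<open>N\<close>.\<close>

lemma shift_unique:
  fixes p :: "nat \<Rightarrow> bool"
  assumes eq: "\<And>t. t < k + N \<Longrightarrow> (a \<le> t \<and> t < a + k \<and> p (t - a)) = (b \<le> t \<and> t < b + k \<and> p (t - b))"
    and "a < N" "b < N" "i < k" "p i"
  shows "a = b"
proof -
  have aux: "\<not> p i" if eq: "\<And>t. t < k + N \<Longrightarrow> (a \<le> t \<and> t < a + k \<and> p (t - a)) = (b \<le> t \<and> t < b + k \<and> p (t - b))"
    and "a < b" "a < N" "i < k" for a b i
    using that(4)
  proof (induction i rule: less_induct)
    case (less i)
    show ?case
    proof
      assume "p i"
      then have "b \<le> a + i \<and> a + i < b + k \<and> p (a + i - b)" using eq[of "a + i"] that less.prems by auto
      moreover have "a + i - b < i" "a + i - b < k" using calculation \<open>a < b\<close> less.prems by auto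
      ultimately show False using less.IH by blast
    qed
  qed
  show ?thesis
  proof (rule ccontr)
    assume "a \<noteq> b"
    then consider "a < b" | "b < a" by linarith
    then show False using aux[of a b i] aux[of b a i] assms by cases auto
  qed
qed

lemma petal_points [simp]: "petal w k N x0 ab v \<in> points (w + k + 2 * (k + N))"
  by (simp add: petal_def points_def)

lemma petal_nth:
  assumes "j < w + k + 2 * (k + N)"
  shows "petal w k N x0 ab v ! j = (x0 ! j \<noteq>
     (if j < w + k then v ! j
      else if j < w + k + (k + N) then fst ab \<le> j - (w + k) \<and> j - (w + k) < fst ab + k \<and> v ! (w + (j - (w + k) - fst ab))
      else snd ab \<le> j - (w + k + (k + N)) \<and> j - (w + k + (k + N)) < snd ab + k \<and> v ! (w + (j - (w + k + (k + N)) - snd ab))))"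
  using assms by (simp add: petal_def)

lemma petal_eq_imp:
  assumes "v \<in> points (w + k)" "v' \<in> points (w + k)" "petal w k N x0 ab v = petal w k N x0 cd v'"
  shows "v = v'"
proof (rule points_eqI[OF assms(1,2)])
  fix j assume "j < w + k"
  then show "v ! j = v' ! j"
    using arg_cong[OF assms(3), of "\<lambda>l. l ! j"] petal_nth[of j w k N x0 ab v] petal_nth[of j w k N x0 cd v'] by auto
qed

text \<open>Two independent shifts give \<open>N * N\<close> petals at the price of
  \<open>2 * (k + N)\<close> coordinates, hence order \<open>m\<close> petals in codimension
  O(\<open>sqrt m\<close>). With one shift the Chernoff term would only be exponentially small in
  \<open>sqrt m\<close>, without the logarithm.\<close>

lemma petal_disjoint:
  assumes v: "v \<in> points (w + k) - {zero (w + k)}" "v \<notin> kernel w k"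
    and ab: "ab \<in> {..<N} \<times> {..<N}" "cd \<in> {..<N} \<times> {..<N}"
    and eq: "petal w k N x0 ab v = petal w k N x0 cd v"
  shows "ab = cd"
proof -
  obtain i where i: "i < k" "v ! (w + i)"
  proof -
    obtain j where "w \<le> j" "j < w + k" "v ! j" using v by (auto simp: kernel_def)
    then show thesis using that[of "j - w"] by auto
  qed
  have "fst ab = fst cd"
  proof (rule shift_unique[of k N "fst ab" "\<lambda>i. v ! (w + i)" "fst cd" i])
    fix t assume t: "t < k + N"
    then show "(fst ab \<le> t \<and> t < fst ab + k \<and> v ! (w + (t - fst ab))) = (fst cd \<le> t \<and> t < fst cd + k \<and> v ! (w + (t - fst cd)))"
      using arg_cong[OF eq, of "\<lambda>l. l ! (w + k + t)"] petal_nth[of "w + k + t" w k N x0 ab v] petal_nth[of "w + k + t" w k N x0 cd v]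
      by auto
  qed (use ab i in auto)
  moreover have "snd ab = snd cd"
  proof (rule shift_unique[of k N "snd ab" "\<lambda>i. v ! (w + i)" "snd cd" i])
    fix t assume t: "t < k + N"
    then show "(snd ab \<le> t \<and> t < snd ab + k \<and> v ! (w + (t - snd ab))) = (snd cd \<le> t \<and> t < snd cd + k \<and> v ! (w + (t - snd cd)))"
      using arg_cong[OF eq, of "\<lambda>l. l ! (w + k + (k + N) + t)"] petal_nth[of "w + k + (k + N) + t" w k N x0 ab v] petal_nth[of "w + k + (k + N) + t" w k N x0 cd v]
      by auto
  qed (use ab i in auto)
  ultimately show ?thesis by (simp add: prod_eq_iff)
qed

lemma petal_zero:
  assumes "x0 \<in> points (w + k + 2 * (k + N))" shows "petal w k N x0 ab (zero (w + k)) = x0"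
proof (rule points_eqI[OF petal_points assms])
  fix j assume j: "j < w + k + 2 * (k + N)"
  show "petal w k N x0 ab (zero (w + k)) ! j = x0 ! j"
    unfolding petal_nth[OF j] by auto
qed

lemma petal_kernel:
  assumes "v \<in> kernel w k" shows "petal w k N x0 ab v = petal w k N x0 cd v"
proof (rule points_eqI[OF petal_points petal_points])
  fix j assume j: "j < w + k + 2 * (k + N)"
  have v: "\<not> v ! (w + i)" if "i < k" for i using assms that by (auto simp: kernel_def)
  have "(a \<le> t \<and> t < a + k \<and> v ! (w + (t - a))) = False" for a t
  proof -
    have "a \<le> t \<Longrightarrow> t < a + k \<Longrightarrow> t - a < k" by linarith
    then show ?thesis using v[of "t - a"] by blast
  qed
  then show "petal w k N x0 ab v ! j = petal w k N x0 cd v ! j"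
    unfolding petal_nth[OF j] by (simp only:)
qed

lemma petal_affine:
  assumes "j < w + k + 2 * (k + N)"
  shows "(\<lambda>v. v \<in> points (w + k) \<and> petal w k N x0 ab v ! j) \<in> RM (w + k) 1"
  unfolding petal_nth[OF assms]
proof -
  let ?n = "w + k"
  consider "j < ?n" | "\<not> j < ?n" "j < ?n + (k + N)" | "\<not> j < ?n" "\<not> j < ?n + (k + N)" by blast
  then show "(\<lambda>v. v \<in> points (w + k) \<and> x0 ! j \<noteq>
     (if j < w + k then v ! j
      else if j < w + k + (k + N) then fst ab \<le> j - (w + k) \<and> j - (w + k) < fst ab + k \<and> v ! (w + (j - (w + k) - fst ab))
      else snd ab \<le> j - (w + k + (k + N)) \<and> j - (w + k + (k + N)) < snd ab + k \<and> v ! (w + (j - (w + k + (k + N)) - snd ab)))) \<in> RM (w + k) 1"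
  proof cases
    case 1
    then show ?thesis using RM_affine_coord[of j ?n "x0 ! j" True] by simp
  next
    case 2
    show ?thesis
    proof (cases "fst ab \<le> j - ?n \<and> j - ?n < fst ab + k")
      case True
      then have "w + (j - ?n - fst ab) < ?n" by linarith
      from RM_affine_coord[OF this, of "x0 ! j" True] True 2 show ?thesis by simp
    next
      case False
      then show ?thesis using 2 RM_const[of ?n "x0 ! j" 1] by auto
    qed
  next
    case 3
    show ?thesis
    proof (cases "snd ab \<le> j - (?n + (k + N)) \<and> j - (?n + (k + N)) < snd ab + k")
      case True
      then have "w + (j - (?n + (k + N)) - snd ab) < ?n" by linarith
      from RM_affine_coord[OF this, of "x0 ! j" True] True 3 show ?thesis by simp
    next
      case False
      then show ?thesis using 3 RM_const[of ?n "x0 ! j" 1] by auto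
    qed
  qed
qed


subsection \<open>Bit error probability\<close>

context lin_code begin

definition lik1 :: "'a \<Rightarrow> 'a set \<Rightarrow> real" where
  "lik1 x Y = (\<Sum>c\<in>{c \<in> C. x \<in> c}. wt Om (sd c Y))"

definition lik0 :: "'a \<Rightarrow> 'a set \<Rightarrow> real" where
  "lik0 x Y = (\<Sum>c\<in>{c \<in> C. x \<notin> c}. wt Om (sd c Y))"

text \<open>The probability that the bitwise maximum a posteriori rule outputs 1, with a fair coin
  on ties; for the zero codeword it is the error probability.\<close>

definition guess1 :: "'a \<Rightarrow> 'a set \<Rightarrow> real" where
  "guess1 x Y = (if lik0 x Y < lik1 x Y then 1 else if lik1 x Y < lik0 x Y then 0 else 1/2)"

lemma lik_shift:
  assumes "c \<in> C"
  shows "lik1 x (sd c Y) = (if x \<in> c then lik0 x Y else lik1 x Y)"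
    and "lik0 x (sd c Y) = (if x \<in> c then lik1 x Y else lik0 x Y)"
proof -
  have "sd d (sd c Y) = sd (sd c d) Y" for d by (auto simp: set_eq_iff)
  then show "lik1 x (sd c Y) = (if x \<in> c then lik0 x Y else lik1 x Y)"
    "lik0 x (sd c Y) = (if x \<in> c then lik1 x Y else lik0 x Y)"
    unfolding lik1_def lik0_def using assms C_sd
    by (auto intro!: sum.reindex_bij_witness[of _ "sd c" "sd c"])
qed

lemma guess_shift:
  assumes "c \<in> C" shows "guess1 x (sd c Y) = (if x \<in> c then 1 - guess1 x Y else guess1 x Y)"
  using lik_shift[OF assms] by (auto simp: guess1_def)

lemma guess_bounds: "0 \<le> guess1 x Y" "guess1 x Y \<le> 1"
  by (auto simp: guess1_def)

text \<open>Writing the noise as codeword plus received word, for every codeword in turn, converts a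
  noise average into a sum over received words in which the two likelihoods compete.\<close>

lemma average_over_code:
  assumes "\<And>c Y. c \<in> C \<Longrightarrow> Y \<subseteq> Om \<Longrightarrow> F (sd c Y) = (if x \<in> c then a Y else b Y)"
  shows "card C * E Om F = (\<Sum>Y\<in>Pow Om. lik1 x Y * a Y + lik0 x Y * b Y)"
proof -
  have e: "sd c Y \<inter> Om = sd c Y" if "c \<in> C" "Y \<in> Pow Om" for c Y
    using that by (auto dest!: subsetD[OF C_sub])
  have "card C * E Om F = (\<Sum>c\<in>C. \<Sum>Y\<in>Pow Om. wt Om (sd c Y \<inter> Om) * F (sd c Y \<inter> Om))"
    by (simp add: E_def sum_Pow_sd_shift[of "\<lambda>Y. wt Om Y * F Y"])
  also have "\<dots> = (\<Sum>c\<in>C. \<Sum>Y\<in>Pow Om. wt Om (sd c Y) * (if x \<in> c then a Y else b Y))"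
    using assms by (intro sum.cong refl) (simp add: e)
  also have "\<dots> = (\<Sum>Y\<in>Pow Om. \<Sum>c\<in>C. wt Om (sd c Y) * (if x \<in> c then a Y else b Y))"
    by (rule sum.swap)
  also have "\<dots> = (\<Sum>Y\<in>Pow Om. lik1 x Y * a Y + lik0 x Y * b Y)"
  proof (rule sum.cong[OF refl])
    fix Y
    have "(\<Sum>c\<in>C. wt Om (sd c Y) * (if x \<in> c then a Y else b Y)) =
      (\<Sum>c\<in>C. if x \<in> c then wt Om (sd c Y) * a Y else wt Om (sd c Y) * b Y)"
      by (intro sum.cong) auto
    also have "\<dots> = (\<Sum>c\<in>C \<inter> {c. x \<in> c}. wt Om (sd c Y) * a Y) + (\<Sum>c\<in>C \<inter> - {c. x \<in> c}. wt Om (sd c Y) * b Y)"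
      by (rule sum.If_cases) simp
    also have "C \<inter> {c. x \<in> c} = {c \<in> C. x \<in> c}" by auto
    also have "C \<inter> - {c. x \<in> c} = {c \<in> C. x \<notin> c}" by auto
    finally show "(\<Sum>c\<in>C. wt Om (sd c Y) * (if x \<in> c then a Y else b Y)) = lik1 x Y * a Y + lik0 x Y * b Y"
      by (simp add: lik1_def lik0_def sum_distrib_right)
  qed
  finally show ?thesis .
qed

text \<open>For each received word the MAP rule pays the smaller of the two likelihoods, so it is at
  least as good as any score \<open>S\<close> whose sign follows the codeword bit. A score of 0
  counts as an error.\<close>

lemma guess_optimal:
  assumes S: "\<And>c Y. c \<in> C \<Longrightarrow> Y \<subseteq> Om \<Longrightarrow> S (sd c Y) = sg x c * S Y"
  shows "E Om (guess1 x) \<le> E Om (\<lambda>Z. of_bool (S Z \<le> 0))"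
proof -
  have "card C * E Om (guess1 x) = (\<Sum>Y\<in>Pow Om. lik1 x Y * (1 - guess1 x Y) + lik0 x Y * guess1 x Y)"
    by (rule average_over_code) (rule guess_shift)
  also have "\<dots> \<le> (\<Sum>Y\<in>Pow Om. lik1 x Y * of_bool (- S Y \<le> 0) + lik0 x Y * of_bool (S Y \<le> 0))"
  proof (rule sum_mono)
    fix Y
    have "0 \<le> lik0 x Y" "0 \<le> lik1 x Y" by (auto simp: lik0_def lik1_def intro!: sum_nonneg wt_nonneg)
    then show "lik1 x Y * (1 - guess1 x Y) + lik0 x Y * guess1 x Y \<le> lik1 x Y * of_bool (- S Y \<le> 0) + lik0 x Y * of_bool (S Y \<le> 0)"
      by (cases "S Y \<le> 0"; cases "- S Y \<le> 0") (auto simp: guess1_def)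
  qed
  also have "\<dots> = card C * E Om (\<lambda>Z. of_bool (S Z \<le> 0))"
    by (rule average_over_code[symmetric]) (auto simp: S sg_def)
  finally show ?thesis using card_C_pos by simp
qed

end

section \<open>The Reed-Muller instance\<close>

context bsc begin

lemma RMs_code: "lin_code eps (points n) (RMs n r)"
proof
  show "{} \<in> RMs n r" by (simp add: in_RMs)
  fix a b assume "a \<in> RMs n r" "b \<in> RMs n r"
  then show "sd a b \<in> RMs n r" using RM_xor[of "\<lambda>x. x \<in> a" n r "\<lambda>x. x \<in> b"] by (simp add: in_RMs wxor_def)
qed (auto simp: RMs_sub)

definition rm_post :: "nat \<Rightarrow> nat \<Rightarrow> point set \<Rightarrow> real" where
  "rm_post n r = lin_code.post eps (RMs n r) (points n - {zero n}) (zero n)"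

definition rm_guess :: "nat \<Rightarrow> nat \<Rightarrow> point \<Rightarrow> point set \<Rightarrow> real" where
  "rm_guess M r = lin_code.guess1 eps (points M) (RMs M r)"

text \<open>Translations preserve the code and act transitively on the points. The factor
  \<open>ln 2\<close> converts bits into the nats of \<open>kl\<close>.\<close>

lemma rm_post_mean:
  "(1 - bin_entropy eps - binom_le n r / 2 ^ n) * ln 2 \<le> E (points n - {zero n}) (rm_post n r)"
proof -
  interpret lin_code eps "points n" "RMs n r" by (rule RMs_code)
  have "\<exists>g. inj_on g (points n) \<and> g ` points n = points n \<and> (image g) ` RMs n r = RMs n r \<and> g (zero n) = x"
    if "x \<in> points n" for x
  proof -
    note g = RMs_involution[where n = n and T = "xlate n x", OF conjI[OF xlate_points xlate_xlate] xlate_affine]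
    show ?thesis using xlate_zero[OF that] by (intro exI[of _ "xlate n x"] conjI g)
  qed
  then have weak: "card (points n) * (ln 2 + eps * ln eps + (1 - eps) * ln (1 - eps)) - ln (card (RMs n r))
    \<le> card (points n) * E (points n - {zero n}) (rm_post n r)"
    unfolding rm_post_def by (intro weak_decoding) auto
  have "real (card (RMs n r)) \<le> 2 ^ binom_le n r"
    using RM_card(2)[of n r] unfolding card_RMs by (metis of_nat_le_iff of_nat_numeral of_nat_power)
  then have "ln (card (RMs n r)) \<le> ln (2 ^ binom_le n r)"
    using card_C_pos by (subst ln_le_cancel_iff) auto
  then have "ln (card (RMs n r)) \<le> binom_le n r * ln 2" by (simp add: ln_realpow)
  moreover have "bin_entropy eps * ln 2 = - (eps * ln eps) - (1 - eps) * ln (1 - eps)"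
    by (simp add: bin_entropy_def log_def field_simps)
  moreover from this have "ln 2 + eps * ln eps + (1 - eps) * ln (1 - eps) = (1 - bin_entropy eps) * ln 2"
    by (simp add: algebra_simps)
  ultimately have "2 ^ n * ((1 - bin_entropy eps) * ln 2) - binom_le n r * ln 2 \<le> 2 ^ n * E (points n - {zero n}) (rm_post n r)"
    using weak by simp
  moreover have "2 ^ n * ((1 - bin_entropy eps - binom_le n r / 2 ^ n) * ln 2) = 2 ^ n * ((1 - bin_entropy eps) * ln 2) - binom_le n r * ln 2"
    by (simp add: left_diff_distrib right_diff_distrib)
  ultimately have "2 ^ n * ((1 - bin_entropy eps - binom_le n r / 2 ^ n) * ln 2) \<le> 2 ^ n * E (points n - {zero n}) (rm_post n r)"
    by simp
  then show ?thesis by (simp only: mult_le_cancel_left_pos zero_less_power zero_less_numeral)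
qed

lemma rm_post_bound: "\<bar>rm_post n r Y\<bar> \<le> 1"
proof -
  interpret lin_code eps "points n" "RMs n r" by (rule RMs_code)
  show ?thesis unfolding rm_post_def by (rule post_le)
qed

text \<open>Shears fix the origin and preserve the code, so the posterior mean at the origin is
  invariant under them.\<close>

lemma rm_post_contraction:
  "(\<Sum>S\<in>{S \<in> Pow (kernel w k). d \<le> card S}. (coef (points (w + k) - {zero (w + k)}) (rm_post (w + k) r) S)\<^sup>2)
     \<le> 1 / (real d + 1) ^ k"
proof (rule symmetric_contraction[where G = "shear_maps w k" and g = "shear w k"])
  interpret lin_code eps "points (w + k)" "RMs (w + k) r" by (rule RMs_code)
  let ?A = "points (w + k) - {zero (w + k)}"
  show inv: "shear w k l v \<in> ?A \<and> shear w k l (shear w k l v) = v" if "v \<in> ?A" for l v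
    using that shear_shear[of v w k l] shear_zero[of w k l] by auto
  show "rm_post (w + k) r (shear w k l ` Z) = rm_post (w + k) r Z" if "Z \<subseteq> ?A" for l Z
  proof -
    note g = RMs_involution[where n = "w + k" and T = "shear w k l", OF conjI[OF shear_points shear_shear] shear_affine]
    have "shear w k l ` ?A = ?A"
    proof
      show "shear w k l ` ?A \<subseteq> ?A" by (rule image_subsetI) (rule conjunct1[OF inv])
      show "?A \<subseteq> shear w k l ` ?A"
      proof
        fix v assume "v \<in> ?A"
        then show "v \<in> shear w k l ` ?A" using inv[of v l] by (intro image_eqI[of _ _ "shear w k l v"]) auto
      qed
    qed
    then show ?thesis
      using transport_post[OF g(1) g(3), of ?A Z "zero (w + k)"] that by (simp add: rm_post_def shear_zero)
  qed
  show "card {l \<in> shear_maps w k. shear w k l ` T \<subseteq> kernel w k} * (card T + 1) ^ k \<le> card (shear_maps w k)"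
    if "T \<subseteq> ?A" for T
    by (rule shear_count[OF that])
  show "shear_maps w k \<noteq> {}" using card_shear_maps[of w k] by (metis card.empty power_eq_0_iff zero_neq_numeral)
qed (auto simp: finite_shear_maps kernel_def rm_post_bound)

text \<open>A petal pulls a codeword of \<open>RM M r\<close> back to one of
  \<open>RM (w + k) r\<close> whose bit at the origin is the bit at \<open>x0\<close>. The sum of
  the petal posteriors is therefore a score to which the MAP rule can be compared. The three terms
  stem from the low and the high part of the kernel deviation and from the vote.\<close>

lemma bit_error_bound:
  fixes w k N D s M r :: nat
  defines "A \<equiv> points (w + k) - {zero (w + k)}"
  assumes M: "M = w + k + 2 * (k + N)" and x0: "x0 \<in> points M" and N: "0 < N" and s: "1 \<le> s"
    and mu: "E A (rm_post (w + k) r) = mu" "0 < mu"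
  shows "E (points M) (rm_guess M r x0) \<le>
    (4 / mu) ^ (2 ^ s) * ((hyp_const ^ (D * s)) ^ (2 ^ s) * (1 / 2 ^ k) ^ (2 ^ (s - 1)))
     + 16 / mu\<^sup>2 / (real D + 2) ^ k + exp (- mu\<^sup>2 / 16) ^ (N * N)"
proof -
  interpret S: lin_code eps "points (w + k)" "RMs (w + k) r" by (rule RMs_code)
  interpret L: lin_code eps "points M" "RMs M r" by (rule RMs_code)
  let ?f = "rm_post (w + k) r"
  let ?I = "{..<N} \<times> {..<N}"
  define vote where "vote = (\<lambda>Y. \<Sum>ab\<in>?I. ?f {v \<in> A. petal w k N x0 ab v \<in> Y})"
  have finA: "finite A" by (simp add: A_def)
  have eq: "vote (sd c Y) = L.sg x0 c * vote Y" if c: "c \<in> RMs M r" for c Y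
  proof -
    have "?f {v \<in> A. petal w k N x0 ab v \<in> sd c Y} = L.sg x0 c * ?f {v \<in> A. petal w k N x0 ab v \<in> Y}" for ab
    proof -
      let ?c = "{v \<in> points (w + k). petal w k N x0 ab v \<in> c}"
      have c': "?c \<in> RMs (w + k) r"
      proof (rule RMs_pullback[OF c])
        show "petal w k N x0 ab v \<in> points M" for v unfolding M by (rule petal_points)
        show "(\<lambda>v. v \<in> points (w + k) \<and> petal w k N x0 ab v ! i) \<in> RM (w + k) 1" if "i < M" for i
          using that unfolding M by (rule petal_affine)
      qed
      have "{v \<in> A. petal w k N x0 ab v \<in> sd c Y} = sd ?c {v \<in> A. petal w k N x0 ab v \<in> Y} \<inter> A"
        by (auto simp: A_def)
      moreover have "S.sg (zero (w + k)) ?c = L.sg x0 c"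
        using petal_zero[of x0 w k N ab] x0 M by (simp add: S.sg_def L.sg_def)
      moreover have "{v \<in> A. petal w k N x0 ab v \<in> Y} \<subseteq> A" by auto
      ultimately show ?thesis
        using S.post_shift[OF c', of "{v \<in> A. petal w k N x0 ab v \<in> Y}" A "zero (w + k)"]
        by (simp add: rm_post_def A_def)
    qed
    then show ?thesis by (simp add: vote_def sum_distrib_left)
  qed
  have "mu \<le> E A (\<lambda>_. 1)"
    unfolding mu(1)[symmetric] using rm_post_bound[of "w + k" r] by (intro E_mono) (auto simp: abs_le_iff)
  then have mu1: "mu \<le> 1" using finA by simp
  have "E (points M) (rm_guess M r x0) \<le> E (points M) (\<lambda>Z. of_bool (vote Z \<le> 0))"
    unfolding rm_guess_def by (rule L.guess_optimal) (rule eq)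
  also have "\<dots> \<le> E (kernel w k) (\<lambda>Z. of_bool (kmean A (kernel w k) ?f Z < mu / 2)) + exp (- mu\<^sup>2 / 16) ^ card ?I"
    unfolding vote_def
  proof (rule sunflower_vote[where j = "petal w k N x0 (0, 0)"])
    show "kernel w k \<subseteq> A" by (auto simp: kernel_def A_def)
    fix t assume "t \<in> ?I"
    show "inj_on (petal w k N x0 t) A" 
    proof (rule inj_onI)
      fix v v' assume "v \<in> A" "v' \<in> A" "petal w k N x0 t v = petal w k N x0 t v'"
      then show "v = v'" using petal_eq_imp[of v w k v' N x0 t t] by (simp add: A_def)
    qed
    show "petal w k N x0 t ` A \<subseteq> points M" unfolding M by (rule image_subsetI) (rule petal_points)
    fix v assume "v \<in> kernel w k"
    then show "petal w k N x0 t v = petal w k N x0 (0, 0) v" by (rule petal_kernel)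
  next
    fix t u v v' assume tu: "t \<in> ?I" "u \<in> ?I" "t \<noteq> u" "v \<in> A - kernel w k" "v' \<in> A - kernel w k"
    show "petal w k N x0 t v \<noteq> petal w k N x0 u v'"
    proof
      assume e: "petal w k N x0 t v = petal w k N x0 u v'"
      then have "v = v'" using tu by (intro petal_eq_imp[OF _ _ e]) (auto simp: A_def)
      then show False using petal_disjoint[of v w k t N u x0] tu e by (auto simp: A_def)
    qed
  qed (use finA N mu mu1 rm_post_bound in auto)
  also have "E (kernel w k) (\<lambda>Z. of_bool (kmean A (kernel w k) ?f Z < mu / 2)) \<le>
    (4 / mu) ^ (2 ^ s) * ((hyp_const ^ (D * s)) ^ (2 ^ s) * (1 / 2 ^ k) ^ (2 ^ (s - 1))) + 16 / mu\<^sup>2 / (real D + 2) ^ k"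
  proof (rule kernel_tail[OF finA _ mu s])
    show "kernel w k \<subseteq> A" by (auto simp: kernel_def A_def)
  qed (unfold A_def, rule rm_post_contraction)
  finally show ?thesis by simp
qed

end


subsection \<open>Binomial sums\<close>

text \<open>The step is \<open>(2n + 1) * (2n + 3) <= (2n + 2)^2\<close>, as in Wallis'
  product.\<close>

lemma central_binomial_sq: "((2 * n) choose n)\<^sup>2 * (2 * n + 1) \<le> 16 ^ n"
proof (induction n)
  case (Suc n)
  let ?a = "(2 * n) choose n" let ?b = "(2 * Suc n) choose (Suc n)"
  have sym: "(2 * n + 1) choose n = (2 * n + 1) choose (Suc n)"
    using binomial_symmetric[of n "2 * n + 1"] by simp
  define c where "c = Suc (2 * n) choose Suc n"
  have "?b = 2 * c" using sym by (simp add: c_def)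
  then have "?b * Suc n = 2 * (c * Suc n)" by (simp only: mult.assoc)
  also have "c * Suc n = Suc (2 * n) * ?a" unfolding c_def by (rule Suc_times_binomial_eq[symmetric])
  finally have e: "?b * Suc n = 2 * (2 * n + 1) * ?a" by (simp only: mult.assoc Suc_eq_plus1)
  have "(Suc n)\<^sup>2 * (?b\<^sup>2 * (2 * Suc n + 1)) = (?b * Suc n)\<^sup>2 * (2 * n + 3)"
  proof -
    have "2 * Suc n + 1 = 2 * n + 3" by simp
    then show ?thesis unfolding power_mult_distrib by (simp only: mult_ac)
  qed
  also have "\<dots> = (?a\<^sup>2 * (2 * n + 1)) * (4 * ((2 * n + 1) * (2 * n + 3)))"
  proof -
    have "(2 * (2 * n + 1) * x)\<^sup>2 * (2 * n + 3) = (x\<^sup>2 * (2 * n + 1)) * (4 * ((2 * n + 1) * (2 * n + 3)))" for x :: nat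
      by (simp add: power2_eq_square algebra_simps)
    then show ?thesis unfolding e .
  qed
  also have "\<dots> \<le> 16 ^ n * (4 * ((2 * n + 2) * (2 * n + 2)))"
    by (rule mult_mono[OF Suc.IH]) (auto simp: algebra_simps)
  also have "\<dots> = (Suc n)\<^sup>2 * 16 ^ Suc n" by (simp add: power2_eq_square algebra_simps)
  finally show ?case by simp
qed simp

lemma binomial_sq_le: "(m choose r)\<^sup>2 * m \<le> 4 ^ m"
proof -
  have "(m choose r)\<^sup>2 * m \<le> (m choose (m div 2))\<^sup>2 * m"
    using binomial_maximum[of m r] by (intro mult_right_mono power_mono) auto
  also have "\<dots> \<le> 4 ^ m"
  proof (cases "even m")
    case True
    then obtain n where m: "m = 2 * n" by auto
    have "(m choose (m div 2))\<^sup>2 * m \<le> ((2 * n) choose n)\<^sup>2 * (2 * n + 1)" by (simp add: m)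
    then show ?thesis using central_binomial_sq[of n] by (simp add: m power_mult)
  next
    case False
    then obtain n where m: "m = 2 * n + 1" by (auto elim: oddE)
    have sym: "(2 * n + 1) choose n = (2 * n + 1) choose (Suc n)"
      using binomial_symmetric[of n "2 * n + 1"] by simp
    have "(2 * Suc n) choose (Suc n) = 2 * (m choose (m div 2))" using sym by (simp add: m)
    then have "4 * ((m choose (m div 2))\<^sup>2 * (2 * Suc n + 1)) \<le> 16 ^ Suc n"
      using central_binomial_sq[of "Suc n"] by (simp add: power_mult_distrib)
    moreover have "(m choose (m div 2))\<^sup>2 * m \<le> (m choose (m div 2))\<^sup>2 * (2 * Suc n + 1)"
      by (intro mult_left_mono) (auto simp: m)
    moreover have "(4::nat) ^ m = 4 * 16 ^ n" by (simp add: m power_mult)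
    ultimately show ?thesis by simp
  qed
  finally show ?thesis .
qed

lemma binomial_le_sqrt: "0 < m \<Longrightarrow> real (m choose r) / 2 ^ m \<le> 1 / sqrt m"
proof -
  assume m: "0 < m"
  have "(real (m choose r) / 2 ^ m)\<^sup>2 * m \<le> 1"
  proof -
    have "real ((m choose r)\<^sup>2 * m) \<le> real (4 ^ m)" using binomial_sq_le[of m r] by (simp only: of_nat_le_iff)
    moreover have "((2::real) ^ m)\<^sup>2 = 4 ^ m" by (simp add: power_mult[symmetric] mult.commute[of m] power_mult)
    ultimately show ?thesis by (simp add: power_divide)
  qed
  then have "(real (m choose r) / 2 ^ m)\<^sup>2 \<le> 1 / m" using m by (simp add: pos_le_divide_eq)
  also have "\<dots> = (1 / sqrt m)\<^sup>2" by (simp add: power_divide)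
  finally show ?thesis by (rule power2_le_imp_le) simp
qed

section \<open>Rate under deletion of variables, and the admissible degrees\<close>

definition rate :: "nat \<Rightarrow> nat \<Rightarrow> real" where
  "rate m r = binom_le m r / 2 ^ m"

lemma rate_Suc: "rate m r = rate (Suc m) r + real (m choose r) / 2 ^ Suc m"
proof -
  have "binom_le (Suc m) r + (m choose r) = 2 * binom_le m r"
  proof (induction r)
    case 0 show ?case by (simp add: binom_le_def)
  next
    case (Suc r)
    then show ?case by (simp add: binom_le_def)
  qed
  then have "real (binom_le (Suc m) r) + real (m choose r) = 2 * real (binom_le m r)"
    by (metis of_nat_add of_nat_mult of_nat_numeral)
  then show ?thesis by (simp add: rate_def field_simps)
qed

text \<open>By Pascal's rule one variable fewer raises the rate by half of a normalised binomial
  coefficient, hence by at most \<open>1 / sqrt n\<close>.\<close>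

lemma rate_shrink:
  assumes "0 < n" shows "rate n r \<le> rate (n + t) r + t / sqrt n"
proof (induction t)
  case (Suc t)
  have "real ((n + t) choose r) / 2 ^ Suc (n + t) \<le> real ((n + t) choose r) / 2 ^ (n + t)"
    by (intro divide_left_mono) auto
  also have "\<dots> \<le> 1 / sqrt (n + t)" using assms by (intro binomial_le_sqrt) simp
  also have "\<dots> \<le> 1 / sqrt n" using assms by (intro divide_left_mono) auto
  finally show ?case using Suc rate_Suc[of "n + t" r] by (simp add: add_divide_distrib)
qed simp

text \<open>Chernoff bound with a free tilt: \<open>1 / sqrt n\<close> serves
  \<open>degree_bound\<close>, a constant multiple of \<open>1 / sqrt M\<close> gives the polynomial
  saving in \<open>confusable_asymp\<close>.\<close>

lemma binomial_tail:
  assumes s: "0 \<le> s" "s \<le> 1"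
  shows "rate n r \<le> exp (s * (real r - n / 2) + n * s\<^sup>2 / 2)"
proof -
  have "real (binom_le n r) = (\<Sum>j\<le>r. real (n choose j))" by (simp add: binom_le_def)
  also have "\<dots> \<le> (\<Sum>j\<le>r. real (n choose j) * exp (s * (real r - real j)))"
  proof (rule sum_mono)
    fix j assume "j \<in> {..r}"
    then have "1 \<le> exp (s * (real r - real j))" using s by simp
    then have "real (n choose j) * 1 \<le> real (n choose j) * exp (s * (real r - real j))"
      by (intro mult_left_mono) auto
    then show "real (n choose j) \<le> real (n choose j) * exp (s * (real r - real j))" by simp
  qed
  also have "\<dots> \<le> (\<Sum>j\<le>max r n. real (n choose j) * exp (s * (real r - real j)))"
    by (intro sum_mono2) auto
  also have "\<dots> = (\<Sum>j\<le>n. real (n choose j) * exp (s * (real r - real j)))"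
    by (intro sum.mono_neutral_right) (auto simp: binomial_eq_0)
  also have "\<dots> = exp (s * r) * (\<Sum>j\<le>n. real (n choose j) * exp (- s) ^ j * 1 ^ (n - j))"
    unfolding sum_distrib_left by (intro sum.cong) (auto simp: algebra_simps exp_diff exp_minus exp_of_nat_mult[symmetric] field_simps)
  also have "\<dots> = exp (s * r) * (exp (- s) + 1) ^ n" by (simp only: binomial_ring[of "exp (- s)" 1 n])
  also have "\<dots> \<le> exp (s * r) * (2 * exp (- s / 2 + s\<^sup>2 / 2)) ^ n"
  proof (intro mult_left_mono power_mono)
    \<comment> \<open>\<open>exp_le_quadratic\<close> lives in the locale \<open>bsc\<close> but
      does not mention \<open>eps\<close>; 1/4 is an arbitrary admissible value.\<close>
    have "exp (- s) \<le> 1 + (- s) + (- s)\<^sup>2" using s by (intro bsc.exp_le_quadratic[of "1/4"]) (auto simp: bsc_def)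
    then have "exp (- s) + 1 \<le> 2 * (1 + (- s / 2 + s\<^sup>2 / 2))" by simp
    also have "\<dots> \<le> 2 * exp (- s / 2 + s\<^sup>2 / 2)" by (intro mult_left_mono exp_ge_add_one_self) auto
    finally show "exp (- s) + 1 \<le> 2 * exp (- s / 2 + s\<^sup>2 / 2)" .
  qed auto
  also have "\<dots> = 2 ^ n * exp (s * (real r - n / 2) + n * s\<^sup>2 / 2)"
    by (simp add: power_mult_distrib exp_of_nat_mult[symmetric] exp_add[symmetric] algebra_simps)
  finally show ?thesis by (simp add: rate_def divide_le_eq mult.commute)
qed

text \<open>The complementary binomial sum up to \<open>n - r - 1\<close> has rate at least
  \<open>eta\<close>; if \<open>r\<close> exceeded \<open>n / 2\<close> by a larger multiple of
  \<open>sqrt n\<close>, the Chernoff bound would make it smaller.\<close>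

lemma degree_bound:
  assumes "rate n r \<le> 1 - eta" "0 < eta" "0 < n"
  shows "real r \<le> n / 2 + (1 / 2 - ln eta) * sqrt n"
proof -
  have "r < n"
  proof (rule ccontr)
    assume "\<not> r < n"
    then have "(\<Sum>j\<le>n. n choose j) \<le> binom_le n r" unfolding binom_le_def by (intro sum_mono2) auto
    then have "2 ^ n \<le> binom_le n r" by (simp add: choose_row_sum)
    then have "(2::real) ^ n \<le> binom_le n r" by (metis of_nat_le_iff of_nat_numeral of_nat_power)
    then have "1 \<le> rate n r" by (simp add: rate_def)
    then show False using assms by simp
  qed
  have "binom_le n r + binom_le n (n - r - 1) = 2 ^ n"
  proof -
    have "binom_le n (n - r - 1) = (\<Sum>j\<in>{r<..n}. n choose j)"
      unfolding binom_le_def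
      by (rule sum.reindex_bij_witness[of _ "\<lambda>j. n - j" "\<lambda>j. n - j"])
         (use \<open>r < n\<close> in \<open>auto simp: binomial_symmetric[symmetric]\<close>)
    moreover have "{..n} = {..r} \<union> {r<..n}" using \<open>r < n\<close> by auto
    then have "(\<Sum>j\<le>n. n choose j) = (\<Sum>j\<le>r. n choose j) + (\<Sum>j\<in>{r<..n}. n choose j)"
      by (simp only:) (rule sum.union_disjoint, auto)
    ultimately show ?thesis by (simp add: binom_le_def choose_row_sum)
  qed
  then have "real (binom_le n r) + real (binom_le n (n - r - 1)) = 2 ^ n"
    by (metis of_nat_add of_nat_numeral of_nat_power)
  then have "rate n r + rate n (n - r - 1) = 1"
    by (simp add: rate_def flip: add_divide_distrib)
  moreover have "rate n (n - r - 1) \<le> exp (1 / sqrt n * (real (n - r - 1) - n / 2) + n * (1 / sqrt n)\<^sup>2 / 2)"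
    using assms(3) by (intro binomial_tail) auto
  ultimately have "eta \<le> exp (1 / sqrt n * (real (n - r - 1) - n / 2) + n * (1 / sqrt n)\<^sup>2 / 2)"
    using assms(1) by simp
  then have "ln eta \<le> 1 / sqrt n * (real (n - r - 1) - n / 2) + n * (1 / sqrt n)\<^sup>2 / 2"
    using assms(2) by (metis exp_gt_zero ln_exp ln_le_cancel_iff)
  also have "\<dots> \<le> 1 / sqrt n * (n / 2 - r) + 1 / 2"
  proof -
    have "real (n - r - 1) \<le> real n - real r" using \<open>r < n\<close> by simp
    then show ?thesis using assms(3) by (intro add_mono mult_left_mono) (auto simp: power_divide)
  qed
  finally have "(ln eta - 1 / 2) * sqrt n \<le> (n / 2 - r)"
    using assms(3) by (simp add: field_simps)
  then show ?thesis by (simp add: algebra_simps)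
qed


context bsc begin

lemma powr_half_power: "(1 / 2 ^ k) ^ (2 ^ (s - 1)) = (2 powr (- real k / 2)) ^ (2 ^ s)" if "1 \<le> s"
proof -
  have "(2::nat) ^ s = 2 * 2 ^ (s - 1)" using that by (simp add: power_eq_if)
  then have "(2 powr (- real k / 2)) ^ (2 ^ s) = ((2 powr (- real k / 2))\<^sup>2) ^ (2 ^ (s - 1))"
    by (simp add: power_mult)
  also have "(2 powr (- real k / 2))\<^sup>2 = 2 powr (- real k)"
    by (simp add: powr_power)
  also have "\<dots> = 1 / 2 ^ k" by (simp add: powr_minus powr_realpow field_simps)
  finally show ?thesis by simp
qed

text \<open>Here \<open>k = N\<close> is of order \<open>sqrt M\<close>, so petals lose
  \<open>4 * k\<close> dimensions and number \<open>k * k\<close>, and \<open>D = s\<close> is about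
  \<open>M powr (1/8)\<close>. Then \<open>(D + 2) ^ k\<close> is \<open>2\<close> to the power of
  order \<open>sqrt M * log M\<close>, the hypercontractive loss \<open>hyp_const ^ (D * D)\<close>
  is absorbed by \<open>2 ^ (k / 2)\<close>, and the moment order \<open>2 ^ D\<close> is at least
  \<open>log 2 M\<close>.\<close>

lemma bit_error_asymp:
  assumes eta: "0 < eta"
  shows "\<exists>c>0. \<exists>M0. \<forall>M\<ge>M0. \<forall>r. rate M r \<le> 1 - bin_entropy eps - eta \<longrightarrow>
    (\<forall>x\<in>points M. E (points M) (rm_guess M r x) \<le> 2 powr (- (c * (sqrt M * log 2 M))))"
proof -
  \<comment> \<open>At most \<open>eta / 8\<close> and at most 1/8: the first keeps the rate loss,
    bounded by \<open>6 * kap\<close>, within \<open>3/4 * eta\<close>; the second ensures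
    \<open>8 * k <= M\<close>.\<close>
  define kap where "kap = eta / (8 * (1 + eta))"
  have kap: "0 < kap" "kap \<le> eta / 8" "kap \<le> 1 / 8"
    using eta by (auto simp: kap_def field_simps)
  \<comment> \<open>The correlation that \<open>rm_post_mean\<close> guarantees for the remaining
    gap \<open>eta / 4\<close>.\<close>
  define mu0 where "mu0 = eta / 4 * ln 2"
  have mu0: "0 < mu0" using eta by (simp add: mu0_def)
  define B where "B = log 2 hyp_const"
  have B: "0 < B" using hyp_const_ge by (simp add: B_def)
  define A where "A = log 2 (4 / mu0)"
  define A' where "A' = log 2 (2 + 16 / mu0\<^sup>2)"
  have "eventually (\<lambda>x::real. A + B * x powr (1/4) \<le> kap / 8 * sqrt x) at_top"
    using kap B by real_asymp
  moreover have "eventually (\<lambda>x::real. log 2 x \<le> 2 powr (x powr (1/8) - 1)) at_top" by real_asymp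
  moreover have "eventually (\<lambda>x::real. kap / 16 * (sqrt x * log 2 x) * ln 2 \<le> mu0\<^sup>2 * kap\<^sup>2 / 64 * x) at_top"
    using kap mu0 by real_asymp
  moreover have "eventually (\<lambda>x::real. A' \<le> kap / 32 * (sqrt x * log 2 x)) at_top"
    using kap by real_asymp
  moreover have "eventually (\<lambda>x::real. 2 / kap \<le> sqrt x) at_top" using kap by real_asymp
  moreover have "eventually (\<lambda>x::real. 1 \<le> x) at_top" by real_asymp
  ultimately have "eventually (\<lambda>x::real. A + B * x powr (1/4) \<le> kap / 8 * sqrt x \<and>
     log 2 x \<le> 2 powr (x powr (1/8) - 1) \<and>
     kap / 16 * (sqrt x * log 2 x) * ln 2 \<le> mu0\<^sup>2 * kap\<^sup>2 / 64 * x \<and>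
     A' \<le> kap / 32 * (sqrt x * log 2 x) \<and> 2 / kap \<le> sqrt x \<and> 1 \<le> x) at_top"
    by (simp only: eventually_conj_iff)
  from eventually_compose_filterlim[OF this filterlim_real_sequentially]
  obtain M0 where M0: "\<And>M. M0 \<le> M \<Longrightarrow> A + B * real M powr (1/4) \<le> kap / 8 * sqrt M \<and>
     log 2 M \<le> 2 powr (real M powr (1/8) - 1) \<and>
     kap / 16 * (sqrt M * log 2 M) * ln 2 \<le> mu0\<^sup>2 * kap\<^sup>2 / 64 * M \<and>
     A' \<le> kap / 32 * (sqrt M * log 2 M) \<and> 2 / kap \<le> sqrt M \<and> 1 \<le> real M"
    by (auto simp: eventually_sequentially)
  have "E (points M) (rm_guess M r x) \<le> 2 powr (- (kap / 32 * (sqrt M * log 2 M)))"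
    if M: "M0 \<le> M" and rt: "rate M r \<le> 1 - bin_entropy eps - eta" and x: "x \<in> points M" for M r x
  proof -
    from M0[OF M] have e1: "A + B * real M powr (1/4) \<le> kap / 8 * sqrt M"
      and e2: "log 2 M \<le> 2 powr (real M powr (1/8) - 1)"
      and e3: "kap / 16 * (sqrt M * log 2 M) * ln 2 \<le> mu0\<^sup>2 * kap\<^sup>2 / 64 * M"
      and e4: "A' \<le> kap / 32 * (sqrt M * log 2 M)" and e5: "2 / kap \<le> sqrt M" and e6: "1 \<le> real M"
      by auto
    define L where "L = sqrt M * log 2 M"
    define k where "k = nat \<lfloor>kap * sqrt M\<rfloor>"
    have ks: "2 \<le> kap * sqrt M" using e5 kap(1) by (simp add: field_simps)
    have k1: "real k \<le> kap * sqrt M" using kap ks by (simp add: k_def)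
    have k2: "kap * sqrt M / 2 \<le> real k" using ks unfolding k_def by linarith
    have k0: "0 < k" using k2 ks by auto
    have sM: "sqrt M \<le> M" using e6 by (simp add: real_le_lsqrt power2_eq_square)
    have "kap * sqrt M \<le> 1 / 8 * sqrt M" using kap by (intro mult_right_mono) auto
    with k1 sM have "8 * real k \<le> real M" by simp
    then have k8: "8 * k \<le> M" by linarith
    define w where "w = M - 5 * k"
    have Mw: "M = w + k + 2 * (k + k)" using k8 by (simp add: w_def)
    define n where "n = w + k"
    have nM: "M = n + 4 * k" using Mw by (simp add: n_def)
    have n2: "real M / 2 \<le> real n" using k8 nM by linarith
    have npos: "0 < n" using n2 e6 by linarith
    have "rate n r \<le> rate M r + 4 * real k / sqrt n" using rate_shrink[OF npos, of r "4 * k"] nM by simp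
    also have "4 * real k / sqrt n \<le> 6 * kap"
    proof -
      have "2 / 3 * sqrt M \<le> sqrt n"
      proof (rule real_le_rsqrt)
        show "(2 / 3 * sqrt M)\<^sup>2 \<le> n" using n2 by (simp add: power_mult_distrib power2_eq_square)
      qed
      then have "4 * real k \<le> 6 * kap * (2 / 3 * sqrt M)" using k1 by simp
      also have "\<dots> \<le> 6 * kap * sqrt n" using \<open>2 / 3 * sqrt M \<le> sqrt n\<close> kap by (intro mult_left_mono) auto
      finally show ?thesis using npos by (simp add: divide_le_eq)
    qed
    finally have rn: "rate n r \<le> 1 - bin_entropy eps - eta / 4" using rt kap(2) by simp
    define mu where "mu = E (points (w + k) - {zero (w + k)}) (rm_post (w + k) r)"
    have "mu0 \<le> (1 - bin_entropy eps - rate n r) * ln 2"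
      unfolding mu0_def using rn by (intro mult_right_mono) auto
    also have "\<dots> \<le> mu" using rm_post_mean[of n r] by (simp add: mu_def rate_def n_def)
    finally have mu: "mu0 \<le> mu" .
    then have mu_pos: "0 < mu" using mu0 by simp
    define D where "D = nat \<lfloor>real M powr (1/8)\<rfloor>"
    have Mp: "1 \<le> real M powr (1/8)" using e6 by (simp add: ge_one_powr_ge_zero)
    have D1: "1 \<le> D" using Mp by (simp add: D_def le_nat_floor)
    have D2: "real D \<le> real M powr (1/8)" by (simp add: D_def)
    have D3: "real M powr (1/8) \<le> real D + 1" unfolding D_def using Mp by linarith
    have bound: "E (points M) (rm_guess M r x) \<le>
      (4 / mu) ^ (2 ^ D) * ((hyp_const ^ (D * D)) ^ (2 ^ D) * (1 / 2 ^ k) ^ (2 ^ (D - 1)))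
       + 16 / mu\<^sup>2 / (real D + 2) ^ k + exp (- mu\<^sup>2 / 16) ^ (k * k)"
      using x k0 D1 mu_pos by (intro bit_error_bound[OF Mw]) (auto simp: mu_def)
    have "real M powr (1/8) * real M powr (1/8) = real M powr (1/4)" by (simp flip: powr_add)
    moreover have "real D * real D \<le> real M powr (1/8) * real M powr (1/8)"
      using D2 by (intro mult_mono) auto
    ultimately have DD: "real (D * D) \<le> real M powr (1/4)" by simp
    have T1: "(4 / mu) ^ (2 ^ D) * ((hyp_const ^ (D * D)) ^ (2 ^ D) * (1 / 2 ^ k) ^ (2 ^ (D - 1))) \<le> 2 powr (- (kap / 16 * L))"
    proof -
      let ?b = "4 / mu * (hyp_const ^ (D * D) * 2 powr (- real k / 2))"
      have "?b \<le> 2 powr A * (2 powr (B * real M powr (1/4)) * 2 powr (- (kap * sqrt M / 4)))"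
      proof (intro mult_mono)
        have "4 / mu \<le> 4 / mu0" using mu mu0 by (intro divide_left_mono) auto
        then show "4 / mu \<le> 2 powr A" using mu0 by (simp add: A_def)
        have "hyp_const ^ (D * D) = 2 powr (B * real (D * D))"
          using hyp_const_ge by (simp add: B_def powr_powr[symmetric] powr_realpow power_mult)
        also have "\<dots> \<le> 2 powr (B * real M powr (1/4))" using DD B by simp
        finally show "hyp_const ^ (D * D) \<le> 2 powr (B * real M powr (1/4))" .
        show "2 powr (- real k / 2) \<le> 2 powr (- (kap * sqrt M / 4))" using k2 by simp
      qed (use hyp_const_ge mu_pos in auto)
      also have "\<dots> = 2 powr (A + B * real M powr (1/4) - kap * sqrt M / 4)"
        by (simp add: powr_add[symmetric] add_diff_eq)
      also have "\<dots> \<le> 2 powr (- (kap / 8 * sqrt M))" using e1 by simp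
      finally have b: "?b \<le> 2 powr (- (kap / 8 * sqrt M))" .
      have b0: "0 \<le> ?b" using hyp_const_ge mu_pos by simp
      have "log 2 M \<le> 2 powr (real D)"
      proof -
        have "2 powr (real M powr (1/8) - 1) \<le> 2 powr (real D)" using D3 by simp
        with e2 show ?thesis by (rule order_trans)
      qed
      then have p: "log 2 M \<le> 2 ^ D" by (simp add: powr_realpow)
      have "(4 / mu) ^ (2 ^ D) * ((hyp_const ^ (D * D)) ^ (2 ^ D) * (1 / 2 ^ k) ^ (2 ^ (D - 1))) = ?b ^ (2 ^ D)"
        unfolding powr_half_power[OF D1] by (simp only: power_mult_distrib)
      also have "\<dots> \<le> (2 powr (- (kap / 8 * sqrt M))) ^ (2 ^ D)" using b b0 by (rule power_mono)
      also have "\<dots> = 2 powr (- (kap / 8 * sqrt M) * 2 ^ D)" by (simp add: powr_power mult_ac)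
      also have "\<dots> \<le> 2 powr (- (kap / 16 * L))"
      proof -
        have "kap / 16 * L \<le> kap / 8 * L" using kap e6 by (intro mult_right_mono) (auto simp: L_def)
        also have "\<dots> = kap / 8 * sqrt M * log 2 M" by (simp add: L_def)
        also have "\<dots> \<le> kap / 8 * sqrt M * 2 ^ D" using p kap by (intro mult_left_mono) auto
        finally show ?thesis by simp
      qed
      finally show ?thesis .
    qed
    have T2: "16 / mu\<^sup>2 / (real D + 2) ^ k \<le> 16 / mu0\<^sup>2 * 2 powr (- (kap / 16 * L))"
    proof -
      have "(real M powr (1/8)) ^ k \<le> (real D + 2) ^ k" using D3 by (intro power_mono) auto
      moreover have "(real M powr (1/8)) ^ k = 2 powr (real k / 8 * log 2 M)"
        using e6 by (simp add: powr_realpow[symmetric] powr_powr log_def powr_def)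
      moreover have "2 powr (kap / 16 * L) \<le> 2 powr (real k / 8 * log 2 M)"
      proof -
        have "kap / 16 * L = (kap * sqrt M / 2) / 8 * log 2 M" by (simp add: L_def)
        also have "\<dots> \<le> real k / 8 * log 2 M" using k2 e6 by (intro mult_right_mono divide_right_mono) auto
        finally show ?thesis by simp
      qed
      ultimately have d: "2 powr (kap / 16 * L) \<le> (real D + 2) ^ k" by linarith
      have "16 / mu\<^sup>2 \<le> 16 / mu0\<^sup>2" using mu mu0 by (intro divide_left_mono power_mono) auto
      then have "16 / mu\<^sup>2 / (real D + 2) ^ k \<le> 16 / mu0\<^sup>2 / 2 powr (kap / 16 * L)"
        by (rule frac_le[OF _ _ _ d, rotated]) auto
      then show ?thesis by (simp only: powr_minus_divide times_divide_eq_right mult_1_right)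
    qed
    have T3: "exp (- mu\<^sup>2 / 16) ^ (k * k) \<le> 2 powr (- (kap / 16 * L))"
    proof -
      have "kap / 16 * L * ln 2 \<le> mu0\<^sup>2 * kap\<^sup>2 / 64 * M" using e3 by (simp add: L_def)
      also have "\<dots> = mu0\<^sup>2 * (kap * sqrt M / 2)\<^sup>2 / 16" by (simp add: power_mult_distrib power_divide)
      also have "\<dots> \<le> mu\<^sup>2 * (real k)\<^sup>2 / 16"
        using mu mu0 k2 kap by (intro divide_right_mono mult_mono power_mono) auto
      finally have "- (mu\<^sup>2 * (real k)\<^sup>2 / 16) \<le> - (kap / 16 * L) * ln 2" by simp
      then have "exp (- (mu\<^sup>2 * (real k)\<^sup>2 / 16)) \<le> exp (- (kap / 16 * L) * ln 2)" by (simp only: exp_le_cancel_iff)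
      moreover have "exp (- mu\<^sup>2 / 16) ^ (k * k) = exp (- (mu\<^sup>2 * (real k)\<^sup>2 / 16))"
        by (simp add: exp_of_nat_mult[symmetric] power2_eq_square)
      ultimately show ?thesis by (simp add: powr_def)
    qed
    have "E (points M) (rm_guess M r x) \<le> (2 + 16 / mu0\<^sup>2) * 2 powr (- (kap / 16 * L))"
      using bound T1 T2 T3 by (simp add: algebra_simps)
    also have "2 + 16 / mu0\<^sup>2 = 2 powr A'" by (simp add: A'_def add_pos_nonneg)
    also have "2 powr A' * 2 powr (- (kap / 16 * L)) = 2 powr (A' - kap / 16 * L)" by (simp add: powr_add[symmetric])
    also have "\<dots> \<le> 2 powr (- (kap / 32 * L))" using e4 by (simp add: L_def)
    finally show ?thesis by (simp add: L_def)
  qed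
  then show ?thesis using kap(1) by (intro exI[of _ "kap / 32"] conjI exI[of _ M0]) auto
qed

end


subsection \<open>Light codewords\<close>

definition lin_map :: "nat \<Rightarrow> nat \<Rightarrow> (nat \<Rightarrow> point) \<Rightarrow> point \<Rightarrow> point" where
  "lin_map n l u t = map (\<lambda>j. ip l (u j) t) [0..<n]"

lemma lin_map_nth [simp]: "j < n \<Longrightarrow> lin_map n l u t ! j = ip l (u j) t"
  by (simp add: lin_map_def)

lemma lin_map_points [simp]: "lin_map n l u t \<in> points n"
  by (simp add: lin_map_def points_def)

lemma ip_xlate: "l \<le> k \<Longrightarrow> ip l a (xlate k x y) = (ip l a x \<noteq> ip l a y)"
  by (induction l) auto

abbreviation matrices :: "nat \<Rightarrow> nat \<Rightarrow> (nat \<Rightarrow> point) set" where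
  "matrices n l \<equiv> PiE {..<n} (\<lambda>_. points l)"

text \<open>A uniform random matrix sends a fixed nonzero \<open>d\<close> to a uniform point:
  \<open>ip_solutions\<close> for the origin and \<open>d\<close> leaves half of the choices for
  each row.\<close>

lemma card_lin_map_fibre:
  assumes d: "d \<in> points l" "d \<noteq> zero l" and p: "p \<in> points n"
  shows "card {u \<in> matrices n l. lin_map n l u d = p} * 2 ^ n \<le> card (matrices n l)"
proof -
  define R where "R = (\<lambda>j. {a \<in> points l. ip l a d = p ! j})"
  have R: "card (R j) * 2 \<le> 2 ^ l" for j
  proof -
    have "card (R j) * card {zero l, d} \<le> 2 ^ l"
    proof (rule ip_solutions[where h = "\<lambda>x. x = d \<and> p ! j"])
      fix a x assume "a \<in> R j" "x \<in> {zero l, d}"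
      then show "ip l a x = (x = d \<and> p ! j)" using d(2) by (auto simp: R_def ip_zero)
    qed (use d in \<open>auto simp: R_def\<close>)
    then show ?thesis using d(2) by simp
  qed
  have "{u \<in> matrices n l. lin_map n l u d = p} \<subseteq> PiE {..<n} R"
  proof
    fix u assume u: "u \<in> {u \<in> matrices n l. lin_map n l u d = p}"
    have "ip l (u j) d = p ! j" if "j < n" for j
      using u lin_map_nth[OF that, of l u d] by simp
    then show "u \<in> PiE {..<n} R" using u by (auto simp: PiE_iff R_def)
  qed
  then have "card {u \<in> matrices n l. lin_map n l u d = p} \<le> card (PiE {..<n} R)"
    by (intro card_mono finite_PiE) (auto simp: R_def)
  then have "card {u \<in> matrices n l. lin_map n l u d = p} * 2 ^ n \<le> (\<Prod>j<n. card (R j)) * 2 ^ n"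
    by (intro mult_right_mono) (auto simp: card_PiE)
  also have "\<dots> = (\<Prod>j<n. card (R j) * 2)" by (simp only: prod.distrib) simp
  also have "\<dots> \<le> (\<Prod>j<n. 2 ^ l)" using R by (intro prod_mono) auto
  finally show ?thesis by (simp add: card_PiE)
qed

lemma card_lin_map_hits:
  assumes d: "d \<in> points l" "d \<noteq> zero l" and P: "P \<subseteq> points n" and x: "x \<in> points n"
  shows "card {u \<in> matrices n l. xlate n x (lin_map n l u d) \<in> P} * 2 ^ n \<le> card P * card (matrices n l)"
proof -
  have fin: "finite (matrices n l)" by (intro finite_PiE) auto
  have finP: "finite P" by (rule finite_subset[OF P]) simp
  have "{u \<in> matrices n l. xlate n x (lin_map n l u d) \<in> P} \<subseteq> (\<Union>p\<in>P. {u \<in> matrices n l. lin_map n l u d = xlate n x p})"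
  proof
    fix u assume u: "u \<in> {u \<in> matrices n l. xlate n x (lin_map n l u d) \<in> P}"
    have "lin_map n l u d = xlate n x (xlate n x (lin_map n l u d))"
      by (rule xlate_xlate[symmetric]) simp
    then show "u \<in> (\<Union>p\<in>P. {u \<in> matrices n l. lin_map n l u d = xlate n x p})" using u by blast
  qed
  then have "card {u \<in> matrices n l. xlate n x (lin_map n l u d) \<in> P} \<le> card (\<Union>p\<in>P. {u \<in> matrices n l. lin_map n l u d = xlate n x p})"
    using fin finP by (intro card_mono finite_UN_I) auto
  also have "\<dots> \<le> (\<Sum>p\<in>P. card {u \<in> matrices n l. lin_map n l u d = xlate n x p})"
    by (rule card_UN_le[OF finP])
  finally have "card {u \<in> matrices n l. xlate n x (lin_map n l u d) \<in> P} * 2 ^ n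
    \<le> (\<Sum>p\<in>P. card {u \<in> matrices n l. lin_map n l u d = xlate n x p} * 2 ^ n)"
    by (simp add: sum_distrib_right[symmetric])
  also have "\<dots> \<le> (\<Sum>p\<in>P. card (matrices n l))"
    by (intro sum_mono card_lin_map_fibre[OF d]) simp
  finally show ?thesis by simp
qed

text \<open>\<open>cube_sum n l f u\<close> is the derivative of \<open>f\<close> along \<open>l\<close> directions complementing the first
  \<open>n\<close> coordinates; it is a function of \<open>n\<close> variables only, evaluated along the projection with
  these directions.\<close>
definition cube_sum :: "nat \<Rightarrow> nat \<Rightarrow> word \<Rightarrow> (nat \<Rightarrow> point) \<Rightarrow> word" where
  "cube_sum n l f u = (\<lambda>z. z \<in> points n \<and> odd (card {t \<in> points l. f (xlate n z (lin_map n l u t) @ t)}))"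

text \<open>The affine map \<open>T\<close> straightens the directions to the last \<open>l\<close>
  coordinates, where the cube becomes a face.\<close>

lemma cube_sum_RM:
  assumes f: "f \<in> RM (n + l) r"
  shows "l \<le> r \<Longrightarrow> cube_sum n l f u \<in> RM n (r - l)" "r < l \<Longrightarrow> cube_sum n l f u = (\<lambda>_. False)"
proof -
  define T where "T = (\<lambda>x. map (\<lambda>i. if i < n then x ! i \<noteq> ip l (u i) (drop n x) else x ! i) [0..<n + l])"
  have Tp: "T x \<in> points (n + l)" for x by (simp add: T_def points_def)
  have Ti: "T x ! i = (if i < n then x ! i \<noteq> ip l (u i) (drop n x) else x ! i)" if "i < n + l" for i x
    using that by (simp add: T_def)
  have aff: "(\<lambda>x. x \<in> points (n + l) \<and> T x ! i) \<in> RM (n + l) 1" if i: "i < n + l" for i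
  proof (cases "i < n")
    case True
    have "(\<lambda>x. x \<in> points (n + l) \<and> T x ! i) =
      wxor (\<lambda>x. x \<in> points (n + l) \<and> x ! i) (\<lambda>x. x \<in> points (n + l) \<and> ip l (u i) (drop n x))"
      using True Ti[OF i] by (auto simp: fun_eq_iff)
    moreover have "(\<lambda>x. x \<in> points (n + l) \<and> ip l (u i) (drop n x)) \<in> RM (n + l) 1"
    proof (rule RM_ip)
      fix j assume j: "j < l"
      have "(\<lambda>x. x \<in> points (n + l) \<and> drop n x ! j) = (\<lambda>x. x \<in> points (n + l) \<and> x ! (n + j))"
        by (auto simp: points_def fun_eq_iff)
      then show "(\<lambda>x. x \<in> points (n + l) \<and> drop n x ! j) \<in> RM (n + l) 1"
        using RM_coord[of "n + j" "n + l" 1] j by simp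
    qed
    ultimately show ?thesis using RM_coord[of i "n + l" 1] i by (auto intro!: RM_xor)
  next
    case False
    then show ?thesis using RM_coord[of i "n + l" 1] i Ti[OF i] by simp
  qed
  define g where "g = (\<lambda>x. x \<in> points (n + l) \<and> f (T x))"
  have g: "g \<in> RM (n + l) r" unfolding g_def by (rule RM_comp[OF f Tp aff])
  have gz: "g (z @ t) = f (xlate n z (lin_map n l u t) @ t)" if "z \<in> points n" "t \<in> points l" for z t
  proof -
    have "T (z @ t) = xlate n z (lin_map n l u t) @ t"
    proof (rule points_eqI[OF Tp])
      show "xlate n z (lin_map n l u t) @ t \<in> points (n + l)"
        using that(2) xlate_points[of n z "lin_map n l u t"] by (simp add: points_def)
      fix i assume i: "i < n + l"
      show "T (z @ t) ! i = (xlate n z (lin_map n l u t) @ t) ! i"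
        using that i xlate_points[of n z "lin_map n l u t"] by (simp add: Ti points_def nth_append)
    qed
    moreover have "z @ t \<in> points (n + l)" using that by (simp add: points_def)
    ultimately show ?thesis by (simp add: g_def)
  qed
  have eq: "cube_sum n l f u = (\<lambda>z. z \<in> points n \<and> odd (card {t \<in> points l. g (z @ t)}))"
  proof (rule ext)
    fix z
    have "{t \<in> points l. g (z @ t)} = {t \<in> points l. f (xlate n z (lin_map n l u t) @ t)}" if "z \<in> points n"
      using gz[OF that] by auto
    then show "cube_sum n l f u z = (z \<in> points n \<and> odd (card {t \<in> points l. g (z @ t)}))"
      by (auto simp: cube_sum_def)
  qed
  show "l \<le> r \<Longrightarrow> cube_sum n l f u \<in> RM n (r - l)" "r < l \<Longrightarrow> cube_sum n l f u = (\<lambda>_. False)"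
    using RM_sum_last_many[OF g] unfolding eq by auto
qed

definition estimate :: "nat \<Rightarrow> nat \<Rightarrow> (nat \<Rightarrow> point) \<Rightarrow> word \<Rightarrow> word" where
  "estimate n l u G x = G (xlate n (take n x) (lin_map n l u (drop n x)))"

text \<open>The estimate is the parity of \<open>f\<close> over an affine cube through
  \<open>x\<close>, so it fails only if another point of the cube lies in the support of
  \<open>f\<close>. For random directions the first \<open>n\<close> coordinates of each other point
  are uniform, and the expected number of such hits is at most the weight of \<open>f\<close>
  divided by \<open>2 ^ n\<close>, hence 1/16.\<close>

lemma estimate_wrong:
  assumes x: "x \<in> points (n + l)" and out: "\<And>x. x \<notin> points (n + l) \<Longrightarrow> \<not> f x"
    and small: "card {x \<in> points (n + l). f x} * 16 \<le> 2 ^ n"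
  shows "card {u \<in> matrices n l. estimate n l u (cube_sum n l f u) x \<noteq> f x} * 16 \<le> card (matrices n l)"
proof -
  define y t0 where "y = take n x" "t0 = drop n x"
  have y: "y \<in> points n" "t0 \<in> points l" "x = y @ t0" using x by (auto simp: y_t0_def points_def)
  have fin: "finite (matrices n l)" by (intro finite_PiE) auto
  define P where "P = (\<lambda>t. {z \<in> points n. f (z @ t)})"
  let ?d = "\<lambda>t. xlate l t0 t"
  have val: "estimate n l u (cube_sum n l f u) x = odd (card {t \<in> points l. f (xlate n y (lin_map n l u (?d t)) @ t)})" for u
  proof -
    have "xlate n (xlate n y (lin_map n l u t0)) (lin_map n l u t) = xlate n y (lin_map n l u (?d t))" for t
      by (rule points_eqI[of _ n]) (auto simp: ip_xlate)
    then show ?thesis by (simp add: estimate_def cube_sum_def y_t0_def)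
  qed
  have t0: "xlate n y (lin_map n l u (?d t0)) = y" for u
  proof (rule points_eqI[of _ n])
    fix j assume "j < n"
    have "ip l (u j) (xlate l t0 t0) = False" by (simp add: ip_xlate)
    then show "xlate n y (lin_map n l u (?d t0)) ! j = y ! j" using \<open>j < n\<close> by simp
  qed (use y in auto)
  have "{u \<in> matrices n l. estimate n l u (cube_sum n l f u) x \<noteq> f x} \<subseteq>
    (\<Union>t\<in>points l - {t0}. {u \<in> matrices n l. xlate n y (lin_map n l u (?d t)) \<in> P t})"
  proof
    fix u assume u: "u \<in> {u \<in> matrices n l. estimate n l u (cube_sum n l f u) x \<noteq> f x}"
    show "u \<in> (\<Union>t\<in>points l - {t0}. {u \<in> matrices n l. xlate n y (lin_map n l u (?d t)) \<in> P t})"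
    proof (rule ccontr)
      assume "u \<notin> (\<Union>t\<in>points l - {t0}. {u \<in> matrices n l. xlate n y (lin_map n l u (?d t)) \<in> P t})"
      then have no: "\<not> f (xlate n y (lin_map n l u (?d t)) @ t)" if "t \<in> points l" "t \<noteq> t0" for t
        using that u by (auto simp: P_def)
      then have eq: "{t \<in> points l. f (xlate n y (lin_map n l u (?d t)) @ t)} = (if f x then {t0} else {})"
      proof -
        have "f (xlate n y (lin_map n l u (?d t)) @ t) = (t = t0 \<and> f x)" if "t \<in> points l" for t
          using no[OF that] t0[of u] y(3) by (cases "t = t0") auto
        then show ?thesis using y(2) by auto
      qed
      have "estimate n l u (cube_sum n l f u) x = f x" unfolding val eq by (cases "f x") simp_all
      then show False using u by simp
    qed
  qed
  then have "card {u \<in> matrices n l. estimate n l u (cube_sum n l f u) x \<noteq> f x} \<le>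
    card (\<Union>t\<in>points l - {t0}. {u \<in> matrices n l. xlate n y (lin_map n l u (?d t)) \<in> P t})"
    using fin by (intro card_mono finite_UN_I) auto
  also have "\<dots> \<le> (\<Sum>t\<in>points l - {t0}. card {u \<in> matrices n l. xlate n y (lin_map n l u (?d t)) \<in> P t})"
    by (rule card_UN_le) simp
  finally have "card {u \<in> matrices n l. estimate n l u (cube_sum n l f u) x \<noteq> f x} * 2 ^ n \<le>
    (\<Sum>t\<in>points l - {t0}. card {u \<in> matrices n l. xlate n y (lin_map n l u (?d t)) \<in> P t} * 2 ^ n)"
    by (simp add: sum_distrib_right[symmetric])
  also have "\<dots> \<le> (\<Sum>t\<in>points l - {t0}. card (P t) * card (matrices n l))"
  proof (intro sum_mono card_lin_map_hits)
    fix t assume t: "t \<in> points l - {t0}"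
    show "?d t \<noteq> zero l"
    proof
      assume "?d t = zero l"
      then have "xlate l t0 (xlate l t0 t) = xlate l t0 (zero l)" by simp
      then show False using t y xlate_xlate[of t l t0] xlate_zero[of t0 l] by simp
    qed
  qed (use y in \<open>auto simp: P_def\<close>)
  also have "\<dots> \<le> (\<Sum>t\<in>points l. card (P t)) * card (matrices n l)"
    unfolding sum_distrib_right by (intro sum_mono2) auto
  also have "(\<Sum>t\<in>points l. card (P t)) = card (SIGMA t:points l. P t)"
    by (simp add: P_def)
  also have "\<dots> \<le> card {x \<in> points (n + l). f x}"
  proof (rule card_inj_on_le[of "\<lambda>(t, z). z @ t"])
    show "inj_on (\<lambda>(t, z). z @ t) (SIGMA t:points l. P t)"
      by (auto simp: inj_on_def P_def points_def)
    show "(\<lambda>(t, z). z @ t) ` (SIGMA t:points l. P t) \<subseteq> {x \<in> points (n + l). f x}"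
      by (auto simp: P_def points_def)
  qed simp
  finally have "card {u \<in> matrices n l. estimate n l u (cube_sum n l f u) x \<noteq> f x} * 2 ^ n
     \<le> card {x \<in> points (n + l). f x} * card (matrices n l)" by simp
  then have "card {u \<in> matrices n l. estimate n l u (cube_sum n l f u) x \<noteq> f x} * 16 * 2 ^ n
     \<le> card {x \<in> points (n + l). f x} * 16 * card (matrices n l)" by simp
  also have "\<dots> \<le> 2 ^ n * card (matrices n l)" using small by (rule mult_right_mono) simp
  finally show ?thesis by (simp add: mult.commute)
qed

text \<open>Derandomised choice of directions: the potential \<open>\<Sum>x. 9 ^ (number of wrong estimates at x)\<close>
  grows by a factor of at most 3/2 per step.\<close>
lemma majority_directions:
  assumes fin: "finite X" and U: "finite U" "U \<noteq> {}"
    and bad: "\<And>x. x \<in> X \<Longrightarrow> card {u \<in> U. bad u x} * 16 \<le> card U"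
  shows "\<exists>us. length us = t \<and> set us \<subseteq> U \<and> (\<Sum>x\<in>X. 9 ^ length (filter (\<lambda>u. bad u x) us)) \<le> card X * (3 / 2 :: real) ^ t"
proof (induction t)
  case 0 then show ?case by simp
next
  case (Suc t)
  then obtain us where us: "length us = t" "set us \<subseteq> U"
    "(\<Sum>x\<in>X. 9 ^ length (filter (\<lambda>u. bad u x) us)) \<le> card X * (3 / 2 :: real) ^ t" by auto
  let ?w = "\<lambda>x. 9 ^ length (filter (\<lambda>u. bad u x) us) :: real"
  have "\<exists>u\<in>U. (\<Sum>x\<in>X. ?w x * (1 + 8 * of_bool (bad u x))) \<le> (3 / 2) * (\<Sum>x\<in>X. ?w x)"
  proof (rule ccontr)
    assume "\<not> ?thesis"
    then have "(\<Sum>u\<in>U. (3 / 2) * (\<Sum>x\<in>X. ?w x)) < (\<Sum>u\<in>U. \<Sum>x\<in>X. ?w x * (1 + 8 * of_bool (bad u x)))"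
      using U by (intro sum_strict_mono) (auto simp: not_le)
    also have "\<dots> = (\<Sum>x\<in>X. \<Sum>u\<in>U. ?w x * (1 + 8 * of_bool (bad u x)))" by (rule sum.swap)
    also have "\<dots> = (\<Sum>x\<in>X. ?w x * (card U + 8 * card {u \<in> U. bad u x}))"
      using U by (simp add: sum_distrib_left[symmetric] sum.distrib sum_of_bool_eq Int_def)
    also have "\<dots> \<le> (\<Sum>x\<in>X. ?w x * (3 / 2 * card U))"
    proof (intro sum_mono mult_left_mono)
      fix x assume "x \<in> X"
      from bad[OF this] have "real (card {u \<in> U. bad u x}) * 16 \<le> card U"
        by (metis of_nat_le_iff of_nat_mult of_nat_numeral)
      then show "real (card U + 8 * card {u \<in> U. bad u x}) \<le> 3 / 2 * card U" by simp
    qed auto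
    also have "\<dots> = (\<Sum>u\<in>U. (3 / 2) * (\<Sum>x\<in>X. ?w x))"
      by (simp add: sum_distrib_left sum_distrib_right mult_ac)
    finally show False by simp
  qed
  then obtain u where u: "u \<in> U" "(\<Sum>x\<in>X. ?w x * (1 + 8 * of_bool (bad u x))) \<le> (3 / 2) * (\<Sum>x\<in>X. ?w x)" by auto
  have "(\<Sum>x\<in>X. 9 ^ length (filter (\<lambda>u. bad u x) (u # us))) = (\<Sum>x\<in>X. ?w x * (1 + 8 * of_bool (bad u x)))"
    by (intro sum.cong) auto
  also have "\<dots> \<le> (3 / 2) * (card X * (3 / 2) ^ t)" using u(2) us(3) by simp
  finally show ?case using us u(1) by (intro exI[of _ "u # us"]) auto
qed

definition majority :: "nat \<Rightarrow> nat \<Rightarrow> ((nat \<Rightarrow> point) \<times> word) list \<Rightarrow> word" where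
  "majority n l ps = (\<lambda>x. x \<in> points (n + l) \<and> length ps < 2 * length (filter (\<lambda>(u, G). estimate n l u G x) ps))"

text \<open>A point at which at least half of the \<open>t = n + l + 1\<close> estimates fail would
  alone contribute \<open>3 ^ t\<close> to the potential, which is below
  \<open>2 ^ t * (3 / 2) ^ t\<close>. So one choice of directions makes the majority correct
  everywhere; the base 9 is chosen for this balance.\<close>

lemma light_codeword:
  assumes f: "f \<in> RM (n + l) r" and small: "card {x \<in> points (n + l). f x} * 16 \<le> 2 ^ n"
  shows "\<exists>us. length us = n + l + 1 \<and> set us \<subseteq> matrices n l \<and> f = majority n l (map (\<lambda>u. (u, cube_sum n l f u)) us)"
proof -
  let ?t = "n + l + 1"
  let ?bad = "\<lambda>u x. estimate n l u (cube_sum n l f u) x \<noteq> f x"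
  have out: "\<And>x. x \<notin> points (n + l) \<Longrightarrow> \<not> f x" using RM_outside[OF f] by auto
  have fin: "finite (matrices n l)" by (intro finite_PiE) auto
  have ne: "matrices n l \<noteq> {}" using zero_points[of l] unfolding PiE_eq_empty_iff by blast
  have "\<exists>us. length us = ?t \<and> set us \<subseteq> matrices n l \<and>
    (\<Sum>x\<in>points (n + l). 9 ^ length (filter (\<lambda>u. ?bad u x) us)) \<le> card (points (n + l)) * (3 / 2 :: real) ^ ?t"
    by (rule majority_directions[OF finite_points fin ne]) (rule estimate_wrong[OF _ out small])
  then obtain us where us: "length us = ?t" "set us \<subseteq> matrices n l"
    "(\<Sum>x\<in>points (n + l). 9 ^ length (filter (\<lambda>u. ?bad u x) us)) \<le> card (points (n + l)) * (3 / 2 :: real) ^ ?t"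
    by (elim exE conjE)
  have few: "2 * length (filter (\<lambda>u. ?bad u x) us) < ?t" if x: "x \<in> points (n + l)" for x
  proof (rule ccontr)
    let ?c = "length (filter (\<lambda>u. ?bad u x) us)"
    assume "\<not> 2 * ?c < ?t"
    then have "(3::real) ^ ?t \<le> 3 ^ (2 * ?c)" by (intro power_increasing) auto
    also have "\<dots> = 9 ^ ?c" by (simp add: power_mult)
    also have "\<dots> \<le> (\<Sum>x\<in>points (n + l). 9 ^ length (filter (\<lambda>u. ?bad u x) us))"
      using x by (intro member_le_sum[of x _ "\<lambda>x. 9 ^ length (filter (\<lambda>u. ?bad u x) us)"]) auto
    also have "\<dots> \<le> 2 ^ (n + l) * (3 / 2) ^ ?t" using us(3) by simp
    also have "\<dots> < 2 ^ ?t * (3 / 2) ^ ?t" by (intro mult_strict_right_mono) auto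
    also have "\<dots> = 3 ^ ?t" by (simp add: power_mult_distrib[symmetric])
    finally show False by simp
  qed
  have "f = majority n l (map (\<lambda>u. (u, cube_sum n l f u)) us)"
  proof (rule ext)
    fix x
    show "f x = majority n l (map (\<lambda>u. (u, cube_sum n l f u)) us) x"
    proof (cases "x \<in> points (n + l)")
      case False
      then show ?thesis using out by (simp add: majority_def)
    next
      case True
      have "length (filter (\<lambda>u. ?bad u x) us) + length (filter (\<lambda>u. \<not> ?bad u x) us) = ?t"
        using sum_length_filter_compl[of "\<lambda>u. ?bad u x" us] us(1) by simp
      then show ?thesis using few[OF True] True us(1)
        by (cases "f x") (auto simp: majority_def filter_map o_def)
    qed
  qed
  then show ?thesis using us by blast
qed

text \<open>The list of directions and derivatives determines the codeword, and the derivatives come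
  from a code of much smaller dimension, so it suffices to count lists.\<close>

lemma light_codewords_count:
  assumes "l \<le> r"
  shows "card {f \<in> RM (n + l) r. card {x \<in> points (n + l). f x} * 16 \<le> 2 ^ n}
     \<le> (2 ^ (l * n) * 2 ^ binom_le n (r - l)) ^ (n + l + 1)"
proof -
  let ?F = "{f \<in> RM (n + l) r. card {x \<in> points (n + l). f x} * 16 \<le> 2 ^ n}"
  let ?Q = "matrices n l \<times> RM n (r - l)"
  let ?L = "{ps. set ps \<subseteq> ?Q \<and> length ps = n + l + 1}"
  have fin: "finite ?Q" using RM_card(1) by (intro finite_cartesian_product finite_PiE) auto
  have "?F \<subseteq> majority n l ` ?L"
  proof
    fix f assume "f \<in> ?F"
    then have f: "f \<in> RM (n + l) r" "card {x \<in> points (n + l). f x} * 16 \<le> 2 ^ n" by auto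
    obtain us where us: "length us = n + l + 1" "set us \<subseteq> matrices n l" "f = majority n l (map (\<lambda>u. (u, cube_sum n l f u)) us)"
      using light_codeword[OF f] by auto
    show "f \<in> majority n l ` ?L"
    proof (rule image_eqI[where x = "map (\<lambda>u. (u, cube_sum n l f u)) us"])
      show "f = majority n l (map (\<lambda>u. (u, cube_sum n l f u)) us)" by (rule us(3))
      show "map (\<lambda>u. (u, cube_sum n l f u)) us \<in> ?L"
        using us(1,2) cube_sum_RM(1)[OF f(1) assms] by auto
    qed
  qed
  then have "card ?F \<le> card ?L" using finite_lists_length_eq[OF fin] by (rule surj_card_le[rotated])
  also have "\<dots> = card ?Q ^ (n + l + 1)" by (rule card_lists_length_eq[OF fin])
  also have "\<dots> \<le> (2 ^ (l * n) * 2 ^ binom_le n (r - l)) ^ (n + l + 1)"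
  proof (rule power_mono)
    have "card ?Q = 2 ^ (l * n) * card (RM n (r - l))" by (simp add: card_cartesian_product card_PiE power_mult)
    then show "card ?Q \<le> 2 ^ (l * n) * 2 ^ binom_le n (r - l)" using RM_card(2)[of n "r - l"] by simp
  qed simp
  finally show ?thesis .
qed

text \<open>A weak minimum distance bound: derivatives of order above the degree vanish, and so does
  their majority.\<close>

lemma light_codeword_zero:
  assumes "r < l" "f \<in> RM (n + l) r" "card {x \<in> points (n + l). f x} * 16 \<le> 2 ^ n"
  shows "f = (\<lambda>_. False)"
proof -
  obtain us where us: "length us = n + l + 1" "f = majority n l (map (\<lambda>u. (u, cube_sum n l f u)) us)"
    using light_codeword[OF assms(2,3)] by auto
  have "filter (\<lambda>(u, G). estimate n l u G x) (map (\<lambda>u. (u, cube_sum n l f u)) us) = []" for x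
    using cube_sum_RM(2)[OF assms(2,1)] by (simp add: filter_map o_def estimate_def)
  then have "majority n l (map (\<lambda>u. (u, cube_sum n l f u)) us) = (\<lambda>_. False)"
    by (simp add: majority_def)
  then show ?thesis using us(2) by simp
qed


lemma light_RMs_count:
  assumes "l \<le> r" "l \<le> M"
  shows "card {S \<in> RMs M r. card S * 16 \<le> 2 ^ (M - l)} \<le> 2 ^ ((M + 1) * (l * (M - l) + binom_le (M - l) (r - l)))"
proof -
  have M: "M - l + l = M" using assms by simp
  have "{S \<in> RMs M r. card S * 16 \<le> 2 ^ (M - l)} = Collect ` {f \<in> RM M r. card {x \<in> points M. f x} * 16 \<le> 2 ^ (M - l)}"
  proof -
    have "{x \<in> points M. f x} = Collect f" if "f \<in> RM M r" for f using RM_outside[OF that] by auto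
    then show ?thesis by (auto simp: RMs_def)
  qed
  then have "card {S \<in> RMs M r. card S * 16 \<le> 2 ^ (M - l)} = card {f \<in> RM M r. card {x \<in> points M. f x} * 16 \<le> 2 ^ (M - l)}"
    by (simp only:) (rule card_image, auto simp: inj_on_def)
  also have "\<dots> \<le> (2 ^ (l * (M - l)) * 2 ^ binom_le (M - l) (r - l)) ^ (M + 1)"
    using light_codewords_count[OF assms(1), of "M - l"] M by simp
  also have "\<dots> = 2 ^ ((M + 1) * (l * (M - l) + binom_le (M - l) (r - l)))"
    by (simp only: power_add[symmetric] power_mult[symmetric] mult.commute)
  finally show ?thesis .
qed

lemma light_RMs_zero:
  assumes "r < l" "l \<le> M" "S \<in> RMs M r" "card S * 16 \<le> 2 ^ (M - l)"
  shows "S = {}"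
proof -
  have M: "M - l + l = M" using assms by simp
  have "S \<subseteq> points M" using assms RMs_sub by auto
  then have "{x \<in> points M. x \<in> S} = S" by auto
  then have "(\<lambda>x. x \<in> S) = (\<lambda>_. False)"
    using light_codeword_zero[OF assms(1), of "\<lambda>x. x \<in> S" "M - l"] assms M by (simp add: in_RMs)
  then show ?thesis by (auto simp: fun_eq_iff)
qed

text \<open>The largest admissible \<open>l\<close> places the weight \<open>c\<close> within a
  factor 2 of the threshold \<open>2 ^ (M - l) / 16\<close>.\<close>

lemma dyadic_level:
  assumes "0 < c" "c * 16 * 2 ^ l0 \<le> (2::nat) ^ M"
  shows "\<exists>l\<ge>l0. l \<le> M \<and> c * 16 \<le> 2 ^ (M - l) \<and> 2 ^ (M - l) \<le> c * 32"
proof -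
  let ?P = "\<lambda>l. c * 16 * 2 ^ l \<le> (2::nat) ^ M"
  have bnd: "l \<le> M" if "?P l" for l
  proof -
    have "(2::nat) ^ l \<le> c * 16 * 2 ^ l" using assms(1) by simp
    also have "\<dots> \<le> 2 ^ M" by (rule that)
    finally show ?thesis by simp
  qed
  obtain l where l: "?P l" "\<And>l'. ?P l' \<Longrightarrow> l' \<le> l"
    using ex_has_greatest_nat[of ?P l0 "\<lambda>x. x" "Suc M"] bnd assms(2) by (auto simp: less_Suc_eq_le)
  have "l \<le> M" using bnd l(1) .
  then have e: "(2::nat) ^ M = 2 ^ (M - l) * 2 ^ l" by (simp flip: power_add)
  have "c * 16 \<le> 2 ^ (M - l)" using l(1) unfolding e by simp
  moreover have "\<not> ?P (Suc l)" using l(2)[of "Suc l"] by auto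
  then have "2 ^ (M - l) * 2 ^ l \<le> (c * 32) * 2 ^ l" unfolding e by (simp add: mult_ac)
  then have "2 ^ (M - l) \<le> c * 32" by simp
  ultimately show ?thesis using l(2)[OF assms(2)] \<open>l \<le> M\<close> by auto
qed

section \<open>Union bound over light codewords\<close>

context bsc begin

text \<open>The Bhattacharyya parameter of the channel.\<close>

definition rho :: real where "rho = 2 * sqrt (eps * (1 - eps))"

lemma rho_pos: "0 < rho" and rho_less_1: "rho < 1"
proof -
  show "0 < rho" using eps_pos eps_half by (simp add: rho_def)
  have "4 * (eps * (1 - eps)) = 1 - (1 - 2 * eps)\<^sup>2" by (simp add: power2_eq_square algebra_simps)
  also have "\<dots> < 1" using eps_half by simp
  finally have "sqrt (4 * (eps * (1 - eps))) < 1" by simp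
  then show "rho < 1" unfolding rho_def real_sqrt_mult by simp
qed

text \<open>Chernoff bound with the tilt \<open>tau\<close> at which \<open>eps * tau\<close> and
  \<open>(1 - eps) / tau\<close> coincide. In the event, a codeword differing from the transmitted
  one by \<open>S\<close> agrees with the received word at least as well.\<close>

lemma pair_error:
  assumes fin: "finite A" and S: "S \<subseteq> A"
  shows "E A (\<lambda>Z. of_bool (card S \<le> 2 * card (S \<inter> Z))) \<le> rho ^ card S"
proof -
  define tau where "tau = sqrt ((1 - eps) / eps)"
  have tau: "1 \<le> tau" using eps_pos eps_half by (simp add: tau_def)
  have finS: "finite S" using fin S finite_subset by auto
  define h where "h = (\<lambda>v b. if v \<in> S then (if b then tau else 1 / tau) else 1)"
  have "E A (\<lambda>Z. of_bool (card S \<le> 2 * card (S \<inter> Z))) \<le> E A (\<lambda>Z. \<Prod>v\<in>A. h v (v \<in> Z))"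
  proof (rule E_mono)
    fix Z
    have "(\<Prod>v\<in>A. h v (v \<in> Z)) = (\<Prod>v\<in>S. if v \<in> Z then tau else 1 / tau)"
      unfolding h_def using fin S by (simp add: prod.If_cases Int_absorb1)
    also have "\<dots> = tau ^ card (S \<inter> Z) * (1 / tau) ^ card (S - Z)"
      using finS by (simp add: prod.If_cases Diff_eq)
    finally have e: "(\<Prod>v\<in>A. h v (v \<in> Z)) = tau ^ card (S \<inter> Z) / tau ^ card (S - Z)" by (simp add: power_divide)
    have "card S = card (S \<inter> Z) + card (S - Z)"
      using finS by (metis Int_Diff_Un Int_Diff_disjoint card_Un_disjoint finite_Diff finite_Int)
    then have "card S \<le> 2 * card (S \<inter> Z) \<Longrightarrow> tau ^ card (S - Z) \<le> tau ^ card (S \<inter> Z)"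
      using tau by (intro power_increasing) auto
    then show "of_bool (card S \<le> 2 * card (S \<inter> Z)) \<le> (\<Prod>v\<in>A. h v (v \<in> Z))"
      unfolding e using tau by (auto simp: pos_le_divide_eq)
  qed
  also have "\<dots> = (\<Prod>v\<in>A. eps * h v True + (1 - eps) * h v False)" by (rule E_prod[OF fin])
  also have "\<dots> = (\<Prod>v\<in>A. if v \<in> S then eps * tau + (1 - eps) / tau else 1)"
    by (intro prod.cong) (auto simp: h_def)
  also have "\<dots> = (eps * tau + (1 - eps) / tau) ^ card S"
    using fin S by (simp add: prod.If_cases Int_absorb1)
  also have "eps * tau + (1 - eps) / tau = rho"
  proof -
    have "eps * tau = sqrt (eps * (1 - eps))"
    proof -
      have "eps * tau = sqrt (eps\<^sup>2) * tau" using eps_pos by simp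
      also have "\<dots> = sqrt (eps\<^sup>2 * ((1 - eps) / eps))" unfolding tau_def by (rule real_sqrt_mult[symmetric])
      also have "eps\<^sup>2 * ((1 - eps) / eps) = eps * (1 - eps)" using eps_pos by (simp add: power2_eq_square)
      finally show ?thesis .
    qed
    moreover have "(1 - eps) / tau = sqrt (eps * (1 - eps))"
    proof -
      have "(1 - eps) / tau = sqrt ((1 - eps)\<^sup>2) / tau" using eps_half by simp
      also have "\<dots> = sqrt ((1 - eps)\<^sup>2 / ((1 - eps) / eps))" unfolding tau_def by (rule real_sqrt_divide[symmetric])
      also have "(1 - eps)\<^sup>2 / ((1 - eps) / eps) = eps * (1 - eps)" using eps_pos eps_half by (simp add: power2_eq_square)
      finally show ?thesis .
    qed
    ultimately show ?thesis by (simp add: rho_def)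
  qed
  finally show ?thesis .
qed

text \<open>Another codeword at distance at most \<open>W\<close> from the transmitted one competes
  with it. By linearity only the difference \<open>S\<close> matters, so the event depends on the
  noise alone.\<close>

definition confusable :: "nat \<Rightarrow> nat \<Rightarrow> real \<Rightarrow> point set \<Rightarrow> bool" where
  "confusable M r W Z \<longleftrightarrow> (\<exists>S\<in>RMs M r. S \<noteq> {} \<and> real (card S) \<le> W \<and> card S \<le> 2 * card (S \<inter> Z))"

lemma finite_RMs: "finite (RMs M r)"
  using RM_card(1) by (simp add: RMs_def)

text \<open>Codewords are grouped by the dyadic level of their weight. Being large enough for its
  level makes a word unlikely to be confusable, being small enough makes such words few; levels
  above \<open>r\<close> contain no nonzero word.\<close>

lemma confusable_sum:
  assumes W: "W * 16 * 2 ^ l0 \<le> 2 ^ M"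
  shows "E (points M) (\<lambda>Z. of_bool (confusable M r W Z)) \<le>
    (\<Sum>l\<in>{l0..min r M}. 2 ^ ((M + 1) * (l * (M - l) + binom_le (M - l) (r - l))) * rho powr (2 ^ (M - l) / 32))"
proof -
  let ?B = "{S \<in> RMs M r. S \<noteq> {} \<and> real (card S) \<le> W}"
  let ?N = "\<lambda>l. {S \<in> RMs M r. card S * 16 \<le> 2 ^ (M - l)}"
  have finB: "finite ?B" using finite_RMs by simp
  have "E (points M) (\<lambda>Z. of_bool (confusable M r W Z)) \<le> E (points M) (\<lambda>Z. \<Sum>S\<in>?B. of_bool (card S \<le> 2 * card (S \<inter> Z)))"
  proof (rule E_mono)
    fix Z
    show "(of_bool (confusable M r W Z) :: real) \<le> (\<Sum>S\<in>?B. of_bool (card S \<le> 2 * card (S \<inter> Z)))"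
    proof (cases "confusable M r W Z")
      case True
      then obtain S where S: "S \<in> ?B" "card S \<le> 2 * card (S \<inter> Z)" by (auto simp: confusable_def)
      have "of_bool (card S \<le> 2 * card (S \<inter> Z)) \<le> (\<Sum>S\<in>?B. of_bool (card S \<le> 2 * card (S \<inter> Z)) :: real)"
        using S(1) finB by (intro member_le_sum) auto
      then show ?thesis using S(2) by (simp add: of_bool_def)
    qed (auto intro!: sum_nonneg)
  qed
  also have "\<dots> \<le> (\<Sum>S\<in>?B. rho ^ card S)"
    unfolding E_sum using RMs_sub by (intro sum_mono pair_error) auto
  also have "\<dots> \<le> (\<Sum>S\<in>?B. \<Sum>l\<in>{l0..min r M}. of_bool (S \<in> ?N l) * rho powr (2 ^ (M - l) / 32))"
  proof (rule sum_mono)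
    fix S assume S: "S \<in> ?B"
    have "S \<subseteq> points M" using S subsetD[OF RMs_sub] by blast
    then have finS: "finite S" by (rule finite_subset) simp
    have "real (card S) * 16 * 2 ^ l0 \<le> W * 16 * 2 ^ l0" using S by simp
    also note W
    finally have "real (card S * 16 * 2 ^ l0) \<le> real (2 ^ M)" by simp
    then have "card S * 16 * 2 ^ l0 \<le> 2 ^ M" by (simp only: of_nat_le_iff)
    moreover have "0 < card S" using S finS by (auto simp: card_gt_0_iff)
    ultimately obtain l where l: "l0 \<le> l" "l \<le> M" "card S * 16 \<le> 2 ^ (M - l)" "2 ^ (M - l) \<le> card S * 32"
      using dyadic_level by blast
    have "l \<le> r" using light_RMs_zero[of r l M S] l S by (metis (mono_tags, lifting) mem_Collect_eq not_le)
    have "real (2 ^ (M - l)) \<le> real (card S * 32)" using l(4) by (simp only: of_nat_le_iff)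
    then have "2 ^ (M - l) / 32 \<le> real (card S)" by simp
    then have "rho powr real (card S) \<le> rho powr (2 ^ (M - l) / 32)"
      using rho_pos rho_less_1 by (intro powr_mono') auto
    then have "rho ^ card S \<le> of_bool (S \<in> ?N l) * rho powr (2 ^ (M - l) / 32)"
      using S l rho_pos by (simp add: powr_realpow)
    also have "\<dots> \<le> (\<Sum>l\<in>{l0..min r M}. of_bool (S \<in> ?N l) * rho powr (2 ^ (M - l) / 32))"
      using l \<open>l \<le> r\<close> by (intro member_le_sum[of l _ "\<lambda>l. of_bool (S \<in> ?N l) * rho powr (2 ^ (M - l) / 32)"]) auto
    finally show "rho ^ card S \<le> (\<Sum>l\<in>{l0..min r M}. of_bool (S \<in> ?N l) * rho powr (2 ^ (M - l) / 32))" .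
  qed
  also have "\<dots> = (\<Sum>l\<in>{l0..min r M}. (\<Sum>S\<in>?B. of_bool (S \<in> ?N l)) * rho powr (2 ^ (M - l) / 32))"
    by (subst sum.swap) (simp only: sum_distrib_right)
  also have "\<dots> \<le> (\<Sum>l\<in>{l0..min r M}. 2 ^ ((M + 1) * (l * (M - l) + binom_le (M - l) (r - l))) * rho powr (2 ^ (M - l) / 32))"
  proof (intro sum_mono mult_right_mono)
    fix l assume l: "l \<in> {l0..min r M}"
    have "(\<Sum>S\<in>?B. of_bool (S \<in> ?N l)) = (real (card {S \<in> ?B. S \<in> ?N l}))"
      using finB by (simp add: sum_of_bool_eq Int_def) (rule arg_cong[of _ _ card], auto)
    also have "\<dots> \<le> card (?N l)" using finite_RMs by (intro of_nat_mono card_mono) auto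
    also have "\<dots> \<le> real (2 ^ ((M + 1) * (l * (M - l) + binom_le (M - l) (r - l))))"
      using l by (intro of_nat_mono light_RMs_count) auto
    finally show "(\<Sum>S\<in>?B. of_bool (S \<in> ?N l)) \<le> (2::real) ^ ((M + 1) * (l * (M - l) + binom_le (M - l) (r - l)))"
      by simp
  qed simp
  finally show ?thesis .
qed

text \<open>With \<open>n = M - l\<close> the pair error is \<open>2\<close> to a negative multiple
  of \<open>2 ^ n\<close>, so the main exponent \<open>(M + 1) * binom_le n (r - l)\<close> of the
  count must be a small fraction of \<open>2 ^ n\<close>. Now \<open>r\<close> exceeds
  \<open>M / 2\<close> by at most O(\<open>sqrt M\<close>) while \<open>l\<close> is at least of
  order \<open>sqrt M * log M\<close>; thus \<open>r - l\<close> falls so far below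
  \<open>n / 2\<close> that \<open>rate n (r - l)\<close> is O(\<open>M powr (-4)\<close>).\<close>

lemma confusable_asymp:
  assumes eta: "0 < eta" and kap: "0 < kap"
  shows "\<exists>M0. \<forall>M\<ge>M0. \<forall>r. rate M r \<le> 1 - eta \<longrightarrow>
    E (points M) (\<lambda>Z. of_bool (confusable M r (2 powr (M - kap * (sqrt M * log 2 M))) Z)) \<le> 2 powr (- (2 powr (M / 4)))"
proof -
  define gam where "gam = - log 2 rho"
  have gam: "0 < gam" using rho_pos rho_less_1 by (simp add: gam_def)
  have rho2: "rho = 2 powr (- gam)" using rho_pos by (simp add: gam_def)
  define al where "al = \<bar>1 / 2 - ln eta\<bar> + 1"
  have al: "0 < al" by (simp add: al_def)
  \<comment> \<open>The tilt for which \<open>T * kap / 2 = 4\<close>, the source of the power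
    \<open>M powr (-4)\<close>.\<close>
  define T where "T = 8 / kap"
  have T: "0 < T" using kap by (simp add: T_def)
  define C where "C = exp (T * al + T\<^sup>2 / 2 + 5 * T / 2)"
  have C: "0 < C" by (simp add: C_def)
  have "eventually (\<lambda>x::real. al * sqrt x \<le> x / 6) at_top" using al by real_asymp
  moreover have "eventually (\<lambda>x::real. (x + 1) * (x * x) \<le> gam / 128 * 2 powr (x / 3)) at_top" using gam by real_asymp
  moreover have "eventually (\<lambda>x::real. (x + 1) * (C * x powr (-4)) \<le> gam / 128) at_top" using C gam by real_asymp
  moreover have "eventually (\<lambda>x::real. log 2 (x + 1) + 2 powr (x / 4) \<le> gam / 64 * 2 powr (x / 3)) at_top" using gam by real_asymp
  moreover have "eventually (\<lambda>x::real. 5 \<le> kap * (sqrt x * log 2 x)) at_top" using kap by real_asymp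
  moreover have "eventually (\<lambda>x::real. T \<le> sqrt x) at_top" by real_asymp
  moreover have "eventually (\<lambda>x::real. 1 \<le> x) at_top" by real_asymp
  ultimately have "eventually (\<lambda>x::real. al * sqrt x \<le> x / 6 \<and>
     (x + 1) * (x * x) \<le> gam / 128 * 2 powr (x / 3) \<and> (x + 1) * (C * x powr (-4)) \<le> gam / 128 \<and>
     log 2 (x + 1) + 2 powr (x / 4) \<le> gam / 64 * 2 powr (x / 3) \<and>
     5 \<le> kap * (sqrt x * log 2 x) \<and> T \<le> sqrt x \<and> 1 \<le> x) at_top"
    by (simp only: eventually_conj_iff)
  from eventually_compose_filterlim[OF this filterlim_real_sequentially]
  obtain M0 where M0: "\<And>M. M0 \<le> M \<Longrightarrow> al * sqrt M \<le> real M / 6 \<and>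
     (real M + 1) * (real M * real M) \<le> gam / 128 * 2 powr (real M / 3) \<and> (real M + 1) * (C * real M powr (-4)) \<le> gam / 128 \<and>
     log 2 (real M + 1) + 2 powr (real M / 4) \<le> gam / 64 * 2 powr (real M / 3) \<and>
     5 \<le> kap * (sqrt M * log 2 M) \<and> T \<le> sqrt M \<and> 1 \<le> real M"
    by (auto simp: eventually_sequentially)
  have "E (points M) (\<lambda>Z. of_bool (confusable M r (2 powr (M - kap * (sqrt M * log 2 M))) Z)) \<le> 2 powr (- (2 powr (M / 4)))"
    if M: "M0 \<le> M" and rt: "rate M r \<le> 1 - eta" for M r
  proof -
    define L where "L = kap * (sqrt M * log 2 M)"
    from M0[OF M] have e1: "al * sqrt M \<le> real M / 6"
      and e2: "(real M + 1) * (real M * real M) \<le> gam / 128 * 2 powr (real M / 3)"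
      and e3: "(real M + 1) * (C * real M powr (-4)) \<le> gam / 128"
      and e4: "log 2 (real M + 1) + 2 powr (real M / 4) \<le> gam / 64 * 2 powr (real M / 3)"
      and e5: "5 \<le> L" and e6: "T \<le> sqrt M" and e7: "1 \<le> real M"
      by (auto simp: L_def)
    \<comment> \<open>The 4 pays for the factor 16 in the weight condition; rounding loses at most
      one more.\<close>
    define l0 where "l0 = nat \<lfloor>L\<rfloor> - 4"
    have l0: "L - 5 \<le> real l0" "real l0 \<le> L - 4" unfolding l0_def using e5 by linarith+
    have "2 ^ l0 \<le> 2 powr (L - 4)" using l0(2) by (simp add: powr_realpow[symmetric])
    then have "2 powr (M - L) * 16 * 2 ^ l0 \<le> 2 powr (M - L) * 16 * 2 powr (L - 4)" by simp
    also have "\<dots> = 2 powr (M - L) * 2 powr 4 * 2 powr (L - 4)" by simp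
    also have "\<dots> = 2 ^ M" by (simp only: powr_add[symmetric]) (simp add: powr_realpow)
    finally have W: "2 powr (M - L) * 16 * 2 ^ l0 \<le> 2 ^ M" .
    have "real r \<le> real M / 2 + (1 / 2 - ln eta) * sqrt M"
      using rt eta e7 by (intro degree_bound) auto
    also have "(1 / 2 - ln eta) * sqrt M \<le> al * sqrt M" by (intro mult_right_mono) (auto simp: al_def)
    finally have r: "real r \<le> real M / 2 + al * sqrt M" by simp
    have each: "2 ^ ((M + 1) * (l * (M - l) + binom_le (M - l) (r - l))) * rho powr (2 ^ (M - l) / 32)
      \<le> 2 powr (- (gam / 64 * 2 powr (real M / 3)))" if l: "l \<in> {l0..min r M}" for l
    proof -
      define n where "n = M - l"
      have n: "real n = real M - real l" using l by (simp add: n_def)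
      \<comment> \<open>Since \<open>l <= r\<close> and \<open>r\<close> is at most two thirds of
        \<open>M\<close>.\<close>
      have "real M / 3 \<le> real n" using n l r e1 by auto
      then have n3: "2 powr (real M / 3) \<le> 2 ^ n" by (simp add: powr_realpow[symmetric])
      have "real (l * n) \<le> real M * real M" using l n by (auto intro!: mult_mono)
      then have "real (M + 1) * real (l * n) \<le> real (M + 1) * (real M * real M)" by (intro mult_left_mono) auto
      also have "\<dots> \<le> gam / 128 * 2 powr (real M / 3)" using e2 by (simp add: add.commute)
      also have "\<dots> \<le> gam / 128 * 2 ^ n" using n3 gam by (intro mult_left_mono) auto
      finally have a: "real (M + 1) * real (l * n) \<le> gam / 128 * 2 ^ n" .
      have "rate n (r - l) \<le> exp (T / sqrt M * (real (r - l) - n / 2) + n * (T / sqrt M)\<^sup>2 / 2)"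
        using T e6 e7 by (intro binomial_tail) (auto simp: divide_le_eq)
      also have "\<dots> \<le> exp (T * al + T\<^sup>2 / 2 + 5 * T / 2 + (- (4 * log 2 M)))"
      proof -
        have l0l: "real l0 \<le> real l" and rl: "real (r - l) = real r - real l" using l by auto
        have "real r - real l - (real M - real l) / 2 \<le> al * sqrt M - (L - 5) / 2"
          using r l0(1) l0l by (simp add: field_simps)
        then have "real (r - l) - n / 2 \<le> al * sqrt M - (L - 5) / 2" unfolding rl n .
        then have "T / sqrt M * (real (r - l) - n / 2) \<le> T / sqrt M * (al * sqrt M - (L - 5) / 2)"
          using T by (intro mult_left_mono) auto
        also have "\<dots> = T * al - T * kap / 2 * log 2 M + 5 * T / 2 / sqrt M"
          using e7 by (simp add: L_def field_simps)
        also have "T * kap / 2 * log 2 M = 4 * log 2 M" using kap by (simp add: T_def)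
        also have "5 * T / 2 / sqrt M \<le> 5 * T / 2" using T e7 by (simp add: divide_le_eq mult_le_cancel_left1)
        finally have "T / sqrt M * (real (r - l) - n / 2) \<le> T * al - 4 * log 2 M + 5 * T / 2" by simp
        moreover have "n * (T / sqrt M)\<^sup>2 / 2 \<le> T\<^sup>2 / 2"
        proof -
          have "real n * (T / sqrt M)\<^sup>2 = T\<^sup>2 * (real n / real M)" by (simp add: power_divide)
          also have "\<dots> \<le> T\<^sup>2 * 1" using n e7 by (intro mult_left_mono) auto
          finally show ?thesis by simp
        qed
        ultimately show ?thesis by simp
      qed
      also have "\<dots> = C * exp (- (4 * log 2 M))" by (simp only: C_def exp_add)
      also have "\<dots> \<le> C * real M powr (-4)"
      proof -
        have "ln M * ln 2 \<le> ln M * 1" using e7 ln_2_less_1 by (intro mult_left_mono) auto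
        then have "ln M \<le> log 2 M" by (simp add: log_def le_divide_eq)
        then show ?thesis using C e7 by (intro mult_left_mono) (auto simp: powr_def)
      qed
      finally have "real (M + 1) * rate n (r - l) \<le> real (M + 1) * (C * real M powr (-4))"
        by (intro mult_left_mono) auto
      also have "\<dots> \<le> gam / 128" using e3 by (simp add: add.commute)
      finally have "real (M + 1) * rate n (r - l) * 2 ^ n \<le> gam / 128 * 2 ^ n" by (intro mult_right_mono) auto
      then have b: "real (M + 1) * real (binom_le n (r - l)) \<le> gam / 128 * 2 ^ n" by (simp add: rate_def)
      have "2 ^ ((M + 1) * (l * n + binom_le n (r - l))) * rho powr (2 ^ n / 32) =
        2 powr (real ((M + 1) * (l * n + binom_le n (r - l))) - gam * 2 ^ n / 32)"
      proof -
        have "2 ^ a * rho powr b = 2 powr (real a - gam * b)" for a b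
        proof -
          have "2 ^ a * rho powr b = 2 powr real a * 2 powr (- gam * b)"
            by (simp only: rho2 powr_powr powr_realpow zero_less_numeral)
          then show ?thesis by (simp only: powr_add[symmetric]) simp
        qed
        then show ?thesis by simp
      qed
      also have "\<dots> \<le> 2 powr (- (gam / 64 * 2 ^ n))"
      proof -
        have "real ((M + 1) * (l * n + binom_le n (r - l))) = real (M + 1) * real (l * n) + real (M + 1) * real (binom_le n (r - l))"
          by (simp add: algebra_simps)
        then show ?thesis using a b by simp
      qed
      also have "\<dots> \<le> 2 powr (- (gam / 64 * 2 powr (real M / 3)))" using n3 gam by simp
      finally show ?thesis by (simp add: n_def)
    qed
    have "E (points M) (\<lambda>Z. of_bool (confusable M r (2 powr (M - L)) Z)) \<le>
      (\<Sum>l\<in>{l0..min r M}. 2 ^ ((M + 1) * (l * (M - l) + binom_le (M - l) (r - l))) * rho powr (2 ^ (M - l) / 32))"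
      by (rule confusable_sum[OF W])
    also have "\<dots> \<le> (\<Sum>l\<in>{l0..min r M}. 2 powr (- (gam / 64 * 2 powr (real M / 3))))"
      by (intro sum_mono each)
    also have "\<dots> \<le> (real M + 1) * 2 powr (- (gam / 64 * 2 powr (real M / 3)))"
      by (simp add: mult_right_mono)
    also have "real M + 1 = 2 powr (log 2 (real M + 1))" by simp
    also have "2 powr (log 2 (real M + 1)) * 2 powr (- (gam / 64 * 2 powr (real M / 3))) =
      2 powr (log 2 (real M + 1) + - (gam / 64 * 2 powr (real M / 3)))" by (rule powr_add[symmetric])
    also have "\<dots> \<le> 2 powr (- (2 powr (real M / 4)))" using e4 by simp
    finally show ?thesis by (simp add: L_def)
  qed
  then show ?thesis by blast
qed

end


subsection \<open>The decoder RMRec\<close>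

context bsc begin

section \<open>From the channel to sums over noise sets\<close>

abbreviation noise :: "'a set \<Rightarrow> ('a \<Rightarrow> bool) pmf" where
  "noise A \<equiv> Pi_pmf A False (\<lambda>_. bernoulli_pmf eps)"

lemma pmf_noise:
  assumes "finite A" "Z \<subseteq> A" shows "pmf (noise A) (\<lambda>x. x \<in> Z) = wt A Z"
proof -
  have "pmf (noise A) (\<lambda>x. x \<in> Z) = (\<Prod>x\<in>A. pmf (bernoulli_pmf eps) (x \<in> Z))"
    using assms by (intro pmf_Pi') auto
  also have "\<dots> = (\<Prod>x\<in>A. if x \<in> Z then eps else 1 - eps)"
    using eps_pos eps_half by (intro prod.cong) auto
  also have "\<dots> = wt A Z"
    using assms by (simp add: prod.If_cases Int_absorb1 Diff_eq wt_def)
  finally show ?thesis .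
qed

lemma expectation_noise:
  assumes "finite A"
  shows "measure_pmf.expectation (noise A) f = E A (\<lambda>Z. f (\<lambda>x. x \<in> Z) :: real)"
proof -
  have "measure_pmf.expectation (noise A) f = (\<Sum>e\<in>(\<lambda>Z x. x \<in> Z) ` Pow A. f e * pmf (noise A) e)"
  proof (rule integral_measure_pmf_real)
    fix e assume "e \<in> set_pmf (noise A)"
    then have "\<forall>x. x \<notin> A \<longrightarrow> \<not> e x" using set_Pi_pmf_subset[OF assms, of False "\<lambda>_. bernoulli_pmf eps"] by auto
    then have "Collect e \<in> Pow A" by auto
    then show "e \<in> (\<lambda>Z x. x \<in> Z) ` Pow A" by (intro image_eqI[of _ _ "Collect e"]) auto
  qed (use assms in simp)
  also have "\<dots> = (\<Sum>Z\<in>Pow A. f (\<lambda>x. x \<in> Z) * pmf (noise A) (\<lambda>x. x \<in> Z))"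
    by (subst sum.reindex) (auto simp: inj_on_def fun_eq_iff)
  also have "\<dots> = E A (\<lambda>Z. f (\<lambda>x. x \<in> Z))"
    unfolding E_def using assms by (intro sum.cong) (auto simp: pmf_noise)
  finally show ?thesis .
qed

lemma Collect_RM: "c \<in> RM M r \<Longrightarrow> Collect c \<subseteq> points M"
  using RM_outside by blast

lemma hdist_sets:
  assumes "c \<in> RM M r" "Y \<subseteq> points M"
  shows "hdist M c (\<lambda>x. x \<in> Y) = card (sd (Collect c) Y)"
proof -
  have "{x \<in> points M. c x \<noteq> (x \<in> Y)} = sd (Collect c) Y"
    using Collect_RM[OF assms(1)] assms(2) by auto
  then show ?thesis by (simp add: hdist_def)
qed

lemma lik_wt:
  assumes "c \<in> RM M r" "Y \<subseteq> points M"
  shows "lik eps M c (\<lambda>x. x \<in> Y) = wt (points M) (sd (Collect c) Y)"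
proof -
  have sub: "sd (Collect c) Y \<subseteq> points M" by (rule sd_subset[OF Collect_RM[OF assms(1)] assms(2)])
  then have "card (points M - sd (Collect c) Y) = 2 ^ M - card (sd (Collect c) Y)"
    by (simp add: card_Diff_subset finite_subset)
  then show ?thesis by (simp add: lik_def wt_def hdist_sets[OF assms])
qed

lemma bit_MAP_guess:
  assumes "Y \<subseteq> points M"
  shows "pmf (bit_MAP eps M r (\<lambda>x. x \<in> Y) x) True = rm_guess M r x Y"
    and "pmf (bit_MAP eps M r (\<lambda>x. x \<in> Y) x) False = 1 - rm_guess M r x Y"
proof -
  interpret lin_code eps "points M" "RMs M r" by (rule RMs_code)
  have "(\<Sum>c\<in>{c\<in>RM M r. c x}. lik eps M c (\<lambda>x. x \<in> Y)) = (\<Sum>c\<in>Collect ` {c\<in>RM M r. c x}. wt (points M) (sd c Y))"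
    using assms by (subst sum.reindex) (auto simp: inj_on_def lik_wt intro!: sum.cong)
  moreover have "Collect ` {c\<in>RM M r. c x} = {c \<in> RMs M r. x \<in> c}" by (auto simp: RMs_def)
  ultimately have T: "(\<Sum>c\<in>{c\<in>RM M r. c x}. lik eps M c (\<lambda>x. x \<in> Y)) = lik1 x Y" by (simp add: lik1_def)
  have "(\<Sum>c\<in>{c\<in>RM M r. \<not> c x}. lik eps M c (\<lambda>x. x \<in> Y)) = (\<Sum>c\<in>Collect ` {c\<in>RM M r. \<not> c x}. wt (points M) (sd c Y))"
    using assms by (subst sum.reindex) (auto simp: inj_on_def lik_wt intro!: sum.cong)
  moreover have "Collect ` {c\<in>RM M r. \<not> c x} = {c \<in> RMs M r. x \<notin> c}" by (auto simp: RMs_def)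
  ultimately have F: "(\<Sum>c\<in>{c\<in>RM M r. \<not> c x}. lik eps M c (\<lambda>x. x \<in> Y)) = lik0 x Y" by (simp add: lik0_def)
  show "pmf (bit_MAP eps M r (\<lambda>x. x \<in> Y) x) True = rm_guess M r x Y"
    "pmf (bit_MAP eps M r (\<lambda>x. x \<in> Y) x) False = 1 - rm_guess M r x Y"
    unfolding bit_MAP_def Let_def T F rm_guess_def guess1_def by auto
qed

lemma bit_MAP_wrong:
  assumes c: "c \<in> RM M r" and Z: "Z \<subseteq> points M"
  shows "pmf (bit_MAP eps M r (\<lambda>x. c x \<noteq> (x \<in> Z)) x) (\<not> c x) = rm_guess M r x Z"
proof -
  interpret lin_code eps "points M" "RMs M r" by (rule RMs_code)
  have C: "Collect c \<in> RMs M r" using c by (simp add: RMs_def)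
  have Y: "sd (Collect c) Z \<subseteq> points M" by (rule sd_subset[OF Collect_RM[OF c] Z])
  have "(\<lambda>x. c x \<noteq> (x \<in> Z)) = (\<lambda>x. x \<in> sd (Collect c) Z)" by auto
  moreover have "rm_guess M r x (sd (Collect c) Z) = (if c x then 1 - rm_guess M r x Z else rm_guess M r x Z)"
    using guess_shift[OF C] by (simp add: rm_guess_def)
  ultimately show ?thesis using bit_MAP_guess[OF Y, of r x] by (cases "c x") auto
qed

definition received :: "word \<Rightarrow> point set \<Rightarrow> word" where
  "received c Z = (\<lambda>x. c x \<noteq> (x \<in> Z))"

lemma hdist_commute: "hdist M v w = hdist M w v"
  by (simp add: hdist_def eq_commute)

lemma hdist_triangle: "hdist M u w \<le> hdist M u v + hdist M v w"
proof -
  have "{x \<in> points M. u x \<noteq> w x} \<subseteq> {x \<in> points M. u x \<noteq> v x} \<union> {x \<in> points M. v x \<noteq> w x}" by auto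
  then have "card {x \<in> points M. u x \<noteq> w x} \<le> card ({x \<in> points M. u x \<noteq> v x} \<union> {x \<in> points M. v x \<noteq> w x})"
    by (intro card_mono) auto
  then show ?thesis unfolding hdist_def using card_Un_le order_trans by blast
qed

text \<open>The last step of both decoders. A list element \<open>v\<close> differs from
  \<open>c\<close> on a nonzero codeword \<open>S\<close> of weight at most \<open>W\<close>; off
  \<open>S\<close> both agree equally well with the received word, and on \<open>S\<close> the word
  \<open>c\<close> wins unless the noise covers half of it.\<close>

lemma best_agree_unique:
  assumes c: "c \<in> RM M r" and Z: "Z \<subseteq> points M" and nc: "\<not> confusable M r W Z"
    and L: "c \<in> L" "\<And>v. v \<in> L \<Longrightarrow> v \<in> RM M r \<and> real (hdist M v c) \<le> W"
  shows "best_agree M (received c Z) L = {c}"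
proof -
  have less: "agree M v (received c Z) < agree M c (received c Z)" if v: "v \<in> L" "v \<noteq> c" for v
  proof -
    let ?S = "sd (Collect v) (Collect c)"
    have vR: "v \<in> RM M r" using L v by auto
    have "wxor v c \<in> RM M r" using RM_xor[OF vR c] .
    then have S: "?S \<in> RMs M r" by (simp add: in_RMs wxor_def)
    have Ssub: "?S \<subseteq> points M" using S RMs_sub by blast
    have finS: "finite ?S" by (rule finite_subset[OF Ssub]) simp
    have "?S \<noteq> {}" using v(2) by (auto simp: fun_eq_iff set_eq_iff)
    moreover have "hdist M v c = card ?S"
      using hdist_sets[OF vR, of "Collect c"] Collect_RM[OF c] by simp
    ultimately have big: "2 * card (?S \<inter> Z) < card ?S"
      using nc S L(2)[OF v(1)] unfolding confusable_def by (metis not_le)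
    have a: "{x \<in> points M. v x = received c Z x} = (points M - ?S - Z) \<union> (?S \<inter> Z)"
      "{x \<in> points M. c x = received c Z x} = (points M - ?S - Z) \<union> (?S - Z)"
      using Ssub Z by (auto simp: received_def)
    have "card ?S = card (?S \<inter> Z) + card (?S - Z)"
      using finS by (metis Int_Diff_Un Int_Diff_disjoint card_Un_disjoint finite_Diff finite_Int)
    then have lt: "card (?S \<inter> Z) < card (?S - Z)" using big by linarith
    have "card ((points M - ?S - Z) \<union> (?S \<inter> Z)) = card (points M - ?S - Z) + card (?S \<inter> Z)"
      using finS by (intro card_Un_disjoint) auto
    moreover have "card ((points M - ?S - Z) \<union> (?S - Z)) = card (points M - ?S - Z) + card (?S - Z)"
      using finS by (intro card_Un_disjoint) auto
    ultimately show ?thesis unfolding agree_def a using lt by simp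
  qed
  show ?thesis
  proof
    show "best_agree M (received c Z) L \<subseteq> {c}"
      unfolding best_agree_def using less L(1) by (auto simp: not_less[symmetric])
    have "agree M v (received c Z) \<le> agree M c (received c Z)" if "v \<in> L" for v
      using less[OF that] by (cases "v = c") auto
    then show "{c} \<subseteq> best_agree M (received c Z) L"
      unfolding best_agree_def using L(1) by blast
  qed
qed

lemma expectation_Pi_errors:
  fixes A :: "'a set" and p :: "'a \<Rightarrow> bool pmf"
  assumes "finite A"
  shows "measure_pmf.expectation (Pi_pmf A False p) (\<lambda>g. real (card {x \<in> A. g x \<noteq> c x})) = (\<Sum>x\<in>A. pmf (p x) (\<not> c x))"
proof -
  let ?P = "Pi_pmf A False p"
  have fin: "finite (set_pmf ?P)"
  proof (rule finite_subset)
    show "set_pmf ?P \<subseteq> (\<lambda>Z x. x \<in> Z) ` Pow A"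
    proof
      fix e assume "e \<in> set_pmf ?P"
      then have "\<forall>x. x \<notin> A \<longrightarrow> \<not> e x" using set_Pi_pmf_subset[OF assms, of False p] by auto
      then have "Collect e \<in> Pow A" by auto
      then show "e \<in> (\<lambda>Z x. x \<in> Z) ` Pow A" by (intro image_eqI[of _ _ "Collect e"]) auto
    qed
  qed (use assms in simp)
  have "measure_pmf.expectation ?P (\<lambda>g. real (card {x \<in> A. g x \<noteq> c x})) = measure_pmf.expectation ?P (\<lambda>g. \<Sum>x\<in>A. of_bool (g x \<noteq> c x))"
    using assms by (intro Bochner_Integration.integral_cong) (auto simp: sum_of_bool_eq Int_def)
  also have "\<dots> = (\<Sum>x\<in>A. measure_pmf.expectation ?P (\<lambda>g. of_bool (g x \<noteq> c x)))"
    using fin by (intro Bochner_Integration.integral_sum integrable_measure_pmf_finite)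
  also have "\<dots> = (\<Sum>x\<in>A. pmf (p x) (\<not> c x))"
  proof (rule sum.cong[OF refl])
    fix x assume x: "x \<in> A"
    have "measure_pmf.expectation ?P (\<lambda>g. of_bool (g x \<noteq> c x) :: real) = measure_pmf.expectation (map_pmf (\<lambda>g. g x) ?P) (\<lambda>b. of_bool (b \<noteq> c x))"
      by (subst integral_map_pmf) (rule refl)
    also have "map_pmf (\<lambda>g. g x) ?P = p x" using Pi_pmf_component[OF assms, of x False p] x by simp
    also have "measure_pmf.expectation (p x) (\<lambda>b. of_bool (b \<noteq> c x)) = (\<Sum>b\<in>UNIV. of_bool (b \<noteq> c x) * pmf (p x) b)"
      by (rule integral_measure_pmf_real) auto
    also have "\<dots> = pmf (p x) (\<not> c x)" by (cases "c x") (auto simp: UNIV_bool)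
    finally show "measure_pmf.expectation ?P (\<lambda>g. of_bool (g x \<noteq> c x)) = pmf (p x) (\<not> c x)" .
  qed
  finally show ?thesis .
qed

lemma pmf_bind_ge:
  assumes "\<And>x. x \<in> set_pmf p \<Longrightarrow> x \<in> S \<Longrightarrow> pmf (q x) y = 1"
  shows "measure_pmf.prob p S \<le> pmf (bind_pmf p q) y"
proof -
  have "measure_pmf.prob p S = measure_pmf.expectation p (indicator S)" by simp
  also have "\<dots> \<le> measure_pmf.expectation p (\<lambda>x. pmf (q x) y)"
    using assms by (intro integral_mono_AE) (auto simp: AE_measure_pmf_iff indicator_def intro!: measure_pmf.integrable_const_bound[where B = 1] pmf_le_1)
  finally show ?thesis by (simp add: pmf_bind)
qed

section \<open>Failure probability of RMRec\<close>

definition rec_fail :: "nat \<Rightarrow> nat \<Rightarrow> real \<Rightarrow> word \<Rightarrow> point set \<Rightarrow> real" where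
  "rec_fail M r c' c Z = 1 - pmf (RMRec M r eps (received c Z) c') c"

lemma rec_fail_bounds: "0 \<le> rec_fail M r c' c Z" "rec_fail M r c' c Z \<le> 1"
  by (auto simp: rec_fail_def pmf_le_1)

text \<open>If the bitwise estimate is within the list radius \<open>W / 2\<close> of
  \<open>c\<close>, then \<open>c\<close> is listed and every listed word is within \<open>W\<close>
  of it, so only \<open>confusable\<close> can spoil the choice. The other term is Markov's
  inequality for the number of wrong bits, for fixed noise and random ties.\<close>

lemma rec_fail_le:
  fixes c' :: real and M :: nat
  defines "W \<equiv> 2 powr (real M - c' * sqrt (real M) * log 2 (real M) / 2)"
  assumes c: "c \<in> RM M r" and Z: "Z \<subseteq> points M"
  shows "rec_fail M r c' c Z \<le> of_bool (confusable M r W Z) + (\<Sum>x\<in>points M. rm_guess M r x Z) * 2 / W"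
proof (cases "confusable M r W Z")
  case True
  have "0 \<le> (\<Sum>x\<in>points M. rm_guess M r x Z) * 2 / W"
    unfolding rm_guess_def W_def
    by (intro divide_nonneg_nonneg mult_nonneg_nonneg sum_nonneg lin_code.guess_bounds[OF RMs_code]) auto
  then show ?thesis using True rec_fail_bounds(2)[of M r c' c Z] by simp
next
  case False
  let ?g = "received c Z"
  let ?P = "Pi_pmf (points M) False (\<lambda>x. bit_MAP eps M r ?g x)"
  let ?G = "{gh. real (hdist M gh c) \<le> W / 2}"
  have W: "0 < W" by (simp add: W_def)
  have "measure_pmf.prob ?P ?G \<le> pmf (RMRec M r eps ?g c') c"
    unfolding RMRec_def
  proof (rule pmf_bind_ge)
    fix gh assume gh: "gh \<in> ?G"
    let ?L = "{v\<in>RM M r. real (hdist M v gh) \<le> 2 powr (real M - c' * sqrt (real M) * log 2 (real M) / 2) / 2}"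
    have cL: "c \<in> ?L" using gh c by (simp add: hdist_commute W_def)
    have "v \<in> RM M r \<and> real (hdist M v c) \<le> W" if "v \<in> ?L" for v
    proof -
      have "real (hdist M v c) \<le> real (hdist M v gh) + real (hdist M gh c)"
        using hdist_triangle[of M v c gh] by (simp flip: of_nat_add)
      then show ?thesis using that gh by (auto simp: W_def)
    qed
    from best_agree_unique[OF c Z False cL this] have "best_agree M ?g ?L = {c}" by blast
    moreover have "?L \<noteq> {}" using cL by blast
    ultimately show "pmf (let L = ?L in if L = {} then return_pmf gh else pmf_of_set (best_agree M ?g L)) c = 1"
      unfolding Let_def by (simp only: if_False) (simp add: pmf_of_set_singleton)
  qed
  moreover have "1 - measure_pmf.prob ?P ?G \<le> (\<Sum>x\<in>points M. rm_guess M r x Z) * 2 / W"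
  proof -
    have "1 - measure_pmf.prob ?P ?G = measure_pmf.prob ?P (- ?G)"
      using measure_pmf.prob_compl[of ?G ?P] by (simp add: Compl_eq_Diff_UNIV)
    also have "- ?G = {gh \<in> space (measure_pmf ?P). W / 2 < real (hdist M gh c)}" by (auto simp: not_le)
    also have "measure_pmf.prob ?P \<dots> \<le> measure_pmf.prob ?P {gh \<in> space (measure_pmf ?P). W / 2 \<le> real (hdist M gh c)}"
      by (intro measure_pmf.finite_measure_mono) auto
    also have "\<dots> \<le> measure_pmf.expectation ?P (\<lambda>gh. real (hdist M gh c)) / (W / 2)"
    proof (rule integral_Markov_inequality_measure[where A = "{}"])
      show "integrable (measure_pmf ?P) (\<lambda>gh. real (hdist M gh c))"
      proof (rule measure_pmf.integrable_const_bound[where B = "2 ^ M"])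
        have "hdist M gh c \<le> 2 ^ M" for gh
          unfolding hdist_def by (subst card_points[symmetric]) (intro card_mono, auto)
        then have "real (hdist M gh c) \<le> 2 ^ M" for gh by (metis of_nat_le_iff of_nat_numeral of_nat_power)
        then show "AE gh in measure_pmf ?P. norm (real (hdist M gh c)) \<le> 2 ^ M" by simp
      qed simp
    qed (use W in auto)
    also have "measure_pmf.expectation ?P (\<lambda>gh. real (hdist M gh c)) = (\<Sum>x\<in>points M. pmf (bit_MAP eps M r ?g x) (\<not> c x))"
      unfolding hdist_def by (rule expectation_Pi_errors) simp
    also have "\<dots> = (\<Sum>x\<in>points M. rm_guess M r x Z)"
      unfolding received_def using bit_MAP_wrong[OF c Z] by simp
    finally show ?thesis by simp
  qed
  ultimately show ?thesis using False by (simp add: rec_fail_def)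
qed

lemma bin_entropy_nonneg: "0 \<le> bin_entropy eps"
proof -
  have "log 2 eps \<le> 0" "log 2 (1 - eps) \<le> 0" using eps_pos eps_half by (auto simp: log_le_zero_cancel_iff)
  then have "eps * log 2 eps \<le> 0" "(1 - eps) * log 2 (1 - eps) \<le> 0"
    using eps_pos eps_half by (auto intro!: mult_nonneg_nonpos)
  then show ?thesis unfolding bin_entropy_def by simp
qed

text \<open>\<open>c'\<close> is the bit error exponent \<open>b\<close>. The choice of
  \<open>W\<close> spends half of it on the list radius, the other half survives Markov's
  inequality, and halving once more absorbs the constant 3.\<close>

lemma rec_fail_asymp:
  assumes eta: "0 < eta"
  shows "\<exists>c'>0. \<exists>M0. \<forall>M\<ge>M0. \<forall>r. rate M r \<le> 1 - bin_entropy eps - eta \<longrightarrow>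
    (\<forall>c\<in>RM M r. E (points M) (rec_fail M r c' c) \<le> 2 powr (- (c' / 4 * (sqrt M * log 2 M))))"
proof -
  obtain b M1 where b: "0 < b" and M1: "\<And>M r x. M1 \<le> M \<Longrightarrow> rate M r \<le> 1 - bin_entropy eps - eta \<Longrightarrow> x \<in> points M \<Longrightarrow>
      E (points M) (rm_guess M r x) \<le> 2 powr (- (b * (sqrt M * log 2 M)))"
    using bit_error_asymp[OF eta] by blast
  obtain M2 where M2: "\<And>M r. M2 \<le> M \<Longrightarrow> rate M r \<le> 1 - eta \<Longrightarrow>
    E (points M) (\<lambda>Z. of_bool (confusable M r (2 powr (M - b / 2 * (sqrt M * log 2 M))) Z)) \<le> 2 powr (- (2 powr (M / 4)))"
    using confusable_asymp[OF eta, of "b / 2"] b by auto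
  have "eventually (\<lambda>x::real. b / 2 * (sqrt x * log 2 x) \<le> 2 powr (x / 4)) at_top" using b by real_asymp
  moreover have "eventually (\<lambda>x::real. 8 \<le> b * (sqrt x * log 2 x)) at_top" using b by real_asymp
  ultimately have "eventually (\<lambda>x::real. b / 2 * (sqrt x * log 2 x) \<le> 2 powr (x / 4) \<and> 8 \<le> b * (sqrt x * log 2 x)) at_top"
    by (simp only: eventually_conj_iff)
  from eventually_compose_filterlim[OF this filterlim_real_sequentially]
  obtain M3 where M3: "\<And>M. M3 \<le> M \<Longrightarrow> b / 2 * (sqrt M * log 2 M) \<le> 2 powr (real M / 4) \<and> 8 \<le> b * (sqrt M * log 2 M)"
    by (auto simp: eventually_sequentially)
  have "E (points M) (rec_fail M r b c) \<le> 2 powr (- (b / 4 * (sqrt M * log 2 M)))"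
    if M: "max M1 (max M2 M3) \<le> M" and rt: "rate M r \<le> 1 - bin_entropy eps - eta" and c: "c \<in> RM M r" for M r c
  proof -
    define L where "L = sqrt M * log 2 M"
    define W where "W = 2 powr (real M - b * sqrt (real M) * log 2 (real M) / 2)"
    have W: "W = 2 powr (real M - b / 2 * L)" by (simp add: W_def L_def mult.assoc)
    have e: "b / 2 * L \<le> 2 powr (real M / 4)" "8 \<le> b * L" using M3[of M] M by (auto simp: L_def)
    have "E (points M) (rec_fail M r b c) \<le> E (points M) (\<lambda>Z. of_bool (confusable M r W Z) + (\<Sum>x\<in>points M. rm_guess M r x Z) * (2 / W))"
      using rec_fail_le[OF c, of _ b] by (intro E_mono) (simp add: W_def)
    also have "\<dots> = E (points M) (\<lambda>Z. of_bool (confusable M r W Z)) + (\<Sum>x\<in>points M. E (points M) (rm_guess M r x)) * (2 / W)"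
      unfolding E_add E_cmult_right E_sum ..
    also have "\<dots> \<le> 2 powr (- (b / 2 * L)) + (\<Sum>x\<in>points M. 2 powr (- (b * L))) * (2 / W)"
    proof (intro add_mono mult_right_mono sum_mono)
      have "rate M r \<le> 1 - eta" using rt bin_entropy_nonneg by simp
      then have "E (points M) (\<lambda>Z. of_bool (confusable M r W Z)) \<le> 2 powr (- (2 powr (M / 4)))"
        using M2[of M r] M by (simp add: W L_def)
      also have "\<dots> \<le> 2 powr (- (b / 2 * L))" using e(1) by simp
      finally show "E (points M) (\<lambda>Z. of_bool (confusable M r W Z)) \<le> 2 powr (- (b / 2 * L))" .
      show "E (points M) (rm_guess M r x) \<le> 2 powr (- (b * L))" if "x \<in> points M" for x
        using M1[OF _ rt that] M by (simp add: L_def)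
    qed (simp add: W)
    also have "(\<Sum>x\<in>points M. 2 powr (- (b * L))) * (2 / W) = 2 * 2 powr (- (b / 2 * L))"
    proof -
      have "2 ^ M * 2 powr (- (b * L)) / W = 2 powr (real M + - (b * L) - (real M - b / 2 * L))"
        by (simp only: W powr_diff powr_add powr_realpow zero_less_numeral)
      moreover have "real M + - (b * L) - (real M - b / 2 * L) = - (b / 2 * L)" by simp
      ultimately have "2 ^ M * 2 powr (- (b * L)) / W = 2 powr (- (b / 2 * L))" by (simp only:)
      moreover have "(\<Sum>x\<in>points M. 2 powr (- (b * L))) * (2 / W) = 2 * (2 ^ M * 2 powr (- (b * L)) / W)" by simp
      ultimately show ?thesis by (simp only:)
    qed
    finally have "E (points M) (rec_fail M r b c) \<le> 3 * 2 powr (- (b / 2 * L))" by simp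
    also have "\<dots> \<le> 2 powr 2 * 2 powr (- (b / 2 * L))" by simp
    also have "\<dots> = 2 powr (2 - b / 2 * L)" by (simp only: powr_add[symmetric]) simp
    also have "\<dots> \<le> 2 powr (- (b / 4 * L))" using e(2) by simp
    finally show ?thesis by (simp add: L_def)
  qed
  then show ?thesis using b by blast
qed

end


subsection \<open>The decoder RMRec2\<close>

text \<open>\<open>key\<close> lists the selected coordinates in increasing order,
  \<open>merge\<close> looks them up by rank; this connects the two.\<close>

lemma nth_sorted_rank:
  assumes "finite S" "(k::nat) \<in> S"
  shows "card {k' \<in> S. k' < k} < card S" "sorted_list_of_set S ! card {k' \<in> S. k' < k} = k"
proof -
  let ?l = "sorted_list_of_set S"
  have st: "sorted_wrt (<) ?l" by (rule strict_sorted_list_of_set)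
  have set: "set ?l = S" and len: "length ?l = card S" using assms by auto
  obtain i where i: "i < length ?l" "?l ! i = k" using assms(2) set by (metis in_set_conv_nth)
  have "{k' \<in> S. k' < k} = (\<lambda>j. ?l ! j) ` {..<i}"
  proof (intro equalityI subsetI)
    fix k' assume k': "k' \<in> {k' \<in> S. k' < k}"
    then obtain j where j: "j < length ?l" "?l ! j = k'" using set by (metis in_set_conv_nth mem_Collect_eq)
    have "j < i"
    proof (rule ccontr)
      assume "\<not> j < i"
      then have "k \<le> k'" using sorted_wrt_nth_less[OF st, of i j] i j by (cases "i = j") auto
      then show False using k' by simp
    qed
    then show "k' \<in> (\<lambda>j. ?l ! j) ` {..<i}" using j by auto
  next
    fix k' assume "k' \<in> (\<lambda>j. ?l ! j) ` {..<i}"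
    then obtain j where j: "j < i" "k' = ?l ! j" by auto
    have "?l ! j < ?l ! i" by (rule sorted_wrt_nth_less[OF st j(1) i(1)])
    moreover have "?l ! j \<in> S" using j i set by (metis less_trans nth_mem)
    ultimately show "k' \<in> {k' \<in> S. k' < k}" using j i by auto
  qed
  moreover have "inj_on (\<lambda>j. ?l ! j) {..<i}"
    using i by (intro inj_on_nth) auto
  ultimately have "card {k' \<in> S. k' < k} = i" by (simp add: card_image)
  then show "card {k' \<in> S. k' < k} < card S" "?l ! card {k' \<in> S. k' < k} = k" using i len by auto
qed

lemma nth_key:
  assumes "finite S" "k \<in> S" shows "key S y ! card {k' \<in> S. k' < k} = y ! k"
  using nth_sorted_rank[OF assms] assms(1) by (simp add: key_def)

lemma key_points: "finite S \<Longrightarrow> key S y \<in> points (card S)"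
  by (simp add: key_def points_def)

lemma proj_key: "proj m S = key ({..<m} - S)"
  by (simp add: proj_def key_def fun_eq_iff)

lemma card_compl: "S \<subseteq> {..<m} \<Longrightarrow> card ({..<m} - S) = m - card S"
  by (simp add: card_Diff_subset finite_subset)

lemma proj_points: "S \<subseteq> {..<m} \<Longrightarrow> proj m S y \<in> points (m - card S)"
  using key_points[of "{..<m} - S"] by (simp add: proj_key card_compl)

lemma merge_points [simp]: "merge m S u z \<in> points m"
  by (simp add: merge_def points_def)

lemma merge_nth: "k < m \<Longrightarrow> merge m S u z ! k = (if k \<in> S then u ! card {k'\<in>S. k' < k}
                             else z ! card {k'\<in>{..<m} - S. k' < k})"
  by (simp add: merge_def)

lemma merge_key_proj:
  assumes "S \<subseteq> {..<m}" "y \<in> points m" shows "merge m S (key S y) (proj m S y) = y"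
proof (rule points_eqI[OF merge_points assms(2)])
  fix k assume k: "k < m"
  have "finite S" using assms(1) finite_subset by auto
  then show "merge m S (key S y) (proj m S y) ! k = y ! k"
    unfolding merge_nth[OF k] proj_key using k nth_key[of "{..<m} - S" k y] by (simp add: nth_key)
qed

lemma key_eqI:
  assumes "finite S" "u \<in> points (card S)" "\<And>k. k \<in> S \<Longrightarrow> y ! k = u ! card {k' \<in> S. k' < k}"
  shows "key S y = u"
proof (rule points_eqI[OF key_points[OF assms(1)] assms(2)])
  fix i assume i: "i < card S"
  let ?k = "sorted_list_of_set S ! i"
  have len: "length (sorted_list_of_set S) = card S" using assms(1) by simp
  have k: "?k \<in> S" using i assms(1) nth_mem[of i "sorted_list_of_set S"] by simp
  have "card {k' \<in> S. k' < ?k} = i"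
    using nth_sorted_rank[OF assms(1) k] i len distinct_sorted_list_of_set[of S]
    by (metis nth_eq_iff_index_eq)
  then show "key S y ! i = u ! i" using assms(3)[OF k] i assms(1) by (simp add: key_def)
qed

lemma key_merge:
  assumes "S \<subseteq> {..<m}" "u \<in> points (card S)" shows "key S (merge m S u z) = u"
proof (rule key_eqI[OF finite_subset[OF assms(1)] assms(2)])
  fix k assume "k \<in> S"
  then show "merge m S u z ! k = u ! card {k' \<in> S. k' < k}" using assms(1) by (subst merge_nth) auto
qed simp

lemma proj_merge:
  assumes "S \<subseteq> {..<m}" "z \<in> points (m - card S)" shows "proj m S (merge m S u z) = z"
  unfolding proj_key
proof (rule key_eqI)
  fix k assume "k \<in> {..<m} - S"
  then show "merge m S u z ! k = z ! card {k' \<in> {..<m} - S. k' < k}" by (subst merge_nth) auto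
qed (use assms card_compl in auto)

lemma restr_RM:
  assumes f: "f \<in> RM m r" and S: "S \<subseteq> {..<m}"
  shows "restr m S f u \<in> RM (m - card S) r"
proof -
  have "restr m S f u = (\<lambda>z. z \<in> points (m - card S) \<and> f (merge m S u z))"
    by (auto simp: restr_def fun_eq_iff)
  also have "\<dots> \<in> RM (m - card S) r"
  proof (rule RM_comp[OF f])
    fix k assume k: "k < m"
    show "(\<lambda>z. z \<in> points (m - card S) \<and> merge m S u z ! k) \<in> RM (m - card S) 1"
    proof (cases "k \<in> S")
      case True
      then show ?thesis using k by (simp add: merge_nth RM_const)
    next
      case False
      then have "card {k' \<in> {..<m} - S. k' < k} < m - card S"
        using nth_sorted_rank(1)[of "{..<m} - S" k] k S by (simp add: card_compl)
      then show ?thesis using False k RM_coord[of _ "m - card S" 1] by (simp add: merge_nth)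
    qed
  qed simp
  finally show ?thesis .
qed

section \<open>Keys of a point with respect to a partition\<close>

lemma card_parts:
  assumes "balanced_partition m n P" shows "(\<Sum>j<n. card (P j)) = m"
proof -
  have "card (\<Union>j<n. P j) = (\<Sum>j<n. card (P j))"
    using assms unfolding balanced_partition_def
    by (intro card_UN_disjoint) (auto intro: finite_subset[of _ "{..<m}"])
  then show ?thesis using assms by (simp add: balanced_partition_def)
qed

lemma keys_inject:
  assumes P: "balanced_partition m n P" and y: "y \<in> points m" "y' \<in> points m"
    and keys: "\<And>j. j < n \<Longrightarrow> key (P j) y = key (P j) y'"
  shows "y = y'"
proof (rule points_eqI[OF y])
  fix k assume "k < m"
  then have "k \<in> (\<Union>j<n. P j)" using P by (simp add: balanced_partition_def)
  then obtain j where j: "j < n" "k \<in> P j" by auto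
  have "finite (P j)" using P j(1) by (auto simp: balanced_partition_def intro: finite_subset[of _ "{..<m}"])
  from nth_key[OF this j(2), of y] nth_key[OF this j(2), of y'] keys[OF j(1)] show "y ! k = y' ! k" by simp
qed

text \<open>A point is determined by its keys, so points embed into the product of the key cubes and
  the bad fractions of different parts multiply.\<close>

lemma card_bad_keys:
  fixes q :: real
  assumes P: "balanced_partition m n P" and J: "J \<subseteq> {..<n}" and q: "0 \<le> q"
    and F: "\<And>j. j < n \<Longrightarrow> F j \<subseteq> points (card (P j))" "\<And>j. j < n \<Longrightarrow> real (card (F j)) \<le> q * 2 ^ card (P j)"
  shows "real (card {y \<in> points m. \<forall>j\<in>J. key (P j) y \<in> F j}) \<le> q ^ card J * 2 ^ m"
proof -
  let ?G = "\<lambda>j. if j \<in> J then F j else points (card (P j))"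
  have finP: "finite (P j)" if "j < n" for j
    using P that by (auto simp: balanced_partition_def intro: finite_subset[of _ "{..<m}"])
  have finG: "finite (?G j)" if "j < n" for j using F(1)[OF that] finite_subset by auto
  have "card {y \<in> points m. \<forall>j\<in>J. key (P j) y \<in> F j} \<le> card (PiE {..<n} ?G)"
  proof (rule card_inj_on_le[of "\<lambda>y. \<lambda>j\<in>{..<n}. key (P j) y"])
    show "inj_on (\<lambda>y. \<lambda>j\<in>{..<n}. key (P j) y) {y \<in> points m. \<forall>j\<in>J. key (P j) y \<in> F j}"
    proof (rule inj_onI)
      fix y y' assume y: "y \<in> {y \<in> points m. \<forall>j\<in>J. key (P j) y \<in> F j}" "y' \<in> {y \<in> points m. \<forall>j\<in>J. key (P j) y \<in> F j}"
        and e: "(\<lambda>j\<in>{..<n}. key (P j) y) = (\<lambda>j\<in>{..<n}. key (P j) y')"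
      have "key (P j) y = key (P j) y'" if "j < n" for j
        using fun_cong[OF e, of j] that by simp
      then show "y = y'" using keys_inject[OF P] y by blast
    qed
    show "(\<lambda>y. \<lambda>j\<in>{..<n}. key (P j) y) ` {y \<in> points m. \<forall>j\<in>J. key (P j) y \<in> F j} \<subseteq> PiE {..<n} ?G"
      using finP by (intro image_subsetI restrict_PiE_iff[THEN iffD2]) (auto simp: key_points)
    show "finite (PiE {..<n} ?G)" using finG by (intro finite_PiE) auto
  qed
  also have "card (PiE {..<n} ?G) = (\<Prod>j<n. card (?G j))" by (simp add: card_PiE)
  finally have "real (card {y \<in> points m. \<forall>j\<in>J. key (P j) y \<in> F j}) \<le> real (\<Prod>j<n. card (?G j))"
    by (rule of_nat_mono)
  also have "\<dots> = (\<Prod>j<n. real (card (?G j)))" by simp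
  also have "\<dots> \<le> (\<Prod>j<n. (if j \<in> J then q else 1) * 2 ^ card (P j))"
    using F(2) by (intro prod_mono) auto
  also have "\<dots> = (\<Prod>j<n. if j \<in> J then q else 1) * 2 ^ (\<Sum>j<n. card (P j))"
    by (simp add: prod.distrib power_sum)
  also have "(\<Prod>j<n. if j \<in> J then q else 1) = q ^ card J"
    using J by (simp add: prod.If_cases Int_absorb1)
  finally show ?thesis by (simp add: card_parts[OF P])
qed

text \<open>A point is misjudged by the vote only if half of the keys are bad; the union over the sets of
  bad keys costs a factor of \<open>2 ^ n\<close>.\<close>
lemma card_majority_bad:
  fixes q :: real
  assumes P: "balanced_partition m n P" and q: "0 < q" "q \<le> 1"
    and F: "\<And>j. j < n \<Longrightarrow> F j \<subseteq> points (card (P j))" "\<And>j. j < n \<Longrightarrow> real (card (F j)) \<le> q * 2 ^ card (P j)"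
  shows "real (card {y \<in> points m. n \<le> 2 * card {j \<in> {..<n}. key (P j) y \<in> F j}}) \<le> 2 ^ n * q powr (n / 2) * 2 ^ m"
proof -
  let ?Js = "{J \<in> Pow {..<n}. n \<le> 2 * card J}"
  let ?B = "\<lambda>J. {y \<in> points m. \<forall>j\<in>J. key (P j) y \<in> F j}"
  have finJ: "finite ?Js" by simp
  have "{y \<in> points m. n \<le> 2 * card {j \<in> {..<n}. key (P j) y \<in> F j}} \<subseteq> (\<Union>J\<in>?Js. ?B J)"
  proof
    fix y assume "y \<in> {y \<in> points m. n \<le> 2 * card {j \<in> {..<n}. key (P j) y \<in> F j}}"
    then show "y \<in> (\<Union>J\<in>?Js. ?B J)" by (intro UN_I[of "{j \<in> {..<n}. key (P j) y \<in> F j}"]) auto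
  qed
  then have "card {y \<in> points m. n \<le> 2 * card {j \<in> {..<n}. key (P j) y \<in> F j}} \<le> card (\<Union>J\<in>?Js. ?B J)"
    by (intro card_mono finite_UN_I) auto
  also have "\<dots> \<le> (\<Sum>J\<in>?Js. card (?B J))" by (rule card_UN_le[OF finJ])
  finally have "real (card {y \<in> points m. n \<le> 2 * card {j \<in> {..<n}. key (P j) y \<in> F j}}) \<le> real (\<Sum>J\<in>?Js. card (?B J))"
    by (rule of_nat_mono)
  also have "\<dots> = (\<Sum>J\<in>?Js. real (card (?B J)))" by (rule of_nat_sum)
  also have "\<dots> \<le> (\<Sum>J\<in>?Js. q powr (n / 2) * 2 ^ m)"
  proof (rule sum_mono)
    fix J assume J: "J \<in> ?Js"
    have "real (card (?B J)) \<le> q ^ card J * 2 ^ m"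
      using J q F by (intro card_bad_keys[OF P]) auto
    also have "q ^ card J = q powr real (card J)" using q by (simp add: powr_realpow)
    also have "\<dots> \<le> q powr (n / 2)" using J q by (intro powr_mono') auto
    finally show "real (card (?B J)) \<le> q powr (n / 2) * 2 ^ m" by simp
  qed
  also have "\<dots> = real (card ?Js) * (q powr (n / 2) * 2 ^ m)" by simp
  also have "\<dots> \<le> 2 ^ n * (q powr (n / 2) * 2 ^ m)"
  proof (rule mult_right_mono)
    have "real (card ?Js) \<le> real (card (Pow {..<n}))" by (intro of_nat_mono card_mono) auto
    also have "\<dots> = 2 ^ n" by (simp add: card_Pow)
    finally show "real (card ?Js) \<le> 2 ^ n" .
  qed simp
  finally show ?thesis by simp
qed

section \<open>The runs of RMRec on the restrictions\<close>

context bsc begin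

lemma restr_received:
  "restr m S (received f Z) u = received (restr m S f u) {z \<in> points (m - card S). merge m S u z \<in> Z}"
  by (auto simp: restr_def received_def fun_eq_iff)

definition blocks :: "nat \<Rightarrow> (nat \<Rightarrow> nat set) \<Rightarrow> (nat \<times> point) set" where
  "blocks n P = {(j, u). j < n \<and> u \<in> points (card (P j))}"

definition decode_blocks :: "nat \<Rightarrow> nat \<Rightarrow> real \<Rightarrow> nat \<Rightarrow> (nat \<Rightarrow> nat set) \<Rightarrow> word \<Rightarrow> (nat \<times> point \<Rightarrow> word) pmf" where
  "decode_blocks m r c' n P ft = Pi_pmf (blocks n P) (\<lambda>_. False)
     (\<lambda>(j, u). RMRec (m - card (P j)) r eps (restr m (P j) ft u) c')"

definition bad_keys :: "nat \<Rightarrow> (nat \<Rightarrow> nat set) \<Rightarrow> word \<Rightarrow> (nat \<times> point \<Rightarrow> word) \<Rightarrow> nat \<Rightarrow> point set" where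
  "bad_keys m P f F j = {u \<in> points (card (P j)). F (j, u) \<noteq> restr m (P j) f u}"

lemma finite_blocks: "finite (blocks n P)"
proof -
  have "blocks n P = (SIGMA j:{..<n}. points (card (P j)))" by (auto simp: blocks_def)
  then show ?thesis by simp
qed

text \<open>Where fewer than half of the keys are bad the vote is strict and correct, whatever the
  coin tosses. With a fraction of at most \<open>q\<close> of bad keys in every part the voted word
  is thus within the list radius of \<open>f\<close>.\<close>

lemma RMRec2_success:
  fixes m r :: nat and c c' q :: real
  defines "n \<equiv> num_parts m c"
  assumes P: "balanced_partition m n P" and f: "f \<in> RM m r" and Z: "Z \<subseteq> points m" and q: "0 < q" "q \<le> 1"
    and nc: "\<not> confusable m r (2 powr (m - sqrt m * log 2 m)) Z"
    and few: "2 ^ n * q powr (n / 2) * 2 ^ m \<le> 2 powr (m - sqrt m * log 2 m) / 2"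
  shows "measure_pmf.prob (decode_blocks m r c' n P (received f Z)) {F. \<forall>j<n. real (card (bad_keys m P f F j)) \<le> q * 2 ^ card (P j)}
    \<le> pmf (RMRec2 m r eps (received f Z) c c' P) (Some f)"
  unfolding RMRec2_def Let_def n_def[symmetric] blocks_def[symmetric] decode_blocks_def
proof (rule pmf_bind_ge)
  let ?R = "2 powr (real m - sqrt (real m) * log 2 (real m))"
  fix F assume F: "F \<in> {F. \<forall>j<n. real (card (bad_keys m P f F j)) \<le> q * 2 ^ card (P j)}"
  let ?votes = "\<lambda>y. card {j\<in>{..<n}. F (j, key (P j) y) (proj m (P j) y)}"
  let ?p = "\<lambda>y. if n < 2 * ?votes y then return_pmf True
                 else if 2 * ?votes y < n then return_pmf False
                 else bernoulli_pmf (1/2)"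
  let ?Q = "\<lambda>fh. let L = {v\<in>RM m r. real (hdist m v fh) \<le> ?R / 2}
     in if L = {} then return_pmf None else map_pmf Some (pmf_of_set (best_agree m (received f Z) L))"
  let ?bad = "{y \<in> points m. n \<le> 2 * card {j \<in> {..<n}. key (P j) y \<in> bad_keys m P f F j}}"
  have Psub: "P j \<subseteq> {..<m}" if "j < n" for j using P that by (simp add: balanced_partition_def)
  have "real (card ?bad) \<le> 2 ^ n * q powr (n / 2) * 2 ^ m"
    using F by (intro card_majority_bad[OF P q]) (auto simp: bad_keys_def)
  then have bad: "real (card ?bad) \<le> ?R / 2" using few by linarith
  have one: "pmf (?Q fh) (Some f) = 1" if fh: "fh \<in> set_pmf (Pi_pmf (points m) False ?p)" for fh
  proof -
    have "{y \<in> points m. f y \<noteq> fh y} \<subseteq> ?bad"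
    proof
      fix y assume y: "y \<in> {y \<in> points m. f y \<noteq> fh y}"
      have "fh y \<in> set_pmf (?p y)"
        using fh y set_Pi_pmf[OF finite_points[of m], of False ?p] by (auto simp: PiE_dflt_def)
      let ?G = "{j \<in> {..<n}. key (P j) y \<notin> bad_keys m P f F j}"
      let ?H = "{j \<in> {..<n}. key (P j) y \<in> bad_keys m P f F j}"
      let ?V = "{j\<in>{..<n}. F (j, key (P j) y) (proj m (P j) y)}"
      have val: "F (j, key (P j) y) (proj m (P j) y) = f y" if "j \<in> ?G" for j
      proof -
        have Pj: "P j \<subseteq> {..<m}" using Psub that by auto
        then have "key (P j) y \<in> points (card (P j))" by (intro key_points) (auto intro: finite_subset)
        then have "F (j, key (P j) y) = restr m (P j) f (key (P j) y)" using that by (auto simp: bad_keys_def)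
        then show ?thesis using proj_points[OF Pj, of y] merge_key_proj[OF Pj] y by (simp add: restr_def)
      qed
      have "?G \<union> ?H = {..<n}" by auto
      then have GH: "card ?G + card ?H = n" by (subst card_Un_disjoint[symmetric]) auto
      have "n \<le> 2 * card ?H"
      proof (rule ccontr)
        assume "\<not> n \<le> 2 * card ?H"
        then have H: "2 * card ?H < n" by simp
        have "fh y = f y"
        proof (cases "f y")
          case True
          then have "?G \<subseteq> ?V" using val by auto
          then have "card ?G \<le> card ?V" by (intro card_mono) auto
          then have "n < 2 * card ?V" using GH H by linarith
          then show ?thesis using \<open>fh y \<in> set_pmf (?p y)\<close> True by simp
        next
          case False
          then have "?V \<subseteq> ?H" using val by auto
          then have "card ?V \<le> card ?H" by (intro card_mono) auto
          then have "2 * card ?V < n" using H by linarith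
          then show ?thesis using \<open>fh y \<in> set_pmf (?p y)\<close> False by simp
        qed
        then show False using y by simp
      qed
      then show "y \<in> ?bad" using y by simp
    qed
    then have "card {y \<in> points m. f y \<noteq> fh y} \<le> card ?bad" by (intro card_mono) auto
    then have "real (hdist m f fh) \<le> real (card ?bad)" by (simp add: hdist_def)
    then have near: "real (hdist m f fh) \<le> ?R / 2" using bad by linarith
    let ?L = "{v\<in>RM m r. real (hdist m v fh) \<le> ?R / 2}"
    have fL: "f \<in> ?L" using near f by simp
    have "v \<in> RM m r \<and> real (hdist m v f) \<le> ?R" if "v \<in> ?L" for v
    proof -
      have "real (hdist m v f) \<le> real (hdist m v fh) + real (hdist m fh f)"
        using hdist_triangle[of m v f fh] by (simp flip: of_nat_add)
      then show ?thesis using that near by (simp add: hdist_commute)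
    qed
    from best_agree_unique[OF f Z nc fL this] have "best_agree m (received f Z) ?L = {f}" by blast
    moreover have "?L \<noteq> {}" using fL by blast
    ultimately show ?thesis
      unfolding Let_def by (simp only: if_False) (simp add: pmf_of_set_singleton map_return_pmf)
  qed
  have "1 \<le> pmf (bind_pmf (Pi_pmf (points m) False ?p) ?Q) (Some f)"
    using pmf_bind_ge[of "Pi_pmf (points m) False ?p" UNIV ?Q "Some f"] one by simp
  then show "pmf (bind_pmf (Pi_pmf (points m) False ?p) (\<lambda>fh. if {v\<in>RM m r. real (hdist m v fh) \<le> ?R / 2} = {} then return_pmf None
     else map_pmf Some (pmf_of_set (best_agree m (received f Z) {v\<in>RM m r. real (hdist m v fh) \<le> ?R / 2})))) (Some f) = 1"
    unfolding Let_def by (rule antisym[OF pmf_le_1])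
qed

text \<open>For fixed noise the runs on different blocks use independent coins, so their failure
  probabilities multiply.\<close>

lemma prob_all_bad:
  assumes j: "j < n" and T: "T \<subseteq> points (card (P j))"
  shows "measure_pmf.prob (decode_blocks m r c' n P (received f Z)) {F. T \<subseteq> bad_keys m P f F j} =
    (\<Prod>u\<in>T. rec_fail (m - card (P j)) r c' (restr m (P j) f u) {z \<in> points (m - card (P j)). merge m (P j) u z \<in> Z})"
proof -
  let ?p = "\<lambda>(j, u). RMRec (m - card (P j)) r eps (restr m (P j) (received f Z) u) c'"
  let ?B = "\<lambda>i. if i \<in> Pair j ` T then - {restr m (P j) f (snd i)} else UNIV"
  have fin: "finite T" using T finite_subset by auto
  have sub: "Pair j ` T \<subseteq> blocks n P" using j T by (auto simp: blocks_def)
  have "{F. T \<subseteq> bad_keys m P f F j} = Pi (blocks n P) ?B"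
    using sub T by (fastforce simp: bad_keys_def Pi_def)
  then have "measure_pmf.prob (decode_blocks m r c' n P (received f Z)) {F. T \<subseteq> bad_keys m P f F j} =
      (\<Prod>i\<in>blocks n P. measure_pmf.prob (?p i) (?B i))"
    unfolding decode_blocks_def by (simp only: measure_Pi_pmf_Pi[OF finite_blocks])
  also have "\<dots> = (\<Prod>i\<in>Pair j ` T. measure_pmf.prob (?p i) (?B i))"
    using sub finite_blocks by (intro prod.mono_neutral_right) auto
  also have "\<dots> = (\<Prod>u\<in>T. measure_pmf.prob (?p (j, u)) (?B (j, u)))"
    by (simp add: prod.reindex inj_on_def)
  also have "\<dots> = (\<Prod>u\<in>T. rec_fail (m - card (P j)) r c' (restr m (P j) f u) {z \<in> points (m - card (P j)). merge m (P j) u z \<in> Z})"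
  proof (rule prod.cong[OF refl])
    fix u assume "u \<in> T"
    then have "measure_pmf.prob (?p (j, u)) (?B (j, u)) = 1 - pmf (?p (j, u)) (restr m (P j) f u)"
      using measure_pmf.prob_compl[of "{restr m (P j) f u}" "?p (j, u)"]
      by (simp add: Compl_eq_Diff_UNIV measure_pmf_single)
    then show "measure_pmf.prob (?p (j, u)) (?B (j, u)) =
      rec_fail (m - card (P j)) r c' (restr m (P j) f u) {z \<in> points (m - card (P j)). merge m (P j) u z \<in> Z}"
      by (simp add: rec_fail_def restr_received)
  qed
  finally show ?thesis .
qed

text \<open>The key can be read off a point, so blocks with different keys see disjoint sets of
  noise bits and the average over the noise factors as well.\<close>

lemma E_all_bad:
  fixes p :: real
  assumes S: "S \<subseteq> {..<m}" and T: "T \<subseteq> points (card S)"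
    and p: "\<And>u. u \<in> T \<Longrightarrow> E (points (m - card S)) (rec_fail (m - card S) r c' (restr m S f u)) \<le> p"
  shows "E (points m) (\<lambda>Z. \<Prod>u\<in>T. rec_fail (m - card S) r c' (restr m S f u) {z \<in> points (m - card S). merge m S u z \<in> Z})
    \<le> p ^ card T"
proof -
  let ?n = "m - card S"
  let ?h = "\<lambda>u Z. rec_fail ?n r c' (restr m S f u) {z \<in> points ?n. merge m S u z \<in> Z}"
  have fin: "finite T" using T finite_subset by auto
  have inj: "inj_on (merge m S u) (points ?n)" for u
    using proj_merge[OF S] by (metis inj_onI)
  have "E (points m) (\<lambda>Z. \<Prod>u\<in>T. ?h u Z) = E (points m) (\<lambda>Z. \<Prod>u\<in>T. ?h u (Z \<inter> merge m S u ` points ?n))"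
    by (intro E_cong prod.cong refl arg_cong[of _ _ "rec_fail ?n r c' _"]) auto
  also have "\<dots> = (\<Prod>u\<in>T. E (merge m S u ` points ?n) (?h u))"
  proof (rule E_indep[OF fin])
    fix u u' assume u: "u \<in> T" "u' \<in> T" "u \<noteq> u'"
    show "merge m S u ` points ?n \<inter> merge m S u' ` points ?n = {}"
    proof (rule ccontr)
      assume "\<not> ?thesis"
      then obtain z z' where "merge m S u z = merge m S u' z'" by auto
      then have "key S (merge m S u z) = key S (merge m S u' z')" by simp
      then show False using u T by (auto simp: key_merge[OF S] subset_iff)
    qed
  qed auto
  also have "\<dots> \<le> (\<Prod>u\<in>T. p)"
  proof (rule prod_mono, intro conjI)
    fix u assume u: "u \<in> T"
    show "0 \<le> E (merge m S u ` points ?n) (?h u)" by (intro E_nonneg rec_fail_bounds)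
    have "E (merge m S u ` points ?n) (?h u) = E (points ?n) (\<lambda>Z. ?h u (merge m S u ` Z))"
      by (rule E_image[OF inj])
    also have "\<dots> = E (points ?n) (rec_fail ?n r c' (restr m S f u))"
    proof (rule E_cong)
      fix Z assume "Z \<subseteq> points ?n"
      then have "{z \<in> points ?n. merge m S u z \<in> merge m S u ` Z} = Z"
        using inj[of u] by (auto simp: inj_on_def)
      then show "?h u (merge m S u ` Z) = rec_fail ?n r c' (restr m S f u) Z" by simp
    qed
    also have "\<dots> \<le> p" by (rule p[OF u])
    finally show "E (merge m S u ` points ?n) (?h u) \<le> p" .
  qed
  finally show ?thesis by simp
qed

text \<open>Different keys of the same part see disjoint sets of noise bits, so the number of failing blocks is
  controlled by a union bound over sets of \<open>s\<close> failing blocks.\<close>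
lemma E_many_bad:
  fixes p q :: real
  assumes j: "j < n" and S: "P j \<subseteq> {..<m}" and q: "0 \<le> q" and p: "0 < p" "p \<le> 1"
    and fail: "\<And>u. u \<in> points (card (P j)) \<Longrightarrow> E (points (m - card (P j))) (rec_fail (m - card (P j)) r c' (restr m (P j) f u)) \<le> p"
  shows "E (points m) (\<lambda>Z. measure_pmf.prob (decode_blocks m r c' n P (received f Z))
      {F. q * 2 ^ card (P j) < real (card (bad_keys m P f F j))}) \<le> 2 ^ (2 ^ card (P j)) * p powr (q * 2 ^ card (P j))"
proof -
  let ?D = "\<lambda>Z. decode_blocks m r c' n P (received f Z)"
  let ?B = "2 ^ card (P j) :: nat"
  \<comment> \<open>The least integer above \<open>q * 2 ^ card (P j)\<close>: a part with too many
    bad keys contains a set of exactly \<open>s\<close> of them.\<close>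
  define s where "s = nat \<lfloor>q * 2 ^ card (P j)\<rfloor> + 1"
  have s1: "q * 2 ^ card (P j) \<le> real s" unfolding s_def using q by linarith
  have s2: "s \<le> k" if "q * 2 ^ card (P j) < real k" for k
  proof -
    have "0 \<le> q * 2 ^ card (P j)" using q by simp
    then show ?thesis unfolding s_def using that by linarith
  qed
  let ?Ts = "{T \<in> Pow (points (card (P j))). card T = s}"
  have finT: "finite ?Ts" by simp
  have "E (points m) (\<lambda>Z. measure_pmf.prob (?D Z) {F. q * 2 ^ card (P j) < real (card (bad_keys m P f F j))}) \<le>
    E (points m) (\<lambda>Z. \<Sum>T\<in>?Ts. measure_pmf.prob (?D Z) {F. T \<subseteq> bad_keys m P f F j})"
  proof (rule E_mono)
    fix Z
    have "measure_pmf.prob (?D Z) {F. q * 2 ^ card (P j) < real (card (bad_keys m P f F j))} \<le>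
      measure_pmf.prob (?D Z) (\<Union>T\<in>?Ts. {F. T \<subseteq> bad_keys m P f F j})"
    proof (intro measure_pmf.finite_measure_mono)
      show "{F. q * 2 ^ card (P j) < real (card (bad_keys m P f F j))} \<subseteq> (\<Union>T\<in>?Ts. {F. T \<subseteq> bad_keys m P f F j})"
      proof
        fix F assume "F \<in> {F. q * 2 ^ card (P j) < real (card (bad_keys m P f F j))}"
        then have "s \<le> card (bad_keys m P f F j)" using s2 by simp
        then obtain T where "T \<subseteq> bad_keys m P f F j" "card T = s" by (rule obtain_subset_with_card_n)
        moreover from this have "T \<in> ?Ts" by (auto simp: bad_keys_def)
        ultimately show "F \<in> (\<Union>T\<in>?Ts. {F. T \<subseteq> bad_keys m P f F j})" by blast
      qed
    qed simp
    also have "\<dots> \<le> (\<Sum>T\<in>?Ts. measure_pmf.prob (?D Z) {F. T \<subseteq> bad_keys m P f F j})"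
      using finT by (intro measure_pmf.finite_measure_subadditive_finite) auto
    finally show "measure_pmf.prob (?D Z) {F. q * 2 ^ card (P j) < real (card (bad_keys m P f F j))} \<le>
      (\<Sum>T\<in>?Ts. measure_pmf.prob (?D Z) {F. T \<subseteq> bad_keys m P f F j})" .
  qed
  also have "\<dots> = (\<Sum>T\<in>?Ts. E (points m) (\<lambda>Z. measure_pmf.prob (?D Z) {F. T \<subseteq> bad_keys m P f F j}))"
    by (rule E_sum)
  also have "\<dots> \<le> (\<Sum>T\<in>?Ts. p powr (q * 2 ^ card (P j)))"
  proof (rule sum_mono)
    fix T assume T: "T \<in> ?Ts"
    have "E (points m) (\<lambda>Z. measure_pmf.prob (?D Z) {F. T \<subseteq> bad_keys m P f F j}) \<le> p ^ card T"
      using T fail by (subst prob_all_bad[OF j]) (auto intro!: E_all_bad[OF S])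
    also have "\<dots> = p powr real s" using T p by (simp add: powr_realpow)
    also have "\<dots> \<le> p powr (q * 2 ^ card (P j))" using p s1 by (intro powr_mono') auto
    finally show "E (points m) (\<lambda>Z. measure_pmf.prob (?D Z) {F. T \<subseteq> bad_keys m P f F j}) \<le> p powr (q * 2 ^ card (P j))" .
  qed
  also have "\<dots> = real (card ?Ts) * p powr (q * 2 ^ card (P j))" by simp
  also have "\<dots> \<le> 2 ^ ?B * p powr (q * 2 ^ card (P j))"
  proof (rule mult_right_mono)
    have "real (card ?Ts) \<le> real (card (Pow (points (card (P j)))))" by (intro of_nat_mono card_mono) auto
    also have "\<dots> = 2 ^ ?B" by (simp add: card_Pow)
    finally show "real (card ?Ts) \<le> 2 ^ ?B" .
  qed simp
  finally show ?thesis .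
qed

lemma success_prob_ge:
  assumes "\<And>f. f \<in> RM m r \<Longrightarrow> E (points m) (\<lambda>Z. 1 - pmf (RMRec2 m r eps (received f Z) c c' P) (Some f)) \<le> B"
  shows "1 - success_prob m r eps c c' P \<le> B"
proof -
  have ne: "RM m r \<noteq> {}" using RM_zero by blast
  have fin: "finite (RM m r)" by (rule RM_card)
  let ?in = "\<lambda>f. bind_pmf (noise (points m)) (\<lambda>e. map_pmf (\<lambda>out. out = Some f) (RMRec2 m r eps (\<lambda>x. f x \<noteq> e x) c c' P))"
  have inner: "1 - B \<le> pmf (?in f) True" if f: "f \<in> RM m r" for f
  proof -
    have t: "pmf (map_pmf (\<lambda>out. out = Some f) Q) True = pmf Q (Some f)" for Q
    proof -
      have "(\<lambda>out. out = Some f) -` {True} = {Some f}" by auto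
      then show ?thesis by (simp add: pmf_map measure_pmf_single)
    qed
    have "pmf (?in f) True = E (points m) (\<lambda>Z. pmf (RMRec2 m r eps (received f Z) c c' P) (Some f))"
      by (simp add: pmf_bind t expectation_noise received_def)
    moreover have "E (points m) (\<lambda>Z. 1 - pmf (RMRec2 m r eps (received f Z) c c' P) (Some f)) =
      1 - E (points m) (\<lambda>Z. pmf (RMRec2 m r eps (received f Z) c c' P) (Some f))"
      by (simp add: E_diff)
    ultimately show ?thesis using assms[OF f] by simp
  qed
  have "success_prob m r eps c c' P = (\<Sum>f\<in>RM m r. pmf (?in f) True) / card (RM m r)"
    unfolding success_prob_def pmf_bind[of "pmf_of_set (RM m r)"] using ne fin by (rule integral_pmf_of_set)
  also have "\<dots> \<ge> (\<Sum>f\<in>RM m r. 1 - B) / card (RM m r)"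
    using inner by (intro divide_right_mono sum_mono) auto
  moreover have "(\<Sum>f\<in>RM m r. 1 - B) / card (RM m r) = 1 - B" using ne fin by simp
  ultimately show ?thesis by simp
qed


section \<open>Parameters of RMRec2\<close>

lemma part_sizes:
  assumes P: "balanced_partition m n P" and j: "j < n"
  shows "real n * real (card (P j)) \<le> real m + real n" "real m \<le> real n * (real (card (P j)) + 1)"
proof -
  have "(\<Sum>k<n. card (P j)) \<le> (\<Sum>k<n. card (P k) + 1)"
    using P j by (intro sum_mono) (auto simp: balanced_partition_def)
  also have "\<dots> = m + n" unfolding sum.distrib card_parts[OF P] by simp
  finally have "n * card (P j) \<le> m + n" by simp
  then show "real n * real (card (P j)) \<le> real m + real n" by (metis of_nat_add of_nat_le_iff of_nat_mult)
  have "(\<Sum>k<n. card (P k)) \<le> (\<Sum>k<n. card (P j) + 1)"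
    using P j by (intro sum_mono) (auto simp: balanced_partition_def)
  then have "m \<le> n * (card (P j) + 1)" by (simp add: card_parts[OF P])
  then show "real m \<le> real n * (real (card (P j)) + 1)" by (metis of_nat_1 of_nat_add of_nat_le_iff of_nat_mult)
qed

lemma RMRec2_fail:
  fixes m r :: nat and c c' q :: real
  defines "n \<equiv> num_parts m c"
  assumes P: "balanced_partition m n P" and f: "f \<in> RM m r" and q: "0 < q" "q \<le> 1"
    and few: "2 ^ n * q powr (n / 2) * 2 ^ m \<le> 2 powr (m - sqrt m * log 2 m) / 2"
  shows "E (points m) (\<lambda>Z. 1 - pmf (RMRec2 m r eps (received f Z) c c' P) (Some f)) \<le>
    E (points m) (\<lambda>Z. of_bool (confusable m r (2 powr (m - sqrt m * log 2 m)) Z)) +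
    (\<Sum>j<n. E (points m) (\<lambda>Z. measure_pmf.prob (decode_blocks m r c' n P (received f Z))
      {F. q * 2 ^ card (P j) < real (card (bad_keys m P f F j))}))"
  unfolding E_sum[symmetric] E_add[symmetric]
proof (rule E_mono)
  fix Z assume Z: "Z \<subseteq> points m"
  let ?D = "decode_blocks m r c' n P (received f Z)"
  let ?bad = "\<lambda>j. {F. q * 2 ^ card (P j) < real (card (bad_keys m P f F j))}"
  let ?G = "{F. \<forall>j<n. real (card (bad_keys m P f F j)) \<le> q * 2 ^ card (P j)}"
  let ?C = "confusable m r (2 powr (m - sqrt m * log 2 m)) Z"
  have nn: "0 \<le> (\<Sum>j<n. measure_pmf.prob ?D (?bad j))" by (intro sum_nonneg) simp
  show "1 - pmf (RMRec2 m r eps (received f Z) c c' P) (Some f) \<le> of_bool ?C + (\<Sum>j<n. measure_pmf.prob ?D (?bad j))"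
  proof (cases ?C)
    case True
    have "0 \<le> pmf (RMRec2 m r eps (received f Z) c c' P) (Some f)" by (rule pmf_nonneg)
    then show ?thesis using True nn by (simp only: of_bool_eq)
  next
    case False
    have "measure_pmf.prob ?D ?G \<le> pmf (RMRec2 m r eps (received f Z) c c' P) (Some f)"
      using P f Z q False few unfolding n_def by (rule RMRec2_success)
    moreover have "1 - measure_pmf.prob ?D ?G = measure_pmf.prob ?D (- ?G)"
      using measure_pmf.prob_compl[of ?G ?D] by (simp add: Compl_eq_Diff_UNIV)
    moreover have "- ?G = (\<Union>j\<in>{..<n}. ?bad j)" by (auto simp: not_le)
    moreover have "measure_pmf.prob ?D (\<Union>j\<in>{..<n}. ?bad j) \<le> (\<Sum>j<n. measure_pmf.prob ?D (?bad j))"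
      by (intro measure_pmf.finite_measure_subadditive_finite) auto
    ultimately show ?thesis using False by simp
  qed
qed

lemma RMRec2_asymp:
  assumes eta: "0 < eta"
  shows "\<exists>c c' c''. 0 < c \<and> 0 < c' \<and> 0 < c'' \<and> (\<exists>m0. \<forall>m\<ge>m0. \<forall>r P.
    rate m r \<le> 1 - bin_entropy eps - eta \<longrightarrow> balanced_partition m (num_parts m c) P \<longrightarrow>
    1 - success_prob m r eps c c' P \<le> 2 powr (- (2 powr (c'' * sqrt m))))"
proof -
  obtain c' M0 where c': "0 < c'" and M0: "\<And>M r f. M0 \<le> M \<Longrightarrow> rate M r \<le> 1 - bin_entropy eps - eta / 2 \<Longrightarrow> f \<in> RM M r \<Longrightarrow>
      E (points M) (rec_fail M r c' f) \<le> 2 powr (- (c' / 4 * (sqrt M * log 2 M)))"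
  proof -
    have "0 < eta / 2" using eta by simp
    then show ?thesis using rec_fail_asymp[of "eta / 2"] that by blast
  qed
  obtain M1 where M1: "\<And>M r. M1 \<le> M \<Longrightarrow> rate M r \<le> 1 - eta \<Longrightarrow>
    E (points M) (\<lambda>Z. of_bool (confusable M r (2 powr (M - sqrt M * log 2 M)) Z)) \<le> 2 powr (- (2 powr (M / 4)))"
    using confusable_asymp[OF eta, of 1] by (simp only: mult_1 zero_less_one) blast
  \<comment> \<open>\<open>eta / 8\<close> keeps the restricted codes, which lose at most
    \<open>c * sqrt m + 1\<close> variables, a gap of \<open>eta / 2\<close> below capacity. The 1/8
    makes the number \<open>n\<close> of parts at least \<open>8 * sqrt m\<close>, as the list
    radius demands.\<close>
  define c where "c = min (1 / 8) (eta / 8)"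
  have c: "0 < c" "c \<le> 1 / 8" "c \<le> eta / 8" using eta by (auto simp: c_def)
  have "eventually (\<lambda>x::real. c * sqrt x + 1 \<le> x / 2) at_top" using c by real_asymp
  moreover have "eventually (\<lambda>x::real. c * sqrt x + 1 \<le> 2 * c * sqrt (x / 2)) at_top"
  proof -
    have "eventually (\<lambda>x::real. c * sqrt x + 1 \<le> 2 * c * (2 / 3 * sqrt x)) at_top" using c by real_asymp
    then show ?thesis using eventually_ge_at_top[of "0::real"]
    proof eventually_elim
      case (elim x)
      have "2 / 3 * sqrt x \<le> sqrt (x / 2)"
        using elim(2) by (intro real_le_rsqrt) (simp add: power_mult_distrib power2_eq_square)
      then have "2 * c * (2 / 3 * sqrt x) \<le> 2 * c * sqrt (x / 2)" using c by (intro mult_left_mono) auto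
      then show ?case using elim(1) by linarith
    qed
  qed
  moreover have "eventually (\<lambda>x::real. c * sqrt x / 2 \<le> x / (sqrt x / c + 1) - 1) at_top" using c by real_asymp
  moreover have "eventually (\<lambda>x::real. 2 \<le> c' / 4 * (sqrt (x / 2) * log 2 (x / 2)) * (x powr (-(1/4)) / 16)) at_top" using c' by real_asymp
  moreover have "eventually (\<lambda>x::real. log 2 (sqrt x / c + 2) + 2 powr (c / 4 * sqrt x) \<le> 2 powr (c * sqrt x / 2)) at_top" using c by real_asymp
  moreover have "eventually (\<lambda>x::real. max (max 2 (2 * real M0)) (real M1) \<le> x) at_top" by (rule eventually_ge_at_top)
  ultimately have "eventually (\<lambda>x::real. c * sqrt x + 1 \<le> x / 2 \<and> c * sqrt x + 1 \<le> 2 * c * sqrt (x / 2) \<and>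
     c * sqrt x / 2 \<le> x / (sqrt x / c + 1) - 1 \<and>
     2 \<le> c' / 4 * (sqrt (x / 2) * log 2 (x / 2)) * (x powr (-(1/4)) / 16) \<and>
     log 2 (sqrt x / c + 2) + 2 powr (c / 4 * sqrt x) \<le> 2 powr (c * sqrt x / 2) \<and>
     max (max 2 (2 * real M0)) (real M1) \<le> x) at_top"
    by (simp only: eventually_conj_iff)
  from eventually_compose_filterlim[OF this filterlim_real_sequentially]
  obtain m0 where m0: "\<And>m. m0 \<le> m \<Longrightarrow> c * sqrt m + 1 \<le> real m / 2 \<and> c * sqrt m + 1 \<le> 2 * c * sqrt (real m / 2) \<and>
     c * sqrt m / 2 \<le> real m / (sqrt m / c + 1) - 1 \<and>
     2 \<le> c' / 4 * (sqrt (real m / 2) * log 2 (real m / 2)) * (real m powr (-(1/4)) / 16) \<and>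
     log 2 (sqrt m / c + 2) + 2 powr (c / 4 * sqrt m) \<le> 2 powr (c * sqrt m / 2) \<and>
     max (max 2 (2 * real M0)) (real M1) \<le> real m"
    unfolding eventually_sequentially by blast
  have "1 - success_prob m r eps c c' P \<le> 2 powr (- (2 powr (c / 4 * sqrt m)))"
    if m: "m0 \<le> m" and rt: "rate m r \<le> 1 - bin_entropy eps - eta" and P: "balanced_partition m (num_parts m c) P" for m r P
  proof (rule success_prob_ge)
    fix f assume f: "f \<in> RM m r"
    from m0[OF m] have e1: "c * sqrt m + 1 \<le> real m / 2" and e2: "c * sqrt m + 1 \<le> 2 * c * sqrt (real m / 2)"
      and e3: "c * sqrt m / 2 \<le> real m / (sqrt m / c + 1) - 1"
      and e4: "2 \<le> c' / 4 * (sqrt (real m / 2) * log 2 (real m / 2)) * (real m powr (-(1/4)) / 16)"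
      and e5: "log 2 (sqrt m / c + 2) + 2 powr (c / 4 * sqrt m) \<le> 2 powr (c * sqrt m / 2)"
      and e6: "2 \<le> real m" "2 * real M0 \<le> real m" "real M1 \<le> real m" by auto
    define n where "n = num_parts m c"
    have n1: "sqrt m / c \<le> real n" unfolding n_def num_parts_def by linarith
    have "0 \<le> sqrt m / c" using c by simp
    then have n2: "real n \<le> sqrt m / c + 1" unfolding n_def num_parts_def by linarith
    have sc: "0 < sqrt m / c" using e6 c by simp
    then have n0: "0 < real n" using n1 by linarith
    have P': "balanced_partition m n P" using P by (simp add: n_def)
    have hi: "real (card (P j)) \<le> c * sqrt m + 1" if "j < n" for j
    proof -
      have "real (card (P j)) - 1 \<le> real m / real n"
        using part_sizes(1)[OF P' that] n0 by (simp add: field_simps)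
      also have "\<dots> \<le> real m / (sqrt m / c)" using n1 sc by (intro frac_le) auto
      also have "\<dots> = c * sqrt m" using e6 c by (simp add: field_simps)
      finally show ?thesis by simp
    qed
    have lo: "c * sqrt m / 2 \<le> real (card (P j))" if "j < n" for j
    proof -
      note e3
      also have "real m / (sqrt m / c + 1) \<le> real m / real n" using n2 n0 by (intro frac_le) auto
      also have "real m / real n \<le> real (card (P j)) + 1"
        using part_sizes(2)[OF P' that] n0 by (simp add: field_simps)
      finally show ?thesis by simp
    qed
    \<comment> \<open>\<open>q\<close> must be small enough that \<open>q powr (n / 2)\<close>
      reaches the list radius, and large enough that \<open>p powr q\<close> is at most 1/4, where
      \<open>- log 2 p\<close> is of order \<open>sqrt m * log m\<close>. The 1/16 pays for the
      \<open>2 ^ n\<close> sets of bad parts.\<close>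
    define q where "q = real m powr (-(1/4)) / 16"
    have q0: "0 < q" using e6 by (simp add: q_def)
    have qlog: "q = 2 powr (- (log 2 m / 4) - 4)"
    proof -
      have "real m powr (-(1/4)) = (2 powr (log 2 m)) powr (-(1/4))" using e6 by simp
      also have "\<dots> = 2 powr (- (log 2 m / 4))" by (simp add: powr_powr)
      finally show ?thesis by (simp add: q_def powr_diff)
    qed
    have lm: "0 \<le> log 2 m" using e6 by simp
    then have "q \<le> 2 powr 0" unfolding qlog by (intro powr_mono) auto
    then have q1: "q \<le> 1" by simp
    have few: "2 ^ n * q powr (n / 2) * 2 ^ m \<le> 2 powr (m - sqrt m * log 2 m) / 2"
    proof -
      have "2 ^ n * q powr (n / 2) * 2 ^ m = 2 powr real n * 2 powr ((- (log 2 m / 4) - 4) * (n / 2)) * 2 powr real m"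
        unfolding qlog by (simp only: powr_powr powr_realpow zero_less_numeral)
      also have "\<dots> = 2 powr (real n + (- (log 2 m / 4) - 4) * (n / 2) + real m)"
        by (simp only: powr_add)
      also have "real n + (- (log 2 m / 4) - 4) * (n / 2) + real m = real m - real n - real n / 8 * log 2 m"
        by (simp add: field_simps)
      also have "2 powr (real m - real n - real n / 8 * log 2 m) \<le> 2 powr (real m - sqrt m * log 2 m - 1)"
      proof -
        have "sqrt m * (c * 8) \<le> sqrt m * 1" using c by (intro mult_left_mono) auto
        then have "sqrt m \<le> sqrt m / c / 8" using c by (simp add: field_simps)
        also have "\<dots> \<le> real n / 8" using n1 by simp
        finally have "sqrt m * log 2 m \<le> real n / 8 * log 2 m" using e6 by (intro mult_right_mono) auto
        moreover have "1 \<le> real n" using n0 by simp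
        ultimately show ?thesis by simp
      qed
      also have "\<dots> = 2 powr (m - sqrt m * log 2 m) / 2" by (simp add: powr_diff)
      finally show ?thesis .
    qed
    define p where "p = 2 powr (- (c' / 4 * (sqrt (real m / 2) * log 2 (real m / 2))))"
    have "p \<le> 2 powr 0" unfolding p_def using c' e6 by (intro powr_mono) auto
    then have p: "0 < p" "p \<le> 1" by (auto simp: p_def)
    have each: "E (points m) (\<lambda>Z. measure_pmf.prob (decode_blocks m r c' n P (received f Z))
        {F. q * 2 ^ card (P j) < real (card (bad_keys m P f F j))}) \<le> 2 powr (- (2 powr (c * sqrt m / 2)))"
      if j: "j < n" for j
    proof -
      define s where "s = card (P j)"
      have S: "P j \<subseteq> {..<m}" using P' j by (simp add: balanced_partition_def)
      have sm: "s \<le> m" using card_mono[OF _ S] by (simp add: s_def)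
      have M: "real m / 2 \<le> real (m - s)" using hi[OF j] e1 sm by (simp add: s_def)
      have Mpos: "0 < m - s" using M e6 by linarith
      have "rate (m - s) r \<le> rate m r + real s / sqrt (m - s)"
        using rate_shrink[OF Mpos, of r s] sm by simp
      also have "real s / sqrt (m - s) \<le> eta / 2"
      proof -
        have "real s \<le> 2 * c * sqrt (real m / 2)" using hi[OF j] e2 by (simp add: s_def)
        also have "\<dots> \<le> 2 * c * sqrt (m - s)" using M c by (intro mult_left_mono) auto
        also have "\<dots> \<le> eta / 2 * sqrt (m - s)" using c eta by (intro mult_right_mono) auto
        finally show ?thesis using Mpos by (simp add: divide_le_eq)
      qed
      finally have rM: "rate (m - s) r \<le> 1 - bin_entropy eps - eta / 2" using rt by simp
      have fail: "E (points (m - s)) (rec_fail (m - s) r c' (restr m (P j) f u)) \<le> p" for u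
      proof -
        have "M0 \<le> m - s" using M e6 by linarith
        moreover have "restr m (P j) f u \<in> RM (m - s) r" unfolding s_def by (rule restr_RM[OF f S])
        ultimately have "E (points (m - s)) (rec_fail (m - s) r c' (restr m (P j) f u)) \<le> 2 powr (- (c' / 4 * (sqrt (m - s) * log 2 (m - s))))"
          using rM by (intro M0)
        also have "\<dots> \<le> p"
        proof -
          have "sqrt (real m / 2) * log 2 (real m / 2) \<le> sqrt (m - s) * log 2 (m - s)"
            using M e6 by (intro mult_mono) auto
          then have "c' / 4 * (sqrt (real m / 2) * log 2 (real m / 2)) \<le> c' / 4 * (sqrt (m - s) * log 2 (m - s))"
            using c' by (intro mult_left_mono) auto
          then show ?thesis unfolding p_def by (intro powr_mono) auto
        qed
        finally show ?thesis .
      qed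
      have "E (points m) (\<lambda>Z. measure_pmf.prob (decode_blocks m r c' n P (received f Z))
        {F. q * 2 ^ card (P j) < real (card (bad_keys m P f F j))}) \<le> 2 ^ (2 ^ card (P j)) * p powr (q * 2 ^ card (P j))"
        by (rule E_many_bad[where P = P and j = j, OF j S]) (use fail q0 p in \<open>auto simp: s_def\<close>)
      also have "\<dots> = 2 powr (2 ^ s - c' / 4 * (sqrt (real m / 2) * log 2 (real m / 2)) * q * 2 ^ s)"
      proof -
        have "p powr (q * 2 ^ s) = 2 powr (- (c' / 4 * (sqrt (real m / 2) * log 2 (real m / 2)) * q * 2 ^ s))"
          unfolding p_def by (simp only: powr_powr) (simp add: mult.assoc)
        moreover have "(2::real) ^ (2 ^ s) = 2 powr (2 ^ s)" using powr_realpow[of 2 "2 ^ s"] by simp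
        ultimately show ?thesis by (simp only: s_def[symmetric]) (simp only: powr_add[symmetric] diff_conv_add_uminus)
      qed
      \<comment> \<open>\<open>p powr q <= 1/4\<close> outweighs the \<open>2 ^ 2 ^ s\<close> sets
        of keys in the union bound.\<close>
      also have "\<dots> \<le> 2 powr (- (2 ^ s))"
      proof -
        have "2 * 2 ^ s \<le> c' / 4 * (sqrt (real m / 2) * log 2 (real m / 2)) * q * 2 ^ s"
          using e4 unfolding q_def by (rule mult_right_mono) simp
        then show ?thesis by (intro powr_mono) auto
      qed
      also have "\<dots> \<le> 2 powr (- (2 powr (c * sqrt m / 2)))"
      proof -
        have "2 powr (c * sqrt m / 2) \<le> 2 powr real s" using lo[OF j] by (simp add: s_def)
        also have "\<dots> = 2 ^ s" by (simp add: powr_realpow)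
        finally show ?thesis by simp
      qed
      finally show ?thesis .
    qed
    have conf: "E (points m) (\<lambda>Z. of_bool (confusable m r (2 powr (m - sqrt m * log 2 m)) Z)) \<le> 2 powr (- (2 powr (c * sqrt m / 2)))"
    proof -
      have "M1 \<le> m" "rate m r \<le> 1 - eta" using e6 rt bin_entropy_nonneg by auto
      then have "E (points m) (\<lambda>Z. of_bool (confusable m r (2 powr (m - sqrt m * log 2 m)) Z)) \<le> 2 powr (- (2 powr (real m / 4)))"
        by (rule M1)
      also have "\<dots> \<le> 2 powr (- (2 powr (c * sqrt m / 2)))"
        using e1 by (intro powr_mono le_imp_neg_le) auto
      finally show ?thesis .
    qed
    have "E (points m) (\<lambda>Z. 1 - pmf (RMRec2 m r eps (received f Z) c c' P) (Some f)) \<le>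
      E (points m) (\<lambda>Z. of_bool (confusable m r (2 powr (m - sqrt m * log 2 m)) Z)) +
      (\<Sum>j<n. E (points m) (\<lambda>Z. measure_pmf.prob (decode_blocks m r c' n P (received f Z))
        {F. q * 2 ^ card (P j) < real (card (bad_keys m P f F j))}))"
      using RMRec2_fail[OF P f q0 q1] few by (simp add: n_def)
    also have "\<dots> \<le> 2 powr (- (2 powr (c * sqrt m / 2))) + (\<Sum>j<n. 2 powr (- (2 powr (c * sqrt m / 2))))"
      using conf each by (intro add_mono sum_mono) auto
    also have "\<dots> = (1 + real n) * 2 powr (- (2 powr (c * sqrt m / 2)))" by (simp add: algebra_simps)
    also have "\<dots> \<le> (sqrt m / c + 2) * 2 powr (- (2 powr (c * sqrt m / 2)))"
      using n2 by (intro mult_right_mono) auto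
    also have "sqrt m / c + 2 = 2 powr (log 2 (sqrt m / c + 2))"
      using c by (simp add: add_nonneg_pos)
    also have "2 powr (log 2 (sqrt m / c + 2)) * 2 powr (- (2 powr (c * sqrt m / 2))) =
      2 powr (log 2 (sqrt m / c + 2) + - (2 powr (c * sqrt m / 2)))" by (rule powr_add[symmetric])
    also have "\<dots> \<le> 2 powr (- (2 powr (c / 4 * sqrt m)))" using e5 by (intro powr_mono) auto
    finally show "E (points m) (\<lambda>Z. 1 - pmf (RMRec2 m r eps (received f Z) c c' P) (Some f)) \<le> 2 powr (- (2 powr (c / 4 * sqrt m)))" .
  qed
  then show ?thesis using c(1) c'
    by (intro exI[of _ c] exI[of _ c'] exI[of _ "c / 4"] conjI exI[of _ m0]) auto
qed

end

theorem theorem3: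
  fixes eps :: real and m r :: "nat \<Rightarrow> nat"
  assumes "0 < eps" and "eps < 1/2"
    and "\<forall>i. 0 < m i" and "\<forall>i. 0 < r i"
    and "filterlim m at_top sequentially"
    and "limsup (\<lambda>i. ereal (real (binom_le (m i) (r i)) / 2 ^ m i)) < ereal (1 - bin_entropy eps)"
  shows "\<exists>c c' c''. 0 < c \<and> 0 < c' \<and> 0 < c'' \<and>
     (\<forall>P :: nat \<Rightarrow> nat \<Rightarrow> nat set.
        (\<forall>i. balanced_partition (m i) (num_parts (m i) c) (P i)) \<longrightarrow>
        (\<lambda>i. 1 - success_prob (m i) (r i) eps c c' (P i))
          \<in> O(\<lambda>i. 2 powr (- (2 powr (c'' * sqrt (real (m i)))))))"
proof -
  interpret bsc eps using assms(1,2) by unfold_locales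
  \<comment> \<open>A value strictly between the limit superior and capacity yields a uniform gap
    \<open>eta\<close>, from which the constants are obtained.\<close>
  obtain z where z: "limsup (\<lambda>i. ereal (real (binom_le (m i) (r i)) / 2 ^ m i)) < ereal z" "ereal z < ereal (1 - bin_entropy eps)"
    using ereal_dense2[OF assms(6)] by blast
  define eta where "eta = 1 - bin_entropy eps - z"
  have eta: "0 < eta" using z(2) by (simp add: eta_def)
  have "eventually (\<lambda>i. ereal (real (binom_le (m i) (r i)) / 2 ^ m i) < ereal z) sequentially"
    by (rule Limsup_lessD[OF z(1)])
  then have rt: "eventually (\<lambda>i. rate (m i) (r i) \<le> 1 - bin_entropy eps - eta) sequentially"
    by eventually_elim (simp add: rate_def eta_def)
  obtain c c' c'' m0 where c: "0 < c" "0 < c'" "0 < c''"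
    and bound: "\<And>m r P. m0 \<le> m \<Longrightarrow> rate m r \<le> 1 - bin_entropy eps - eta \<Longrightarrow> balanced_partition m (num_parts m c) P \<Longrightarrow>
      1 - success_prob m r eps c c' P \<le> 2 powr (- (2 powr (c'' * sqrt m)))"
    using RMRec2_asymp[OF eta] by blast
  have large: "eventually (\<lambda>i. m0 \<le> m i) sequentially"
    using assms(5) by (simp add: filterlim_at_top)
  have "(\<lambda>i. 1 - success_prob (m i) (r i) eps c c' (P i)) \<in> O(\<lambda>i. 2 powr (- (2 powr (c'' * sqrt (real (m i))))))"
    if P: "\<forall>i. balanced_partition (m i) (num_parts (m i) c) (P i)" for P :: "nat \<Rightarrow> nat \<Rightarrow> nat set"
  proof (rule bigoI[of _ 1])
    show "eventually (\<lambda>i. norm (1 - success_prob (m i) (r i) eps c c' (P i)) \<le> 1 * norm (2 powr (- (2 powr (c'' * sqrt (real (m i))))))) sequentially"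
      using rt large
    proof eventually_elim
      case (elim i)
      have "0 \<le> 1 - success_prob (m i) (r i) eps c c' (P i)" by (simp add: success_prob_def pmf_le_1)
      then show ?case using bound[OF elim(2,1)] P by simp
    qed
  qed
  then show ?thesis using c by blast
qed

end
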